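(* Let $C$ be a finite cyclic group and let $\chi$ be a character of $C$ of order $p^r$ for a prime $p$ and an integer $r\ge1$. Let $K=\mathbb{Q}(\chi(C))$ be the field of definition of $\chi$ (i.e. the field generated over $\mathbb{Q}$ by the values of $\chi$), with ring of integers $\mathcal{O}_K$, and let $\rho:C\to\mathrm{GL}_2(K)$ be $\rho(g)=\begin{pmatrix}1&0\\0&\chi(g)\end{pmatrix}$ (the representation with character $1+\chi$). Then the number of $\mathrm{GL}_2(\mathcal{O}_K)$-conjugacy classes of homomorphisms $\phi:C\to\mathrm{GL}_2(\mathcal{O}_K)$ that are $\mathrm{GL}_2(K)$-conjugate to $\rho$ is $2h_K$, where $h_K$ is the class number of $K$.
   Context: $h_K$ denotes the order of the ideal class group of $K$. Two homomorphisms into $\mathrm{GL}_2(\mathcal{O}_K)$ are identified when conjugate by an element of $\mathrm{GL}_2(\mathcal{O}_K)$. *)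

theory Defs
  imports
    "HOL-Analysis.Analysis"
    "HOL-Algebra.Algebra"
    "HOL-Algebra.Algebraic_Closure_Type"
begin

abbreviation complex_ring :: "complex ring"
  where "complex_ring \<equiv> ring_of_type_algebra"


section \<open>Characters\<close>

text \<open>Functions on a group are represented by their extensional representatives, so that equality
  of functions is equality on the carrier. The order of a character is its \<^const>\<open>group.ord\<close>
  in the following group.\<close>

definition character_group :: "'a monoid \<Rightarrow> ('a \<Rightarrow> complex) monoid" where
  "character_group C =
     \<lparr>carrier = hom C (mult_of complex_ring) \<inter> extensional (carrier C),
      monoid.mult = (\<lambda>chi \<psi>. \<lambda>g\<in>carrier C. chi g * \<psi> g),
      one = (\<lambda>g\<in>carrier C. 1)\<rparr>"

lemma group_character_group:
  assumes "group C"
  shows "group (character_group C)"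
proof (rule groupI)
  interpret C: group C by fact
  note defs = character_group_def hom_def mult_of_def ring_of_type_algebra_def
  fix chi \<psi> \<theta>
  assume chi: "chi \<in> carrier (character_group C)"
  show "\<one>\<^bsub>character_group C\<^esub> \<otimes>\<^bsub>character_group C\<^esub> chi = chi"
    using chi by (auto simp: defs extensional_def fun_eq_iff)
  define chi' where "chi' = (\<lambda>g\<in>carrier C. inverse (chi g))"
  have "chi' \<in> carrier (character_group C)"
    using chi by (auto simp: defs chi'_def)
  moreover have "chi' \<otimes>\<^bsub>character_group C\<^esub> chi = \<one>\<^bsub>character_group C\<^esub>"
    using chi by (auto simp: defs chi'_def fun_eq_iff Pi_iff)
  ultimately show "\<exists>\<eta>\<in>carrier (character_group C).
      \<eta> \<otimes>\<^bsub>character_group C\<^esub> chi = \<one>\<^bsub>character_group C\<^esub>" by blast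
  assume \<psi>: "\<psi> \<in> carrier (character_group C)"
  show "chi \<otimes>\<^bsub>character_group C\<^esub> \<psi> \<in> carrier (character_group C)"
    using chi \<psi> by (auto simp: defs)
  assume "\<theta> \<in> carrier (character_group C)"
  show "chi \<otimes>\<^bsub>character_group C\<^esub> \<psi> \<otimes>\<^bsub>character_group C\<^esub> \<theta> =
        chi \<otimes>\<^bsub>character_group C\<^esub> (\<psi> \<otimes>\<^bsub>character_group C\<^esub> \<theta>)"
    by (auto simp: defs fun_eq_iff)
next
  interpret C: group C by fact
  show "\<one>\<^bsub>character_group C\<^esub> \<in> carrier (character_group C)"
    by (auto simp: character_group_def hom_def mult_of_def ring_of_type_algebra_def)
qed

definition character_field :: "'a monoid \<Rightarrow> ('a \<Rightarrow> complex) \<Rightarrow> complex set" where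
  "character_field C chi = generate_field complex_ring (\<rat> \<union> chi ` carrier C)"


section \<open>Rings of integers and class groups\<close>

text \<open>Number fields are given as subfields of the complex numbers.\<close>

definition integers_of :: "complex set \<Rightarrow> complex set" where
  "integers_of K = {x \<in> K. algebraic_int x}"

definition ring_of_integers :: "complex set \<Rightarrow> complex ring" where
  "ring_of_integers K = complex_ring\<lparr>carrier := integers_of K\<rparr>"

definition fractional_ideals :: "complex set \<Rightarrow> complex set set" where
  "fractional_ideals K =
     {(\<lambda>x. x / d) ` I | I d.
        ideal I (ring_of_integers K) \<and> I \<noteq> {0} \<and> d \<in> integers_of K \<and> d \<noteq> 0}"

text \<open>The product \<^const>\<open>ideal_prod\<close> of two subsets consists of the finite sums of products of
  their elements; it makes sense for fractional ideals, too.\<close>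

definition fractional_ideal_group :: "complex set \<Rightarrow> complex set monoid" where
  "fractional_ideal_group K =
     \<lparr>carrier = fractional_ideals K,
      monoid.mult = ideal_prod complex_ring,
      one = integers_of K\<rparr>"

definition principal_fractional_ideals :: "complex set \<Rightarrow> complex set set" where
  "principal_fractional_ideals K = {(\<lambda>x. a * x) ` integers_of K | a. a \<in> K - {0}}"

definition class_group :: "complex set \<Rightarrow> complex set set monoid" where
  "class_group K = fractional_ideal_group K Mod principal_fractional_ideals K"

definition class_number :: "complex set \<Rightarrow> nat" where
  "class_number K = order (class_group K)"


section \<open>Matrix representations\<close>

definition matrix_monoid :: "complex set \<Rightarrow> (complex^'n^'n) monoid" where
  "matrix_monoid S = \<lparr>carrier = {A. \<forall>i j. A $ i $ j \<in> S}, monoid.mult = (**), one = mat 1\<rparr>"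

text \<open>For a subring \<open>S\<close>, the units of the above are the matrices over \<open>S\<close> whose
  inverse is again a matrix over \<open>S\<close>.\<close>

definition GL :: "complex set \<Rightarrow> (complex^'n^'n) monoid" where
  "GL S = units_of (matrix_monoid S)"

definition conjugate_homs ::
    "('a, 'c) monoid_scheme \<Rightarrow> ('b, 'd) monoid_scheme \<Rightarrow> ('a \<Rightarrow> 'b) \<Rightarrow> ('a \<Rightarrow> 'b) \<Rightarrow> bool" where
  "conjugate_homs C G \<phi> \<psi> \<longleftrightarrow>
     (\<exists>P\<in>carrier G. \<forall>g\<in>carrier C. \<psi> g = P \<otimes>\<^bsub>G\<^esub> \<phi> g \<otimes>\<^bsub>G\<^esub> inv\<^bsub>G\<^esub> P)"

definition one_plus_character :: "'a monoid \<Rightarrow> ('a \<Rightarrow> complex) \<Rightarrow> 'a \<Rightarrow> complex^2^2" where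
  "one_plus_character C chi = (\<lambda>g\<in>carrier C. vector [vector [1, 0], vector [0, chi g]])"

definition integral_forms ::
    "'a monoid \<Rightarrow> complex set \<Rightarrow> ('a \<Rightarrow> complex^'n^'n) \<Rightarrow> ('a \<Rightarrow> complex^'n^'n) set" where
  "integral_forms C K \<rho> =
     {\<phi> \<in> hom C (GL (integers_of K)) \<inter> extensional (carrier C). conjugate_homs C (GL K) \<phi> \<rho>}"

definition integral_form_classes ::
    "'a monoid \<Rightarrow> complex set \<Rightarrow> ('a \<Rightarrow> complex^'n^'n) \<Rightarrow> ('a \<Rightarrow> complex^'n^'n) set set" where
  "integral_form_classes C K \<rho> =
     integral_forms C K \<rho> //
       {(\<phi>, \<psi>). \<phi> \<in> integral_forms C K \<rho> \<and> \<psi> \<in> integral_forms C K \<rho> \<and>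
                conjugate_homs C (GL (integers_of K)) \<phi> \<psi>}"

end

theory Submission
  imports Defs "HOL-Number_Theory.Cong"
begin

text \<open>
  Let \<open>\<zeta>\<close> be the value of the character at a generator of \<open>C\<close>, a primitive \<open>p\<^sup>r\<close>-th root of unity.
  A form is determined by the image \<open>A\<close> of the generator, and \<open>A = 1 + u (-v\<^sub>2, v\<^sub>1)\<close> with eigenvectors
  \<open>v\<close> for \<open>1\<close> and \<open>u\<close> for \<open>\<zeta>\<close>, normalised by \<open>det (v, u) = \<zeta> - 1\<close>; the pair is unique up to scaling
  by \<open>(s, 1/s)\<close>. Its conjugacy class has two invariants: the class of the ideal \<open>J\<close> generated by the
  entries of \<open>v\<close>, and whether \<open>A\<close> is congruent to \<open>1\<close> modulo \<open>1 - \<zeta>\<close>. They are complete, because the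
  residue field modulo \<open>1 - \<zeta>\<close> is the prime field and its nonzero elements lift to the cyclotomic units
  \<open>1 + \<zeta> + \<dots> + \<zeta>\<^sup>a\<close>. They take all values, because a fractional ideal \<open>J\<close> is generated by two elements
  \<open>a\<close>, \<open>b\<close> for which there are \<open>c\<close>, \<open>d\<close> in \<open>J\<inverse>\<close> with \<open>a d - b c = 1\<close>.

  That the ring of integers is \<open>\<int>[\<zeta>]\<close> follows from Eisenstein's argument at \<open>1 - \<zeta>\<close> once the denominators
  are known to divide \<open>p\<^sup>r\<close>, which finite Fourier inversion shows. Invertibility of ideals follows from
  complete integral closedness and the finiteness of the residue rings; the class number is finite by
  Hurwitz' pigeonhole argument.
\<close>


section \<open>Ideals of subrings of the complex numbers\<close>

text \<open>The rank-one matrix \<open>A - 1\<close> has trace \<open>\<zeta> - 1\<close>, and this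
  trace is the determinant of \<open>(v, u)\<close>; hence the normalisation. Let \<open>I\<close>
  be the ideal generated by the entries of \<open>u\<close>. Integrality of \<open>A\<close> says
  that \<open>I J\<close> lies in the ring, and the determinant puts \<open>1 - \<zeta>\<close> into
  \<open>I J\<close>. As \<open>1 - \<zeta>\<close> generates a maximal ideal, \<open>I J\<close> is
  either the whole ring or that ideal: this is the origin of the factor 2. Prime power order enters
  here, since \<open>1 - \<zeta>\<close> is a unit when the order of \<open>\<zeta>\<close> has two
  prime factors. The obstacle is that conjugates are needed before any Galois theory is available. A
  conjugate is the value at a power of \<open>\<zeta>\<close> of an integral polynomial, which
  depends only on the value at \<open>\<zeta>\<close> once the powers of \<open>\<zeta>\<close>
  below the degree are independent. Eisenstein's argument is therefore stated for a ring
  \<open>A\<close> containing \<open>\<int>[\<zeta>]\<close>: with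
  \<open>A = \<int>[\<zeta>]\<close> it yields this independence, with the complete integral closure
  it yields the ring of integers.\<close>

locale complex_subring =
  fixes R :: "complex set"
  assumes one_mem: "1 \<in> R"
    and diff_mem: "\<lbrakk>x \<in> R; y \<in> R\<rbrakk> \<Longrightarrow> x - y \<in> R"
    and mult_mem: "\<lbrakk>x \<in> R; y \<in> R\<rbrakk> \<Longrightarrow> x * y \<in> R"
begin

lemma zero_mem: "0 \<in> R"
  using diff_mem[OF one_mem one_mem] by simp

lemma uminus_mem: "x \<in> R \<Longrightarrow> - x \<in> R"
  using diff_mem[OF zero_mem] by fastforce

lemma add_mem: "\<lbrakk>x \<in> R; y \<in> R\<rbrakk> \<Longrightarrow> x + y \<in> R"
  using diff_mem[OF _ uminus_mem, of x y] by simp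

lemma power_mem: "x \<in> R \<Longrightarrow> x ^ k \<in> R"
  by (induction k) (auto simp: one_mem mult_mem)

lemma sum_mem: "(\<And>i. i \<in> A \<Longrightarrow> f i \<in> R) \<Longrightarrow> sum f A \<in> R"
  by (induction A rule: infinite_finite_induct) (auto simp: zero_mem add_mem)

lemma prod_mem: "(\<And>i. i \<in> A \<Longrightarrow> f i \<in> R) \<Longrightarrow> prod f A \<in> R"
  by (induction A rule: infinite_finite_induct) (auto simp: one_mem mult_mem)

lemma of_nat_mem: "of_nat k \<in> R"
  by (induction k) (auto simp: zero_mem one_mem add_mem)

lemma of_int_mem: "of_int k \<in> R"
  by (cases k) (auto simp: of_nat_mem one_mem diff_mem uminus_mem)

lemmas ring_mems = zero_mem one_mem uminus_mem add_mem diff_mem mult_mem power_mem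
  of_nat_mem of_int_mem

section \<open>Divisibility and the field of fractions\<close>

definition rdvd :: "complex \<Rightarrow> complex \<Rightarrow> bool" where
  "rdvd a x \<longleftrightarrow> (\<exists>s\<in>R. x = a * s)"

lemma rdvd_0: "rdvd a 0"
  unfolding rdvd_def using zero_mem by force

lemma rdvd_mult: "rdvd a x \<Longrightarrow> y \<in> R \<Longrightarrow> rdvd a (x * y)"
  unfolding rdvd_def using mult_mem by (metis mult.assoc)

lemma rdvd_mult': "rdvd a x \<Longrightarrow> y \<in> R \<Longrightarrow> rdvd a (y * x)"
  using rdvd_mult by (simp add: mult.commute)

lemma rdvd_add: "rdvd a x \<Longrightarrow> rdvd a y \<Longrightarrow> rdvd a (x + y)"
  unfolding rdvd_def
proof (elim bexE)
  fix s t assume "s \<in> R" "t \<in> R" "x = a * s" "y = a * t"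
  then show "\<exists>s\<in>R. x + y = a * s"
    by (intro bexI[of _ "s + t"]) (auto simp: distrib_left add_mem)
qed

lemma rdvd_diff: "rdvd a x \<Longrightarrow> rdvd a y \<Longrightarrow> rdvd a (x - y)"
  unfolding rdvd_def
proof (elim bexE)
  fix s t assume "s \<in> R" "t \<in> R" "x = a * s" "y = a * t"
  then show "\<exists>s\<in>R. x - y = a * s"
    by (intro bexI[of _ "s - t"]) (auto simp: right_diff_distrib diff_mem)
qed

definition frac_field :: "complex set" where
  "frac_field = {x / d | x d. x \<in> R \<and> d \<in> R \<and> d \<noteq> 0}"

lemma frac_field_minus: "x \<in> frac_field \<Longrightarrow> - x \<in> frac_field"
  unfolding frac_field_def using uminus_mem minus_divide_left by fastforce

lemma frac_field_mult: 
  assumes "x \<in> frac_field" "y \<in> frac_field"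
  shows "x * y \<in> frac_field"
proof -
  obtain a b c d where "x = a / b" "y = c / d" "a \<in> R" "b \<in> R" "c \<in> R" "d \<in> R" "b \<noteq> 0" "d \<noteq> 0"
    using assms unfolding frac_field_def by blast
  then have "x * y = (a * c) / (b * d)" "a * c \<in> R" "b * d \<in> R" "b * d \<noteq> 0"
    by (auto simp: mult_mem)
  then show ?thesis unfolding frac_field_def by blast
qed

lemma frac_field_add:
  assumes "x \<in> frac_field" "y \<in> frac_field"
  shows "x + y \<in> frac_field"
proof -
  obtain a b c d where "x = a / b" "y = c / d" "a \<in> R" "b \<in> R" "c \<in> R" "d \<in> R" "b \<noteq> 0" "d \<noteq> 0"
    using assms unfolding frac_field_def by blast
  then have "x + y = (a * d + c * b) / (b * d)" "a * d + c * b \<in> R" "b * d \<in> R" "b * d \<noteq> 0"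
    by (auto simp: mult_mem add_mem field_simps)
  then show ?thesis unfolding frac_field_def by blast
qed

lemma frac_field_diff: "x \<in> frac_field \<Longrightarrow> y \<in> frac_field \<Longrightarrow> x - y \<in> frac_field"
  using frac_field_add[OF _ frac_field_minus] by fastforce

lemma frac_field_R: "x \<in> R \<Longrightarrow> x \<in> frac_field"
  unfolding frac_field_def using one_mem by force

lemma frac_field_inverse:
  assumes "x \<in> frac_field" shows "inverse x \<in> frac_field"
proof (cases "x = 0")
  case True
  then show ?thesis using assms by simp
next
  case False
  obtain a b where "x = a / b" "a \<in> R" "b \<in> R" "b \<noteq> 0"
    using assms unfolding frac_field_def by blast
  then have "inverse x = b / a" "a \<noteq> 0" using False by auto
  with \<open>a \<in> R\<close> \<open>b \<in> R\<close> show ?thesis unfolding frac_field_def by blast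
qed

lemma frac_field_divide: "x \<in> frac_field \<Longrightarrow> y \<in> frac_field \<Longrightarrow> x / y \<in> frac_field"
  by (simp add: divide_inverse frac_field_mult frac_field_inverse)

lemmas frac_field_mems = frac_field_minus frac_field_mult frac_field_add frac_field_diff
  frac_field_R frac_field_inverse frac_field_divide

section \<open>Submodules, fractional ideals and their inverses\<close>

definition submodule :: "complex set \<Rightarrow> bool" where
  "submodule J \<longleftrightarrow> 0 \<in> J \<and> (\<forall>x\<in>J. \<forall>y\<in>J. x + y \<in> J) \<and> (\<forall>s\<in>R. \<forall>x\<in>J. s * x \<in> J)"

lemma submodule_0: "submodule J \<Longrightarrow> 0 \<in> J"
  and submodule_add: "submodule J \<Longrightarrow> x \<in> J \<Longrightarrow> y \<in> J \<Longrightarrow> x + y \<in> J"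
  and submodule_mult: "submodule J \<Longrightarrow> s \<in> R \<Longrightarrow> x \<in> J \<Longrightarrow> s * x \<in> J"
  by (auto simp: submodule_def)

lemma submodule_mult': "submodule J \<Longrightarrow> s \<in> R \<Longrightarrow> x \<in> J \<Longrightarrow> x * s \<in> J"
  using submodule_mult by (simp add: mult.commute)

lemma submodule_uminus: "submodule J \<Longrightarrow> x \<in> J \<Longrightarrow> - x \<in> J"
  using submodule_mult[of J "-1" x] by (simp add: uminus_mem one_mem)

lemma submodule_diff: "submodule J \<Longrightarrow> x \<in> J \<Longrightarrow> y \<in> J \<Longrightarrow> x - y \<in> J"
  using submodule_add[of J x "- y"] submodule_uminus by simp

lemma submodule_rdvd: "submodule J \<Longrightarrow> a \<in> J \<Longrightarrow> rdvd a x \<Longrightarrow> x \<in> J"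
  unfolding rdvd_def using submodule_mult' by blast

lemma submodule_image:
  assumes "submodule J" shows "submodule ((*) a ` J)"
  unfolding submodule_def
proof (intro conjI ballI)
  show "0 \<in> (*) a ` J" using submodule_0[OF assms] by force
  show "x + y \<in> (*) a ` J" if "x \<in> (*) a ` J" "y \<in> (*) a ` J" for x y
    using that submodule_add[OF assms] by (auto simp flip: distrib_left)
  show "s * x \<in> (*) a ` J" if "s \<in> R" "x \<in> (*) a ` J" for s x
    using that submodule_mult[OF assms] by (auto simp: mult.left_commute)
qed

definition fractional :: "complex set \<Rightarrow> bool" where
  "fractional J \<longleftrightarrow> submodule J \<and> J \<noteq> {0} \<and> (\<exists>d\<in>R. d \<noteq> 0 \<and> (\<forall>x\<in>J. d * x \<in> R))"

lemma fractional_submodule: "fractional J \<Longrightarrow> submodule J"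
  by (simp add: fractional_def)

lemma fractional_nonzero:
  assumes "fractional J" obtains x where "x \<in> J" "x \<noteq> 0"
  using assms unfolding fractional_def submodule_def by blast

lemma fractional_in_frac_field:
  assumes "fractional J" "x \<in> J" shows "x \<in> frac_field"
proof -
  obtain d where "d \<in> R" "d \<noteq> 0" "d * x \<in> R"
    using assms unfolding fractional_def by blast
  then have "x = (d * x) / d" by simp
  with \<open>d \<in> R\<close> \<open>d \<noteq> 0\<close> \<open>d * x \<in> R\<close> show ?thesis unfolding frac_field_def by blast
qed

lemma fractional_image:
  assumes "fractional J" "a \<in> frac_field" "a \<noteq> 0" shows "fractional ((*) a ` J)"
proof -
  obtain x where x: "x \<in> J" "x \<noteq> 0" by (rule fractional_nonzero[OF assms(1)])
  obtain d where d: "d \<in> R" "d \<noteq> 0" "\<forall>x\<in>J. d * x \<in> R"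
    using assms(1) unfolding fractional_def by blast
  obtain b c where a: "a = b / c" "b \<in> R" "c \<in> R" "c \<noteq> 0"
    using assms(2) unfolding frac_field_def by blast
  have "a * x \<in> (*) a ` J" "a * x \<noteq> 0" using x assms(3) by auto
  then have "(*) a ` J \<noteq> {0}" by blast
  moreover have "c * d * (a * y) \<in> R" if "y \<in> J" for y
  proof -
    have "c * d * (a * y) = b * (d * y)" unfolding a(1) using a(4) by simp
    with that d(3) a(2) mult_mem[of b "d * y"] show ?thesis by metis
  qed
  moreover have "c * d \<in> R" "c * d \<noteq> 0" using a d by (auto simp: mult_mem)
  ultimately show ?thesis
    unfolding fractional_def using submodule_image[OF fractional_submodule[OF assms(1)]] by blast
qed

definition span2 :: "complex \<Rightarrow> complex \<Rightarrow> complex set" where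
  "span2 a b = {s * a + t * b | s t. s \<in> R \<and> t \<in> R}"

lemma span2_gens: "a \<in> span2 a b" "b \<in> span2 a b"
proof -
  have "a = 1 * a + 0 * b" "b = 0 * a + 1 * b" by auto
  then show "a \<in> span2 a b" "b \<in> span2 a b"
    unfolding span2_def using zero_mem one_mem by blast+
qed

lemma submodule_span2: "submodule (span2 a b)"
  unfolding submodule_def
proof (intro conjI ballI)
  show "0 \<in> span2 a b" unfolding span2_def using zero_mem by force
  show "x + y \<in> span2 a b" if xy: "x \<in> span2 a b" "y \<in> span2 a b" for x y
  proof -
    obtain s t s' t' where "x = s * a + t * b" "y = s' * a + t' * b" "s \<in> R" "t \<in> R" "s' \<in> R" "t' \<in> R"
      using xy unfolding span2_def by auto
    then have "x + y = (s + s') * a + (t + t') * b" "s + s' \<in> R" "t + t' \<in> R"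
      by (auto simp: algebra_simps add_mem)
    then show ?thesis unfolding span2_def by blast
  qed
  show "r * x \<in> span2 a b" if rx: "r \<in> R" "x \<in> span2 a b" for r x
  proof -
    obtain s t where "x = s * a + t * b" "s \<in> R" "t \<in> R"
      using rx unfolding span2_def by auto
    then have "r * x = (r * s) * a + (r * t) * b" "r * s \<in> R" "r * t \<in> R"
      using rx by (auto simp: algebra_simps mult_mem)
    then show ?thesis unfolding span2_def by blast
  qed
qed

lemma span2_subset: "submodule J \<Longrightarrow> a \<in> J \<Longrightarrow> b \<in> J \<Longrightarrow> span2 a b \<subseteq> J"
  unfolding span2_def using submodule_add submodule_mult by blast

lemma span2_scale: "(*) c ` span2 a b = span2 (c * a) (c * b)"
proof -
  have "c * (s * a + t * b) = s * (c * a) + t * (c * b)" for s t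
    by (simp add: algebra_simps)
  then show ?thesis unfolding span2_def by (auto 4 4 simp: image_iff)
qed

lemma fractional_span2:
  assumes "a \<in> frac_field" "b \<in> frac_field" "a \<noteq> 0 \<or> b \<noteq> 0"
  shows "fractional (span2 a b)"
proof -
  obtain a1 a2 b1 b2 where ab: "a = a1 / a2" "b = b1 / b2" "a1 \<in> R" "a2 \<in> R" "b1 \<in> R" "b2 \<in> R"
      "a2 \<noteq> 0" "b2 \<noteq> 0"
    using assms unfolding frac_field_def by blast
  have "a2 * b2 * (s * a + t * b) \<in> R" if "s \<in> R" "t \<in> R" for s t
  proof -
    have "a2 * b2 * (s * a + t * b) = s * a1 * b2 + t * b1 * a2"
    proof -
      have "a * a2 = a1" "b * b2 = b1" using ab by auto
      then show ?thesis by (auto simp: algebra_simps)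
    qed
    then show ?thesis using that ab by (simp add: ring_mems)
  qed
  then have "\<forall>x\<in>span2 a b. a2 * b2 * x \<in> R" unfolding span2_def by blast
  moreover have "span2 a b \<noteq> {0}"
  proof
    assume "span2 a b = {0}"
    then have "a = 0" "b = 0" using span2_gens(1)[of a b] span2_gens(2)[of b a] by simp_all
    then show False using assms(3) by simp
  qed
  moreover have "a2 * b2 \<in> R" "a2 * b2 \<noteq> 0" using ab by (auto simp: mult_mem)
  ultimately show ?thesis unfolding fractional_def using submodule_span2 by blast
qed

text \<open>The quotient is formed inside all complex numbers; for fractional \<open>J\<close> it
  lies in \<open>frac_field\<close>, because \<open>J\<close> has a nonzero element to divide
  by.\<close>

definition inv_ideal :: "complex set \<Rightarrow> complex set" where
  "inv_ideal J = {x. \<forall>y\<in>J. x * y \<in> R}"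

lemma submodule_inv_ideal: "submodule (inv_ideal J)"
  unfolding submodule_def inv_ideal_def using zero_mem add_mem mult_mem
  by (simp add: distrib_right mult.assoc)

lemma mult_inv_ideal: "z \<in> J \<Longrightarrow> i \<in> inv_ideal J \<Longrightarrow> z * i \<in> R"
  unfolding inv_ideal_def by (subst mult.commute) simp

text \<open>Zorn's lemma gives \<open>M\<close> maximal among the proper ideals containing
  \<open>Q\<close>. Any \<open>x\<close> outside \<open>M\<close> then satisfies
  \<open>1 = m + x * s\<close>, and the product of two such relations would put 1 into
  \<open>M\<close> if \<open>x * y\<close> were in \<open>M\<close>.\<close>

lemma prime_ideal_above:
  assumes "submodule Q" "Q \<subseteq> R" "1 \<notin> Q"
  obtains M where "submodule M" "M \<subseteq> R" "1 \<notin> M" "Q \<subseteq> M"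
    "\<And>x y. \<lbrakk>x \<in> R; y \<in> R; x * y \<in> M\<rbrakk> \<Longrightarrow> x \<in> M \<or> y \<in> M"
proof -
  define \<A> where "\<A> = {M. submodule M \<and> M \<subseteq> R \<and> 1 \<notin> M \<and> Q \<subseteq> M}"
  have "\<exists>M\<in>\<A>. \<forall>W\<in>\<A>. M \<subseteq> W \<longrightarrow> W = M"
  proof (rule subset_Zorn_nonempty)
    show "\<A> \<noteq> {}" using assms by (auto simp: \<A>_def)
    fix \<C> assume \<C>: "\<C> \<noteq> {}" "subset.chain \<A> \<C>"
    then have sub: "\<C> \<subseteq> \<A>" by (simp add: subset.chain_def)
    have "submodule (\<Union>\<C>)"
      unfolding submodule_def
    proof (intro conjI ballI)
      show "0 \<in> \<Union>\<C>" using \<C>(1) sub submodule_0 unfolding \<A>_def by blast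
      show "x + y \<in> \<Union>\<C>" if xy: "x \<in> \<Union>\<C>" "y \<in> \<Union>\<C>" for x y
      proof -
        obtain W Y where "W \<in> \<C>" "Y \<in> \<C>" "x \<in> W" "y \<in> Y" using xy by blast
        moreover have "W \<subseteq> Y \<or> Y \<subseteq> W"
          using \<C>(2) \<open>W \<in> \<C>\<close> \<open>Y \<in> \<C>\<close> by (auto simp: subset_chain_def)
        ultimately obtain Z where "Z \<in> \<C>" "x \<in> Z" "y \<in> Z" by blast
        then show ?thesis using sub submodule_add unfolding \<A>_def by blast
      qed
      show "s * x \<in> \<Union>\<C>" if "s \<in> R" "x \<in> \<Union>\<C>" for s x
        using that sub submodule_mult unfolding \<A>_def by blast
    qed
    then show "\<Union>\<C> \<in> \<A>" using sub \<C>(1) unfolding \<A>_def by blast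
  qed
  then obtain M where M: "M \<in> \<A>" and max: "\<And>W. W \<in> \<A> \<Longrightarrow> M \<subseteq> W \<Longrightarrow> W = M" by blast
  have subM: "submodule M" and MR: "M \<subseteq> R" and "1 \<notin> M" "Q \<subseteq> M" using M by (auto simp: \<A>_def)
  have ext: "\<exists>m\<in>M. \<exists>s\<in>R. 1 = m + x * s" if x: "x \<in> R" "x \<notin> M" for x
  proof (rule ccontr)
    assume no: "\<not> (\<exists>m\<in>M. \<exists>s\<in>R. 1 = m + x * s)"
    define W where "W = {m + x * s | m s. m \<in> M \<and> s \<in> R}"
    have "submodule W"
      unfolding submodule_def
    proof (intro conjI ballI)
      show "0 \<in> W" unfolding W_def using submodule_0[OF subM] zero_mem by force
      show "y + z \<in> W" if "y \<in> W" "z \<in> W" for y z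
      proof -
        obtain m s m' s' where "y = m + x * s" "z = m' + x * s'" "m \<in> M" "s \<in> R" "m' \<in> M" "s' \<in> R"
          using \<open>y \<in> W\<close> \<open>z \<in> W\<close> unfolding W_def by blast
        then have "y + z = (m + m') + x * (s + s')" "m + m' \<in> M" "s + s' \<in> R"
          using subM by (auto simp: algebra_simps add_mem submodule_add)
        then show ?thesis unfolding W_def by blast
      qed
      show "r * y \<in> W" if "r \<in> R" "y \<in> W" for r y
      proof -
        obtain m s where "y = m + x * s" "m \<in> M" "s \<in> R"
          using \<open>y \<in> W\<close> unfolding W_def by blast
        then have "r * y = r * m + x * (r * s)" "r * m \<in> M" "r * s \<in> R"
          using submodule_mult[OF subM \<open>r \<in> R\<close>] mult_mem[OF \<open>r \<in> R\<close>] by (auto simp: distrib_left)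
        then show ?thesis unfolding W_def by blast
      qed
    qed
    moreover have "M \<subseteq> W"
    proof
      fix m assume "m \<in> M"
      then have "m = m + x * 0" "m \<in> M" "0 \<in> R" using zero_mem by auto
      then show "m \<in> W" unfolding W_def by blast
    qed
    moreover have "x \<in> W"
    proof -
      have "x = 0 + x * 1" by simp
      then show ?thesis unfolding W_def using submodule_0[OF subM] one_mem by blast
    qed
    moreover have "W \<subseteq> R" unfolding W_def using MR x(1) add_mem mult_mem by blast
    moreover have "1 \<notin> W" unfolding W_def using no by blast
    ultimately have "W \<in> \<A>" using \<open>Q \<subseteq> M\<close> unfolding \<A>_def by blast
    then have "W = M" using max \<open>M \<subseteq> W\<close> by blast
    with \<open>x \<in> W\<close> x(2) show False by simp
  qed
  show thesis
  proof (rule that[OF subM MR \<open>1 \<notin> M\<close> \<open>Q \<subseteq> M\<close>])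
    fix x y assume xy: "x \<in> R" "y \<in> R" "x * y \<in> M"
    show "x \<in> M \<or> y \<in> M"
    proof (rule ccontr)
      assume "\<not> (x \<in> M \<or> y \<in> M)"
      then obtain m s m' s' where ms: "m \<in> M" "s \<in> R" "1 = m + x * s" "m' \<in> M" "s' \<in> R" "1 = m' + y * s'"
        using ext xy by meson
      have xys: "x * y \<in> M" by (rule xy(3))
      have "1 = (m + x * s) * (m' + y * s')" using ms(3,6) by simp
      also have "\<dots> = (m' + y * s') * m + ((x * s) * m' + (s * s') * (x * y))"
        by (simp add: algebra_simps)
      also have "\<dots> \<in> M"
        using subsetD[OF MR ms(4)] ms(1,2,4,5) xys xy(1,2)
        by (intro submodule_add[OF subM] submodule_mult[OF subM _ ms(1)] submodule_mult[OF subM _ ms(4)]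
            submodule_mult[OF subM _ xys]) (auto intro: ring_mems)
      finally show False using \<open>1 \<notin> M\<close> by simp
    qed
  qed
qed

end

section \<open>Dedekind subrings: invertible ideals and generation by two elements\<close>

locale dedekind_subring = complex_subring +
  assumes finite_quotient:
      "\<lbrakk>a \<in> R; a \<noteq> 0\<rbrakk> \<Longrightarrow> \<exists>F. finite F \<and> F \<subseteq> R \<and> (\<forall>y\<in>R. \<exists>x\<in>F. rdvd a (y - x))"
    and completely_integrally_closed:
      "\<lbrakk>a \<in> R; a \<noteq> 0; \<And>k. a * x ^ k \<in> R\<rbrakk> \<Longrightarrow> x \<in> R"
begin

text \<open>Pigeonhole on the powers of \<open>z\<close> modulo \<open>a\<close>. The point is that
  the bound \<open>c\<close> does not depend on \<open>z\<close>, so that \<open>fact c\<close>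
  later serves as one exponent for all \<open>z\<close>.\<close>

lemma power_cong_bounded:
  assumes "a \<in> R" "a \<noteq> 0"
  obtains c :: nat where "\<And>z. z \<in> R \<Longrightarrow> \<exists>i j. i < j \<and> j \<le> c \<and> rdvd a (z ^ i - z ^ j)"
proof -
  obtain F where F: "finite F" "F \<subseteq> R" "\<forall>y\<in>R. \<exists>x\<in>F. rdvd a (y - x)"
    using finite_quotient[OF assms] by blast
  have "\<exists>i j. i < j \<and> j \<le> card F \<and> rdvd a (z ^ i - z ^ j)" if "z \<in> R" for z
  proof -
    have "\<forall>i. \<exists>x. x \<in> F \<and> rdvd a (z ^ i - x)" using F(3) power_mem[OF that] by blast
    then obtain f where f: "\<And>i. f i \<in> F" "\<And>i. rdvd a (z ^ i - f i)" by metis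
    have "card (f ` {..card F}) \<le> card F" using F(1) f(1) by (intro card_mono) auto
    then have "\<not> inj_on f {..card F}" by (intro pigeonhole) simp
    then obtain i j where "i \<le> card F" "j \<le> card F" "i \<noteq> j" "f i = f j"
      unfolding inj_on_def by auto
    then obtain i j where ij: "i < j" "j \<le> card F" "f i = f j"
      by (metis linorder_neq_iff)
    have "z ^ i - z ^ j = (z ^ i - f i) - (z ^ j - f j)" using ij(3) by simp
    then have "rdvd a (z ^ i - z ^ j)" using rdvd_diff f(2) by metis
    with ij show ?thesis by blast
  qed
  with that show thesis by blast
qed

text \<open>A proper ideal containing \<open>a\<close> is annihilated by a nonzero element of the finite ring \<open>R / a\<close>:
  some \<open>u \<in> 1 + B\<close> makes all elements of \<open>B\<close> nilpotent, and from there one multiplies by elements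
  of \<open>B\<close> as long as the result stays nonzero.\<close>

lemma annihilator_mod:
  assumes B: "submodule B" "B \<subseteq> R" "1 \<notin> B" and a: "a \<in> B" "a \<noteq> 0"
  obtains b where "b \<in> R" "\<not> rdvd a b" "\<And>x. x \<in> B \<Longrightarrow> rdvd a (b * x)"
proof -
  have aR: "a \<in> R" using a B by blast
  obtain F where F: "finite F" "F \<subseteq> R" "\<forall>y\<in>R. \<exists>x\<in>F. rdvd a (y - x)"
    using finite_quotient[OF aR a(2)] by blast
  define W where "W = F \<inter> B"
  have W: "finite W" "W \<subseteq> B" using F by (auto simp: W_def)
  have Wrep: "\<exists>x\<in>W. rdvd a (y - x)" if y: "y \<in> B" for y
  proof -
    obtain x where x: "x \<in> F" "rdvd a (y - x)" using bspec[OF F(3) subsetD[OF B(2) y]] ..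
    then have "y - (y - x) \<in> B"
      by (intro submodule_diff[OF B(1) y] submodule_rdvd[OF B(1) a(1)])
    then show ?thesis using x unfolding W_def by auto
  qed
  \<comment> \<open>A coincidence of powers modulo \<open>a\<close> factors as
    \<open>(1 - x ^ (j - i)) * x ^ i\<close>, and the first factor is the wanted
    \<open>u\<close>.\<close>
  have pow: "\<exists>u e. u \<in> R \<and> 1 - u \<in> B \<and> rdvd a (u * x ^ e)" if x: "x \<in> B" for x
  proof -
    obtain i j where ij: "i < j" "rdvd a (x ^ i - x ^ j)"
      by (rule power_cong_bounded[OF aR a(2)]) (use x B(2) in blast)
    have eq: "x ^ i - x ^ j = (1 - x ^ (j - i)) * x ^ i"
      using ij(1) by (simp add: algebra_simps flip: power_add)
    have "x ^ (j - i) = x ^ (j - i - 1) * x"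
      using ij(1) by (cases "j - i") (simp_all add: power_Suc2 del: power_Suc)
    also have "\<dots> \<in> B" using x B by (intro submodule_mult power_mem) auto
    finally have "1 - (1 - x ^ (j - i)) \<in> B" by simp
    moreover have "1 - x ^ (j - i) \<in> R" using x B(2) by (intro ring_mems) auto
    ultimately show ?thesis using ij(2) eq by metis
  qed
  have "\<exists>u. u \<in> R \<and> 1 - u \<in> B \<and> (\<forall>x\<in>Y. \<exists>e. rdvd a (u * x ^ e))" if "finite Y" "Y \<subseteq> B" for Y
    using that
  proof (induction Y)
    case empty
    show ?case using one_mem submodule_0[OF B(1)] by force
  next
    case (insert x Y)
    then obtain u where u: "u \<in> R" "1 - u \<in> B" "\<forall>x\<in>Y. \<exists>e. rdvd a (u * x ^ e)" by auto
    obtain w e where w: "w \<in> R" "1 - w \<in> B" "rdvd a (w * x ^ e)" using pow insert by blast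
    have "1 - u * w = (1 - u) + u * (1 - w)" by (simp add: algebra_simps)
    then have "1 - u * w \<in> B" using u w B(1) by (metis submodule_add submodule_mult)
    moreover have "\<exists>e. rdvd a (u * w * y ^ e)" if y: "y \<in> insert x Y" for y
    proof (cases "y = x")
      case True
      then show ?thesis using rdvd_mult'[OF w(3) u(1)] by (auto simp: ac_simps)
    next
      case False
      then obtain e where "rdvd a (u * y ^ e)" using u(3) y by blast
      then show ?thesis using rdvd_mult'[OF _ w(1)] by (metis mult.assoc mult.left_commute)
    qed
    ultimately show ?case using mult_mem[OF u(1) w(1)] by blast
  qed
  then obtain u where u: "u \<in> R" "1 - u \<in> B" "\<forall>x\<in>W. \<exists>e. rdvd a (u * x ^ e)" using W by blast
  have nu: "\<not> rdvd a u"
  proof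
    assume "rdvd a u"
    then have "u \<in> B" using submodule_rdvd B(1) a(1) by blast
    then have "(1 - u) + u \<in> B" using u(2) B(1) submodule_add by blast
    then show False using B(3) by simp
  qed
  have "\<exists>b. b \<in> R \<and> \<not> rdvd a b \<and> (\<forall>x\<in>W. \<exists>e. rdvd a (b * x ^ e)) \<and> (\<forall>x\<in>Y. rdvd a (b * x))"
    if "finite Y" "Y \<subseteq> W" for Y
    using that
  proof (induction Y)
    case empty
    show ?case using u nu by blast
  next
    case (insert x Y)
    then obtain b where b: "b \<in> R" "\<not> rdvd a b" "\<forall>x\<in>W. \<exists>e. rdvd a (b * x ^ e)"
      "\<forall>x\<in>Y. rdvd a (b * x)" by auto
    have xR: "x \<in> R" using insert W B by blast
    \<comment> \<open>With \<open>e\<close> minimal, multiplying \<open>b\<close> by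
      \<open>x ^ (e - 1)\<close> keeps it nonzero modulo \<open>a\<close>, while one more factor
      \<open>x\<close> gives zero.\<close>
    define e where "e = (LEAST e. rdvd a (b * x ^ e))"
    have e: "rdvd a (b * x ^ e)"
      unfolding e_def using b(3) insert by (metis (no_types, lifting) LeastI_ex insert_subset)
    have "e \<noteq> 0" using e b(2) by (intro notI) simp
    then obtain e' where e': "e = Suc e'" using not0_implies_Suc by blast
    have "e' < e" using e' by simp
    then have "\<not> rdvd a (b * x ^ e')" unfolding e_def by (rule not_less_Least)
    moreover have "b * x ^ e' \<in> R" using b xR by (simp add: ring_mems)
    moreover have "\<forall>y\<in>W. \<exists>e. rdvd a (b * x ^ e' * y ^ e)"
      using b(3) rdvd_mult[OF _ power_mem[OF xR]] by (metis mult.assoc mult.commute)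
    moreover have "rdvd a (b * x ^ e' * y)" if "y \<in> insert x Y" for y
    proof (cases "y = x")
      case True
      then show ?thesis using e e' by (simp add: ac_simps)
    next
      case False
      then have "rdvd a (b * y)" using b(4) that by blast
      then show ?thesis using rdvd_mult[OF _ power_mem[OF xR]] by (metis mult.assoc mult.commute)
    qed
    ultimately show ?case by blast
  qed
  then obtain b where b: "b \<in> R" "\<not> rdvd a b" "\<forall>x\<in>W. rdvd a (b * x)" using W by blast
  show thesis
  proof (rule that[OF b(1,2)])
    fix y assume "y \<in> B"
    then obtain x where x: "x \<in> W" "rdvd a (y - x)" using Wrep by blast
    have "b * y = b * (y - x) + b * x" by (simp add: algebra_simps)
    then show "rdvd a (b * y)"
      using rdvd_add rdvd_mult'[OF x(2) b(1)] b(3) x(1) by metis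
  qed
qed

text \<open>Suppose \<open>J\<close> times its inverse is a proper ideal \<open>B\<close>. It
  contains \<open>j * d\<close> for a nonzero \<open>j\<close> in \<open>J\<close> and a denominator
  \<open>d\<close>, and an annihilator \<open>b\<close> modulo \<open>j * d\<close> gives
  \<open>y = b / (j * d)\<close> outside \<open>R\<close> with \<open>y B\<close> inside
  \<open>R\<close>. So \<open>y\<close> maps \<open>inv_ideal J\<close> into itself, all
  \<open>y ^ k * d\<close> lie there, and \<open>j * d\<close> is a common denominator of the powers
  of \<open>y\<close>; complete integral closedness then forces \<open>y\<close> into
  \<open>R\<close>.\<close>

lemma fractional_invertible:
  assumes "fractional J"
  shows "1 \<in> ideal_prod complex_ring J (inv_ideal J)"
proof (rule ccontr)
  let ?B = "ideal_prod complex_ring J (inv_ideal J)"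
  assume "1 \<notin> ?B"
  note subJ = fractional_submodule[OF assms]
  have mult_eq [simp]: "x \<otimes>\<^bsub>complex_ring\<^esub> y = x * y" "x \<oplus>\<^bsub>complex_ring\<^esub> y = x + y" for x y
    by (auto simp: ring_of_type_algebra_def)
  have prod_mem: "x * y \<in> ?B" if "x \<in> J" "y \<in> inv_ideal J" for x y
    using ideal_prod.prod[OF that, of complex_ring] by simp
  have sum_mem: "x + y \<in> ?B" if "x \<in> ?B" "y \<in> ?B" for x y
    using ideal_prod.sum[OF that] by simp
  have BR: "?B \<subseteq> R"
  proof
    fix x assume "x \<in> ?B"
    then show "x \<in> R"
      by induction (auto simp: inv_ideal_def add_mem mult.commute)
  qed
  have "s * x \<in> ?B" if "x \<in> ?B" "s \<in> R" for s x
    using that(1)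
  proof induction
    case (prod i j)
    show ?case using prod_mem[OF submodule_mult[OF subJ that(2) prod(1)] prod(2)] by (simp add: mult.assoc)
  next
    case (sum x y)
    then show ?case using sum_mem by (simp add: distrib_left)
  qed
  moreover have "0 \<in> ?B" using prod_mem[OF submodule_0[OF subJ] submodule_0[OF submodule_inv_ideal]] by simp
  ultimately have subB: "submodule ?B" using sum_mem unfolding submodule_def by blast
  obtain d where d: "d \<in> R" "d \<noteq> 0" "\<forall>x\<in>J. d * x \<in> R"
    using assms unfolding fractional_def by blast
  obtain j where j: "j \<in> J" "j \<noteq> 0" by (rule fractional_nonzero[OF assms])
  have dJ: "d \<in> inv_ideal J" using d by (simp add: inv_ideal_def)
  have jd: "j * d \<in> ?B" "j * d \<noteq> 0" using prod_mem[OF j(1) dJ] j d by auto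
  obtain b where b: "b \<in> R" "\<not> rdvd (j * d) b" "\<And>x. x \<in> ?B \<Longrightarrow> rdvd (j * d) (b * x)"
    using annihilator_mod[OF subB BR \<open>1 \<notin> ?B\<close> jd] by blast
  define y where "y = b / (j * d)"
  have yB: "y * x \<in> R" if x: "x \<in> ?B" for x
  proof -
    obtain s where "s \<in> R" "b * x = (j * d) * s" using b(3)[OF x] unfolding rdvd_def by blast
    then show ?thesis using jd(2) by (simp add: y_def field_simps)
  qed
  have "y * i \<in> inv_ideal J" if "i \<in> inv_ideal J" for i
    unfolding inv_ideal_def
  proof safe
    fix x assume "x \<in> J"
    then have "y * (x * i) \<in> R" using yB prod_mem that by blast
    then show "y * i * x \<in> R" by (simp add: ac_simps)
  qed
  then have "y ^ k * d \<in> inv_ideal J" for k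
    by (induction k) (auto simp: dJ mult.assoc)
  then have "j * (y ^ k * d) \<in> R" for k
    by (rule mult_inv_ideal[OF j(1)])
  then have "j * d * y ^ k \<in> R" for k
    by (simp add: ac_simps)
  then have "y \<in> R" using completely_integrally_closed jd BR by blast
  then have "rdvd (j * d) b" unfolding rdvd_def y_def using jd(2) by (intro bexI[of _ y]) (auto simp: y_def)
  with b(2) show False by simp
qed

primrec list_span :: "complex list \<Rightarrow> complex set" where
  "list_span [] = {0}"
| "list_span (x # xs) = {s * x + y | s y. s \<in> R \<and> y \<in> list_span xs}"

lemma list_span_subset: "submodule J \<Longrightarrow> set xs \<subseteq> J \<Longrightarrow> list_span xs \<subseteq> J"
  by (induction xs) (auto simp: submodule_0 submodule_add submodule_mult)

text \<open>From \<open>1\<close> as a sum of products \<open>x * y\<close> with \<open>x\<close> in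
  \<open>J\<close> and \<open>y\<close> in the inverse, every \<open>z\<close> in \<open>J\<close>
  is the sum of the \<open>(z * y) * x\<close>, so the finitely many \<open>x\<close>
  generate.\<close>

lemma fractional_finitely_generated:
  assumes "fractional J"
  obtains xs where "J = list_span xs"
proof -
  have mult_eq: "x \<otimes>\<^bsub>complex_ring\<^esub> y = x * y" "x \<oplus>\<^bsub>complex_ring\<^esub> y = x + y" for x y
    by (auto simp: ring_of_type_algebra_def)
  have "\<exists>ps. set ps \<subseteq> J \<times> inv_ideal J \<and> s = (\<Sum>(x, y)\<leftarrow>ps. x * y)"
    if "s \<in> ideal_prod complex_ring J (inv_ideal J)" for s
    using that
  proof induction
    case (prod i j)
    then show ?case by (intro exI[of _ "[(i, j)]"]) (simp add: mult_eq)
  next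
    case (sum s1 s2)
    then obtain ps qs where "set ps \<subseteq> J \<times> inv_ideal J" "s1 = (\<Sum>(x, y)\<leftarrow>ps. x * y)"
      "set qs \<subseteq> J \<times> inv_ideal J" "s2 = (\<Sum>(x, y)\<leftarrow>qs. x * y)" by blast
    then show ?case by (intro exI[of _ "ps @ qs"]) (simp add: mult_eq)
  qed
  from this[OF fractional_invertible[OF assms]]
  obtain ps where ps: "set ps \<subseteq> J \<times> inv_ideal J" "1 = (\<Sum>(x, y)\<leftarrow>ps. x * y)" by blast
  have *: "z * (\<Sum>(x, y)\<leftarrow>qs. x * y) \<in> list_span (map fst qs)"
    if z: "z \<in> J" and "set qs \<subseteq> J \<times> inv_ideal J" for z qs
    using that(2)
  proof (induction qs)
    case Nil
    show ?case by simp
  next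
    case (Cons q qs)
    obtain x y where q: "q = (x, y)" by (cases q)
    have "z * y \<in> R" using Cons.prems z unfolding q by (auto intro: mult_inv_ideal)
    moreover have "z * (\<Sum>(x, y)\<leftarrow>q # qs. x * y) = (z * y) * x + z * (\<Sum>(x, y)\<leftarrow>qs. x * y)"
      by (simp add: q algebra_simps)
    moreover have "z * (\<Sum>(x, y)\<leftarrow>qs. x * y) \<in> list_span (map fst qs)"
      using Cons by simp
    ultimately show ?case unfolding q by auto
  qed
  have "J \<subseteq> list_span (map fst ps)" using *[OF _ ps(1)] ps(2) by force
  moreover have "list_span (map fst ps) \<subseteq> J"
    using ps(1) by (intro list_span_subset fractional_submodule[OF assms]) auto
  ultimately show thesis using that by blast
qed

lemma ideal_prod_span3:
  assumes "L = {s * a + t * x + u * y | s t u. s \<in> R \<and> t \<in> R \<and> u \<in> R}"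
    and "z \<in> ideal_prod complex_ring L (inv_ideal L)"
  obtains b0 b1 b2 where "b0 \<in> inv_ideal L" "b1 \<in> inv_ideal L" "b2 \<in> inv_ideal L"
    "z = a * b0 + x * b1 + y * b2"
proof -
  note sub = submodule_inv_ideal[of L]
  have "\<exists>b0 b1 b2. b0 \<in> inv_ideal L \<and> b1 \<in> inv_ideal L \<and> b2 \<in> inv_ideal L \<and> z = a * b0 + x * b1 + y * b2"
    using assms(2)
  proof induction
    case (prod i j)
    then obtain s t u where i: "i = s * a + t * x + u * y" "s \<in> R" "t \<in> R" "u \<in> R"
      using assms(1) by auto
    have "i \<otimes>\<^bsub>complex_ring\<^esub> j = a * (s * j) + x * (t * j) + y * (u * j)"
      by (simp add: i(1) ring_of_type_algebra_def algebra_simps)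
    moreover have "s * j \<in> inv_ideal L" "t * j \<in> inv_ideal L" "u * j \<in> inv_ideal L"
      using submodule_mult[OF sub _ prod(2)] i by auto
    ultimately show ?case by blast
  next
    case (sum s1 s2)
    then obtain b0 b1 b2 c0 c1 c2 where b: "b0 \<in> inv_ideal L" "b1 \<in> inv_ideal L" "b2 \<in> inv_ideal L"
      "c0 \<in> inv_ideal L" "c1 \<in> inv_ideal L" "c2 \<in> inv_ideal L"
      and eq: "s1 = a * b0 + x * b1 + y * b2" "s2 = a * c0 + x * c1 + y * c2" by blast
    have "s1 \<oplus>\<^bsub>complex_ring\<^esub> s2 = a * (b0 + c0) + x * (b1 + c1) + y * (b2 + c2)"
      by (simp add: eq ring_of_type_algebra_def algebra_simps)
    moreover have "b0 + c0 \<in> inv_ideal L" "b1 + c1 \<in> inv_ideal L" "b2 + c2 \<in> inv_ideal L"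
      using submodule_add[OF sub] b by auto
    ultimately show ?case by blast
  qed
  then show thesis using that by blast
qed

text \<open>As \<open>z\<close> is outside the prime \<open>M\<close>, the factor
  \<open>z ^ i\<close> cancels and \<open>z ^ (j - i)\<close> is 1 modulo \<open>M\<close>. The
  exponent \<open>fact c\<close> is a multiple of every possible \<open>j - i\<close>.\<close>

lemma power_cong_1_mod_prime:
  assumes "submodule M" "M \<subseteq> R" "\<And>x y. \<lbrakk>x \<in> R; y \<in> R; x * y \<in> M\<rbrakk> \<Longrightarrow> x \<in> M \<or> y \<in> M"
    and "a \<in> M" "z \<in> R" "z \<notin> M" "i < j" "j \<le> c" "rdvd a (z ^ i - z ^ j)"
  shows "1 - z ^ fact c \<in> M"
proof -
  have M1: "z ^ i - z ^ j \<in> M" using submodule_rdvd assms by blast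
  have eq: "z ^ i - z ^ j = z ^ i * (1 - z ^ (j - i))"
    using assms by (simp add: algebra_simps flip: power_add)
  \<comment> \<open>The alternative \<open>1 \<in> M\<close> only makes the induction start; it is
    excluded next, since it would put \<open>z\<close> into \<open>M\<close>.\<close>
  have "z ^ k \<notin> M \<or> 1 \<in> M" for k
  proof (induction k)
    case (Suc k)
    then show ?case using assms(3)[OF assms(5) power_mem[OF assms(5)], of k] assms(6)
        submodule_mult[OF assms(1) assms(5), of 1] by auto
  qed simp
  then have zi: "z ^ i \<notin> M"
    using submodule_mult[OF assms(1) assms(5), of 1] assms(6) by auto
  have w: "1 - z ^ (j - i) \<in> M"
    using assms(3)[of "z ^ i" "1 - z ^ (j - i)"] M1 zi eq assms(5) by (simp add: ring_mems)
  have "(j - i) dvd fact c" using assms(7,8) by (intro dvd_fact) auto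
  then obtain l where l: "fact c = (j - i) * l" by blast
  have "1 - (z ^ (j - i)) ^ l \<in> M"
  proof (induction l)
    case 0
    show ?case using submodule_0[OF assms(1)] by simp
  next
    case (Suc l)
    have "1 - (z ^ (j - i)) ^ Suc l = (1 - (z ^ (j - i)) ^ l) + (z ^ (j - i)) ^ l * (1 - z ^ (j - i))"
      by (simp add: algebra_simps)
    also have "\<dots> \<in> M"
      using Suc w assms(1,5) by (intro submodule_add submodule_mult power_mem) auto
    finally show ?case .
  qed
  then show ?thesis by (simp add: l power_mult)
qed

text \<open>At a prime containing \<open>a L\<inverse>\<close>, the element \<open>t\<close> below is \<open>0\<close> if \<open>x\<close> generates \<open>L\<close> locally
  and \<open>1\<close> otherwise, in which case \<open>y\<close> is a local generator. So \<open>x + t y\<close> generates \<open>L\<close> modulo \<open>a\<close>.\<close>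

lemma three_generators_to_two:
  assumes L: "L = {s * a + t * x + u * y | s t u. s \<in> R \<and> t \<in> R \<and> u \<in> R}"
    and frac: "fractional L" and "a \<noteq> 0"
  obtains w where "L = span2 a w"
proof -
  define I where "I = inv_ideal L"
  have subI: "submodule I" unfolding I_def by (rule submodule_inv_ideal)
  have subL: "submodule L" by (rule fractional_submodule[OF frac])
  obtain b0 b1 b2 where b: "b0 \<in> I" "b1 \<in> I" "b2 \<in> I" "1 = a * b0 + x * b1 + y * b2"
    using ideal_prod_span3[OF L fractional_invertible[OF frac]] unfolding I_def by metis
  have "a = 1 * a + 0 * x + 0 * y" "x = 0 * a + 1 * x + 0 * y" "y = 0 * a + 0 * x + 1 * y" by auto
  then have gens: "a \<in> L" "x \<in> L" "y \<in> L"
    unfolding L using zero_mem one_mem by blast+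
  have LI: "z * i \<in> R" if "z \<in> L" "i \<in> I" for z i
    using that unfolding I_def by (rule mult_inv_ideal)
  obtain d where d: "d \<in> R" "d \<noteq> 0" "\<forall>x\<in>L. d * x \<in> R"
    using frac unfolding fractional_def by blast
  have dI: "d \<in> I" using d by (simp add: I_def inv_ideal_def)
  have adR: "a * d \<in> R" "a * d \<noteq> 0" using LI[OF gens(1) dI] d assms(3) by auto
  \<comment> \<open>Every prime containing the ideal \<open>Q\<close> below contains
    \<open>a * d\<close>, because \<open>d\<close> lies in \<open>I\<close>; so this single
    \<open>c\<close> serves at all of them.\<close>
  obtain c where c: "\<And>z. z \<in> R \<Longrightarrow> \<exists>i j. i < j \<and> j \<le> c \<and> rdvd (a * d) (z ^ i - z ^ j)"
    using power_cong_bounded[OF adR] by blast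
  define N :: nat where "N = fact c"
  have "N \<noteq> 0" by (simp add: N_def)
  define t where "t = (1 - (x * b1) ^ N) * (1 - (x * b2) ^ N)"
  have tR: "t \<in> R" unfolding t_def
    by (intro mult_mem[OF diff_mem[OF one_mem power_mem] diff_mem[OF one_mem power_mem]] LI gens b)
  define w where "w = x + t * y"
  have wL: "w \<in> L" unfolding w_def using gens tR by (intro submodule_add[OF subL] submodule_mult[OF subL])
  \<comment> \<open>This is \<open>span2 a w\<close> times the inverse of \<open>L\<close>. If it
    contains 1, multiplying that relation by elements of \<open>L\<close> gives
    \<open>L = span2 a w\<close>.\<close>
  define Q where "Q = {w * i + a * i' | i i'. i \<in> I \<and> i' \<in> I}"
  have "submodule Q"
    unfolding submodule_def
  proof (intro conjI ballI)
    show "0 \<in> Q" unfolding Q_def using submodule_0[OF subI] by force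
    show "z + z' \<in> Q" if z: "z \<in> Q" "z' \<in> Q" for z z'
    proof -
      obtain i i' j j' where "z = w * i + a * i'" "z' = w * j + a * j'" "i \<in> I" "i' \<in> I" "j \<in> I" "j' \<in> I"
        using z unfolding Q_def by blast
      then have "z + z' = w * (i + j) + a * (i' + j')" "i + j \<in> I" "i' + j' \<in> I"
        using submodule_add[OF subI] by (auto simp: algebra_simps)
      then show ?thesis unfolding Q_def by blast
    qed
    show "s * z \<in> Q" if z: "s \<in> R" "z \<in> Q" for s z
    proof -
      obtain i i' where "z = w * i + a * i'" "i \<in> I" "i' \<in> I"
        using z unfolding Q_def by blast
      then have "s * z = w * (s * i) + a * (s * i')" "s * i \<in> I" "s * i' \<in> I"
        using submodule_mult[OF subI z(1)] by (auto simp: algebra_simps)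
      then show ?thesis unfolding Q_def by blast
    qed
  qed
  have "Q \<subseteq> R" unfolding Q_def using LI wL gens(1) add_mem by blast
  have wQ: "w * i \<in> Q" if "i \<in> I" for i
  proof -
    have "w * i = w * i + a * 0" by simp
    then show ?thesis unfolding Q_def using that submodule_0[OF subI] by blast
  qed
  have aQ: "a * i \<in> Q" if "i \<in> I" for i
  proof -
    have "a * i = w * 0 + a * i" by simp
    then show ?thesis unfolding Q_def using that submodule_0[OF subI] by blast
  qed
  have "1 \<in> Q"
  proof (rule ccontr)
    assume "1 \<notin> Q"
    obtain M where M: "submodule M" "M \<subseteq> R" "1 \<notin> M" "Q \<subseteq> M"
      and prime: "\<And>x y. \<lbrakk>x \<in> R; y \<in> R; x * y \<in> M\<rbrakk> \<Longrightarrow> x \<in> M \<or> y \<in> M"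
      using prime_ideal_above[OF \<open>submodule Q\<close> \<open>Q \<subseteq> R\<close> \<open>1 \<notin> Q\<close>] by blast
    have adM: "a * d \<in> M" using aQ[OF dI] M(4) by blast
    have pow: "1 - z ^ N \<in> M" if z: "z \<in> R" "z \<notin> M" for z
    proof -
      obtain i j where ij: "i < j" "j \<le> c" "rdvd (a * d) (z ^ i - z ^ j)" using c[OF z(1)] by blast
      show ?thesis
        unfolding N_def by (rule power_cong_1_mod_prime[OF M(1,2) prime adM z ij])
    qed
    note xb = LI[OF gens(2) b(2)] LI[OF gens(2) b(3)] and yb = LI[OF gens(3) b(2)] LI[OF gens(3) b(3)]
    have tM: "t \<in> M" if "x * b1 \<notin> M \<or> x * b2 \<notin> M"
    proof -
      have "1 - (x * b1) ^ N \<in> M \<or> 1 - (x * b2) ^ N \<in> M" using that pow xb by blast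
      moreover have "1 - (x * b1) ^ N \<in> R" "1 - (x * b2) ^ N \<in> R" using xb by (auto intro: ring_mems)
      ultimately show ?thesis unfolding t_def
        using submodule_mult[OF M(1)] submodule_mult'[OF M(1)] by blast
    qed
    have xM: "x * i \<in> M" if i: "i \<in> I" "t \<in> M" for i
    proof -
      have "x * i = w * i - t * (y * i)" by (simp add: w_def algebra_simps)
      also have "\<dots> \<in> M"
        using wQ[OF i(1)] M(4) submodule_mult'[OF M(1) LI[OF gens(3) i(1)] i(2)]
        by (intro submodule_diff[OF M(1)]) auto
      finally show ?thesis .
    qed
    \<comment> \<open>If one of the two were outside \<open>M\<close>, then \<open>t\<close> would
      lie in \<open>M\<close>, so \<open>w\<close> and \<open>x\<close> would agree there and both
      products would lie in \<open>M\<close> after all.\<close>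
    have xbM: "x * b1 \<in> M" "x * b2 \<in> M" using tM xM b by blast+
    have powM: "z ^ N \<in> M" if "z \<in> M" for z
    proof -
      have "z ^ N = z ^ (N - 1) * z" using \<open>N \<noteq> 0\<close> by (simp flip: power_Suc2)
      then show ?thesis using that M(2) submodule_mult[OF M(1) power_mem, of z z] by auto
    qed
    have t1: "1 - t \<in> M"
    proof -
      have "1 - t = (x * b1) ^ N + (1 - (x * b1) ^ N) * (x * b2) ^ N"
        by (simp add: t_def algebra_simps)
      also have "\<dots> \<in> M"
        using powM[OF xbM(1)] powM[OF xbM(2)] xb M(1)
        by (intro submodule_add submodule_mult) (auto intro: ring_mems)
      finally show ?thesis .
    qed
    have "y * b2 = (w * b2 - x * b2) + (1 - t) * (y * b2)" by (simp add: w_def algebra_simps)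
    also have "\<dots> \<in> M"
      using wQ[OF b(3)] M(4) xbM(2) submodule_mult'[OF M(1) yb(2) t1]
      by (intro submodule_add[OF M(1)] submodule_diff[OF M(1)]) auto
    finally have "a * b0 + x * b1 + y * b2 \<in> M"
      using aQ[OF b(1)] M(4) xbM(1) by (intro submodule_add[OF M(1)]) auto
    then show False using b(4) M(3) by simp
  qed
  then obtain i i' where i: "1 = w * i + a * i'" "i \<in> I" "i' \<in> I" unfolding Q_def by blast
  have "L \<subseteq> span2 a w"
  proof
    fix z assume "z \<in> L"
    have "z = z * (w * i + a * i')" using i(1) by simp
    also have "\<dots> = (z * i') * a + (z * i) * w" by (simp add: algebra_simps)
    finally show "z \<in> span2 a w" unfolding span2_def using LI[OF \<open>z \<in> L\<close>] i by blast
  qed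
  moreover have "span2 a w \<subseteq> L" by (rule span2_subset[OF subL gens(1) wL])
  ultimately show thesis using that by blast
qed

text \<open>A nonzero \<open>a\<close> in \<open>J\<close> is kept throughout, and
  \<open>three_generators_to_two\<close> absorbs the members of a finite generating list one at a
  time into the second generator, which starts as the placeholder 0.\<close>

lemma fractional_two_generators:
  assumes "fractional J"
  obtains a b where "a \<noteq> 0" "J = span2 a b"
proof -
  obtain a where a: "a \<in> J" "a \<noteq> 0" by (rule fractional_nonzero[OF assms])
  have subJ: "submodule J" by (rule fractional_submodule[OF assms])
  obtain xs where xs: "J = list_span xs" by (rule fractional_finitely_generated[OF assms])
  have "\<exists>w. J = span2 a w" if "J = {s * a + t * x + z | s t z. s \<in> R \<and> t \<in> R \<and> z \<in> list_span ys}" for x ys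
    using that
  proof (induction ys arbitrary: x)
    case Nil
    then have "J = span2 a x" unfolding span2_def by auto
    then show ?case by blast
  next
    case (Cons y ys)
    define L where "L = {s * a + t * x + u * y | s t u. s \<in> R \<and> t \<in> R \<and> u \<in> R}"
    have zero: "0 \<in> list_span ys" by (induction ys) (use zero_mem in force)+
    have J: "J = {l + z | l z. l \<in> L \<and> z \<in> list_span ys}"
    proof (intro Set.set_eqI iffI)
      fix j assume "j \<in> J"
      then obtain s t u z where "j = s * a + t * x + (u * y + z)" "s \<in> R" "t \<in> R" "u \<in> R" "z \<in> list_span ys"
        by (subst (asm) Cons.prems) auto
      then have "j = (s * a + t * x + u * y) + z" "s * a + t * x + u * y \<in> L" unfolding L_def by auto
      then show "j \<in> {l + z | l z. l \<in> L \<and> z \<in> list_span ys}" using \<open>z \<in> _\<close> by blast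
    next
      fix j assume "j \<in> {l + z | l z. l \<in> L \<and> z \<in> list_span ys}"
      then obtain s t u z where "j = s * a + t * x + u * y + z" "s \<in> R" "t \<in> R" "u \<in> R"
        and z: "z \<in> list_span ys"
        unfolding L_def by auto
      moreover from this have "j = s * a + t * x + (u * y + z)" by simp
      moreover have "u * y + z \<in> list_span (y # ys)" using \<open>u \<in> R\<close> z by auto
      ultimately show "j \<in> J" by (subst Cons.prems) blast
    qed
    have LJ: "L \<subseteq> J"
    proof
      fix l assume "l \<in> L"
      moreover have "l = l + 0" by simp
      ultimately show "l \<in> J" unfolding J using zero by blast
    qed
    have subL: "submodule L"
      unfolding submodule_def
    proof (intro conjI ballI)
      have "0 = 0 * a + 0 * x + 0 * y" by simp
      then show "0 \<in> L" unfolding L_def using zero_mem by blast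
      show "z + z' \<in> L" if z: "z \<in> L" "z' \<in> L" for z z'
      proof -
        obtain s t u s' t' u' where "z = s * a + t * x + u * y" "z' = s' * a + t' * x + u' * y"
          and R: "s \<in> R" "t \<in> R" "u \<in> R" "s' \<in> R" "t' \<in> R" "u' \<in> R"
          using z unfolding L_def by blast
        then have "z + z' = (s + s') * a + (t + t') * x + (u + u') * y"
          by (simp add: algebra_simps)
        then show ?thesis unfolding L_def using R add_mem by blast
      qed
      show "r * z \<in> L" if z: "r \<in> R" "z \<in> L" for r z
      proof -
        obtain s t u where "z = s * a + t * x + u * y" and R: "s \<in> R" "t \<in> R" "u \<in> R"
          using z unfolding L_def by blast
        then have "r * z = (r * s) * a + (r * t) * x + (r * u) * y"
          by (simp add: algebra_simps)
        then show ?thesis unfolding L_def using R z mult_mem by blast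
      qed
    qed
    have "a = 1 * a + 0 * x + 0 * y" by simp
    then have "a \<in> L" unfolding L_def using zero_mem one_mem by blast
    obtain d where "d \<in> R" "d \<noteq> 0" "\<forall>x\<in>J. d * x \<in> R"
      using assms unfolding fractional_def by blast
    then have "fractional L" unfolding fractional_def using subL LJ a(2) \<open>a \<in> L\<close> by blast
    then obtain w where w: "L = span2 a w" using three_generators_to_two[OF L_def _ a(2)] by blast
    have "J = {s * a + t * w + z | s t z. s \<in> R \<and> t \<in> R \<and> z \<in> list_span ys}"
      unfolding J w span2_def by blast
    then show ?case by (rule Cons.IH)
  qed
  moreover have "J = {s * a + t * 0 + z | s t z. s \<in> R \<and> t \<in> R \<and> z \<in> list_span xs}"
  proof (intro Set.set_eqI iffI)
    fix j assume "j \<in> J"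
    moreover have "j = 0 * a + 0 * 0 + j" by simp
    ultimately show "j \<in> {s * a + t * 0 + z | s t z. s \<in> R \<and> t \<in> R \<and> z \<in> list_span xs}"
      using xs zero_mem by blast
  next
    fix j assume "j \<in> {s * a + t * 0 + z | s t z. s \<in> R \<and> t \<in> R \<and> z \<in> list_span xs}"
    then obtain s z where "j = s * a + z" "s \<in> R" "z \<in> J" using xs by auto
    then show "j \<in> J" using submodule_add[OF subJ submodule_mult[OF subJ _ a(1)]] by blast
  qed
  ultimately show thesis using that a(2) by blast
qed

text \<open>A matrix form of Steinitz' isomorphism: \<open>(s, t)\<close> is sent to
  \<open>(s * a + t * b, s * c + t * d)\<close>, from pairs over \<open>R\<close> onto the direct
  sum of \<open>J\<close> and its inverse. It comes from writing 1, as an element of their product,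
  in terms of two generators.\<close>

lemma fractional_unimodular_generators:
  assumes "fractional J"
  obtains a b c d where "J = span2 a b" "c \<in> inv_ideal J" "d \<in> inv_ideal J" "a * d - b * c = 1"
proof -
  obtain a b where ab: "J = span2 a b" by (rule fractional_two_generators[OF assms])
  have L: "J = {s * a + t * b + u * 0 | s t u. s \<in> R \<and> t \<in> R \<and> u \<in> R}"
    unfolding ab span2_def using zero_mem by auto
  obtain b0 b1 b2 where b: "b0 \<in> inv_ideal J" "b1 \<in> inv_ideal J" "1 = a * b0 + b * b1 + 0 * b2"
    using ideal_prod_span3[OF L fractional_invertible[OF assms]] by metis
  have "- b1 \<in> inv_ideal J" by (rule submodule_uminus[OF submodule_inv_ideal b(2)])
  then show thesis using that[OF ab _ b(1), of "- b1"] b(3) by simp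
qed

end

text \<open>The last assumption is Hurwitz' form of the finiteness of the class number.\<close>

locale finite_class_number = dedekind_subring +
  fixes m :: complex
  assumes m_mem: "m \<in> R" "m \<noteq> 0"
    and almost_principal:
      "\<lbrakk>submodule J; J \<subseteq> R; J \<noteq> {0}\<rbrakk> \<Longrightarrow> \<exists>a\<in>J. a \<noteq> 0 \<and> (\<forall>x\<in>J. rdvd a (m * x))"
begin

text \<open>After clearing denominators, let \<open>a\<close> be an almost generator of the integral
  ideal \<open>J'\<close>. The ideal \<open>B\<close> = \<open>(m / a) J'\<close> is integral and
  contains \<open>m\<close>, so it is determined by the subset of the finite system \<open>F\<close>
  of representatives that it contains.\<close>

lemma finitely_many_fractional_up_to_scaling:
  "\<exists>\<S>. finite \<S> \<and> (\<forall>J. fractional J \<longrightarrow> (\<exists>a\<in>frac_field. a \<noteq> 0 \<and> (*) a ` J \<in> \<S>))"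
proof -
  obtain F where F: "finite F" "F \<subseteq> R" "\<forall>y\<in>R. \<exists>x\<in>F. rdvd m (y - x)"
    using finite_quotient[OF m_mem] by blast
  define \<S> where "\<S> = (\<lambda>G. {y\<in>R. \<exists>x\<in>G. rdvd m (y - x)}) ` Pow F"
  have "finite \<S>" using F(1) by (simp add: \<S>_def)
  moreover have "\<exists>a\<in>frac_field. a \<noteq> 0 \<and> (*) a ` J \<in> \<S>" if J: "fractional J" for J
  proof -
    obtain d where d: "d \<in> R" "d \<noteq> 0" "\<forall>x\<in>J. d * x \<in> R"
      using J unfolding fractional_def by blast
    define J' where "J' = (*) d ` J"
    have J': "fractional J'" unfolding J'_def by (rule fractional_image[OF J frac_field_R[OF d(1)] d(2)])
    have "J' \<subseteq> R" unfolding J'_def using d(3) by blast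
    then obtain a where a: "a \<in> J'" "a \<noteq> 0" "\<forall>x\<in>J'. rdvd a (m * x)"
      using almost_principal[of J'] J' unfolding fractional_def by blast
    define B where "B = (*) (m / a) ` J'"
    have subB: "submodule B" unfolding B_def by (rule submodule_image[OF fractional_submodule[OF J']])
    have BR: "B \<subseteq> R"
    proof
      fix y assume "y \<in> B"
      then obtain x where x: "x \<in> J'" "y = m / a * x" unfolding B_def by blast
      obtain s where "s \<in> R" "m * x = a * s" using a(3) x(1) unfolding rdvd_def by blast
      then show "y \<in> R" using x(2) a(2) by (simp add: field_simps)
    qed
    have mB: "m \<in> B" unfolding B_def using a by (intro image_eqI[of _ _ a]) auto
    have "B = {y\<in>R. \<exists>x\<in>F \<inter> B. rdvd m (y - x)}"
    proof (intro Set.set_eqI iffI)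
      fix y assume y: "y \<in> B"
      then obtain x where x: "x \<in> F" "rdvd m (y - x)" using F(3) BR by blast
      have "y - (y - x) \<in> B"
        by (rule submodule_diff[OF subB y submodule_rdvd[OF subB mB x(2)]])
      then show "y \<in> {y\<in>R. \<exists>x\<in>F \<inter> B. rdvd m (y - x)}" using x y BR by auto
    next
      fix y assume "y \<in> {y\<in>R. \<exists>x\<in>F \<inter> B. rdvd m (y - x)}"
      then obtain x where x: "x \<in> B" "rdvd m (y - x)" by blast
      have "(y - x) + x \<in> B"
        by (rule submodule_add[OF subB submodule_rdvd[OF subB mB x(2)] x(1)])
      then show "y \<in> B" by simp
    qed
    then have "B \<in> \<S>" unfolding \<S>_def by blast
    moreover have "B = (*) (m / a * d) ` J"
      unfolding B_def J'_def by (simp add: image_image mult.assoc)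
    moreover have "m / a * d \<in> frac_field" "m / a * d \<noteq> 0"
      using m_mem a d \<open>J' \<subseteq> R\<close>
      by (auto intro!: frac_field_mult frac_field_divide intro: frac_field_R simp del: times_divide_eq_left)
    ultimately show ?thesis by blast
  qed
  ultimately show ?thesis by blast
qed

end

section \<open>Roots of unity of prime power order\<close>

definition integral_poly :: "complex poly \<Rightarrow> bool" where
  "integral_poly f \<longleftrightarrow> (\<forall>i. Polynomial.coeff f i \<in> \<int>)"

lemma integral_poly_0: "integral_poly 0"
  and integral_poly_1: "integral_poly 1"
  by (auto simp: integral_poly_def)

lemma integral_poly_pCons: "integral_poly (pCons a f) \<longleftrightarrow> a \<in> \<int> \<and> integral_poly f"
  unfolding integral_poly_def by (metis coeff_pCons_0 coeff_pCons_Suc not0_implies_Suc)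

lemma integral_poly_monom: "a \<in> \<int> \<Longrightarrow> integral_poly (Polynomial.monom a k)"
  by (auto simp: integral_poly_def)

lemma integral_poly_add: "integral_poly f \<Longrightarrow> integral_poly g \<Longrightarrow> integral_poly (f + g)"
  and integral_poly_diff: "integral_poly f \<Longrightarrow> integral_poly g \<Longrightarrow> integral_poly (f - g)"
  and integral_poly_smult: "a \<in> \<int> \<Longrightarrow> integral_poly f \<Longrightarrow> integral_poly (Polynomial.smult a f)"
  by (auto simp: integral_poly_def)

lemma integral_poly_mult: "integral_poly f \<Longrightarrow> integral_poly g \<Longrightarrow> integral_poly (f * g)"
  unfolding integral_poly_def by (auto simp: coeff_mult intro!: Ints_sum Ints_mult)

lemma integral_poly_power: "integral_poly f \<Longrightarrow> integral_poly (f ^ k)"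
  by (induction k) (auto simp: integral_poly_1 integral_poly_mult)

lemma integral_poly_sum: "(\<And>i. i \<in> A \<Longrightarrow> integral_poly (f i)) \<Longrightarrow> integral_poly (sum f A)"
  by (induction A rule: infinite_finite_induct) (auto simp: integral_poly_0 integral_poly_add)

lemma integral_poly_pcompose: "integral_poly f \<Longrightarrow> integral_poly g \<Longrightarrow> integral_poly (pcompose f g)"
  by (induction f)
    (auto simp: pcompose_pCons integral_poly_pCons integral_poly_0 intro!: integral_poly_add integral_poly_mult)

lemma poly_as_bounded_sum:
  fixes f :: "'a::comm_ring_1 poly"
  assumes "Polynomial.degree f < n"
  shows "poly f x = (\<Sum>i<n. Polynomial.coeff f i * x ^ i)"
proof -
  have "poly f x = (\<Sum>i\<le>Polynomial.degree f. Polynomial.coeff f i * x ^ i)" by (rule poly_altdef)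
  also have "\<dots> = (\<Sum>i<n. Polynomial.coeff f i * x ^ i)"
    using assms by (intro sum.mono_neutral_left) (auto simp: coeff_eq_0)
  finally show ?thesis .
qed

text \<open>The polynomials \<open>G i\<close> are chosen before \<open>\<xi>\<close>. Thus the
  coefficients of a product of linear factors can be evaluated at all conjugates by the same
  polynomials.\<close>

lemma integral_poly_prod_linear:
  assumes "finite S" "\<And>k. k \<in> S \<Longrightarrow> integral_poly (F k)"
  shows "\<exists>G. \<forall>i. integral_poly (G i) \<and>
    (\<forall>\<xi>. Polynomial.coeff (\<Prod>k\<in>S. [:- poly (F k) \<xi>, 1:]) i = poly (G i) \<xi>)"
  using assms
proof (induction S)
  case empty
  show ?case
    by (rule exI[of _ "\<lambda>i. if i = 0 then 1 else 0"]) (auto simp: integral_poly_0 integral_poly_1)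
next
  case (insert k S)
  then obtain G where G: "\<And>i. integral_poly (G i)"
    "\<And>i \<xi>. Polynomial.coeff (\<Prod>k\<in>S. [:- poly (F k) \<xi>, 1:]) i = poly (G i) \<xi>" by auto
  define G' where "G' = (\<lambda>i. (if i = 0 then 0 else G (i - 1)) - F k * G i)"
  have "integral_poly (G' i)" for i
    unfolding G'_def using G(1) insert.prems
    by (intro integral_poly_diff integral_poly_mult) (auto simp: integral_poly_0)
  moreover have "Polynomial.coeff (\<Prod>k\<in>insert k S. [:- poly (F k) \<xi>, 1:]) i = poly (G' i) \<xi>" for i \<xi>
    using insert.hyps by (cases i) (auto simp: G'_def G(2) coeff_pCons algebra_simps)
  ultimately show ?case by blast
qed

text \<open>Turns divisibility by arbitrarily high powers into a contradiction: for
  \<open>\<bar>b\<bar> \<ge> 2\<close> the power with exponent \<open>\<bar>c\<bar>\<close> already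
  exceeds \<open>\<bar>c\<bar>\<close>.\<close>

lemma bounded_powers_imp_unit:
  fixes b c :: int
  assumes "\<And>k. b ^ k dvd c" "c \<noteq> 0"
  shows "\<bar>b\<bar> \<le> 1"
proof (rule ccontr)
  assume "\<not> \<bar>b\<bar> \<le> 1"
  then have "\<bar>b\<bar> \<ge> 2" by simp
  have "int (nat \<bar>c\<bar>) < 2 ^ nat \<bar>c\<bar>" by (metis of_nat_less_two_power)
  also have "2 ^ nat \<bar>c\<bar> \<le> \<bar>b\<bar> ^ nat \<bar>c\<bar>" using \<open>\<bar>b\<bar> \<ge> 2\<close> by (intro power_mono) auto
  also have "\<dots> \<le> \<bar>c\<bar>" using dvd_imp_le_int[OF assms(2) assms(1)] by (simp add: power_abs)
  finally show False by simp
qed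

section \<open>Primitive roots of unity and their exponents modulo \<open>N\<close>\<close>

locale prime_power_root =
  fixes p r :: nat and \<zeta> :: complex
  assumes prime_p: "Factorial_Ring.prime p" and r_pos: "r \<ge> 1"
    and zeta_pow: "\<zeta> ^ (p ^ r) = 1" and zeta_prim: "\<zeta> ^ (p ^ (r - 1)) \<noteq> 1"
begin

definition q :: nat where "q = p ^ (r - 1)"
definition N :: nat where "N = p ^ r"
text \<open>Euler's totient of \<open>N\<close>, which turns out to be the degree of the field
  generated by \<open>\<zeta>\<close>.\<close>

definition n :: nat where "n = (p - 1) * q"
definition lam :: complex where "lam = 1 - \<zeta>"

lemma p_ge_2: "p \<ge> 2"
  using prime_p by (rule prime_ge_2_nat)

lemma q_pos: "q > 0"
  using p_ge_2 by (simp add: q_def)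

lemma N_eq: "N = p * q"
  unfolding N_def q_def using r_pos by (simp flip: power_Suc)

lemma N_eq': "N = n + q"
  using p_ge_2 by (simp add: N_eq n_def algebra_simps)

lemma n_pos: "n > 0"
  using p_ge_2 q_pos by (simp add: n_def)

lemma N_ge_2: "N \<ge> 2"
  using N_eq' n_pos q_pos by linarith

lemma zeta_N: "\<zeta> ^ N = 1" and zeta_q: "\<zeta> ^ q \<noteq> 1"
  using zeta_pow zeta_prim by (auto simp: N_def q_def)

lemma zeta_nonzero: "\<zeta> \<noteq> 0"
  using zeta_N N_ge_2 by (intro notI) (simp add: power_0_left)

text \<open>By Bezout the exponent can be replaced by its gcd with \<open>N\<close>. That is a power
  of \<open>p\<close>, and if it were smaller than \<open>N\<close> it would divide
  \<open>q\<close>, against \<open>zeta_q\<close>.\<close>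

lemma zeta_pow_eq_1_iff: "\<zeta> ^ i = 1 \<longleftrightarrow> N dvd i"
proof
  assume "N dvd i"
  then show "\<zeta> ^ i = 1" by (auto simp: power_mult zeta_N)
next
  assume i: "\<zeta> ^ i = 1"
  show "N dvd i"
  proof (cases "i = 0")
    case False
    obtain x y where "i * x = N * y + gcd i N" using bezout_nat[OF False] by blast
    then have "\<zeta> ^ (i * x) = \<zeta> ^ (N * y + gcd i N)" by simp
    then have g: "\<zeta> ^ gcd i N = 1" by (simp add: power_add power_mult i zeta_N)
    have "gcd i N dvd p ^ r" by (simp add: N_def)
    then obtain k where k: "k \<le> r" "gcd i N = p ^ k"
      using prime_p divides_primepow_nat by blast
    have "k = r"
    proof (rule ccontr)
      assume "k \<noteq> r"
      then have "gcd i N dvd q" using k by (simp add: q_def le_imp_power_dvd)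
      then have "\<zeta> ^ q = 1" using g by (auto simp: power_mult)
      then show False using zeta_q by simp
    qed
    then have "gcd i N = N" using k by (simp add: N_def)
    then show ?thesis by (metis gcd_dvd1)
  qed simp
qed

lemma zeta_pow_mod: "\<zeta> ^ (i mod N) = \<zeta> ^ i"
proof -
  have "\<zeta> ^ i = \<zeta> ^ (N * (i div N) + i mod N)" by simp
  also have "\<dots> = \<zeta> ^ (i mod N)" unfolding power_add power_mult zeta_N by simp
  finally show ?thesis by simp
qed

lemma zeta_pow_cong: "[i = j] (mod N) \<Longrightarrow> \<zeta> ^ i = \<zeta> ^ j"
  unfolding cong_def by (metis zeta_pow_mod)

lemma zeta_pow_inj: "inj_on (\<lambda>k. \<zeta> ^ k) {..<N}"
proof (rule inj_onI)
  have *: "i = j" if "i \<le> j" "j < N" "\<zeta> ^ i = \<zeta> ^ j" for i j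
  proof -
    have "\<zeta> ^ i * \<zeta> ^ (j - i) = \<zeta> ^ i * 1"
      unfolding power_add[symmetric] using that by simp
    then have "\<zeta> ^ (j - i) = 1" using zeta_nonzero by simp
    then have "N dvd j - i" by (simp add: zeta_pow_eq_1_iff)
    then show ?thesis using that by (auto dest: dvd_imp_le)
  qed
  show "i = j" if "i \<in> {..<N}" "j \<in> {..<N}" "\<zeta> ^ i = \<zeta> ^ j" for i j
  proof (cases "i \<le> j")
    case True
    then show ?thesis by (rule *) (use that in auto)
  next
    case False
    then have "j = i" by (intro *) (use that in auto)
    then show ?thesis ..
  qed
qed

text \<open>Representatives of the units modulo \<open>N\<close>, indexing the conjugates of
  \<open>\<zeta>\<close>.\<close>

definition T :: "nat set" where "T = {k. k < N \<and> \<not> p dvd k}"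

lemma coprime_N_iff: "Rings.coprime k N \<longleftrightarrow> \<not> p dvd k"
proof -
  have "Rings.coprime k N \<longleftrightarrow> Rings.coprime p k"
    unfolding N_def using r_pos by (simp add: coprime_commute)
  also have "\<dots> \<longleftrightarrow> \<not> p dvd k"
  proof (cases "p dvd k")
    case True
    then have "Rings.coprime p k \<longleftrightarrow> is_unit p" by (rule coprime_absorb_left)
    then show ?thesis using True p_ge_2 by simp
  qed (simp add: prime_imp_coprime[OF prime_p])
  finally show ?thesis .
qed

lemma finite_T: "finite T"
  unfolding T_def by simp

lemma card_T: "card T = n"
proof -
  have "{..<N} = T \<union> (\<lambda>i. p * i) ` {..<q}"
    using p_ge_2 q_pos by (auto simp: T_def N_eq elim!: dvdE)
  moreover have "T \<inter> (\<lambda>i. p * i) ` {..<q} = {}" by (auto simp: T_def)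
  ultimately have "card {..<N} = card T + card ((\<lambda>i. p * i) ` {..<q})"
    using finite_T by (metis card_Un_disjoint finite_imageI finite_lessThan)
  also have "card ((\<lambda>i. p * i) ` {..<q}) = q"
    using p_ge_2 by (subst card_image) (auto simp: inj_on_def)
  finally show ?thesis using N_eq' by simp
qed

lemma one_in_T: "1 \<in> T"
  using N_ge_2 prime_p by (auto simp: T_def)

lemma coprime_inverse:
  assumes "\<not> p dvd k"
  obtains k' where "[k * k' = 1] (mod N)" "\<not> p dvd k'"
proof -
  obtain k' where k': "[k * k' = 1] (mod N)"
    using cong_solve_coprime_nat[of k N] assms coprime_N_iff by auto
  have "p dvd N" by (simp add: N_eq)
  then have "[k * k' = 1] (mod p)" using k' cong_dvd_modulus_nat by blast
  then have "\<not> p dvd k'" using prime_p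
    by (metis cong_dvd_iff dvd_mult dvd_mult2 not_prime_unit)
  with k' show thesis by (rule that)
qed

text \<open>Lets every result about \<open>\<zeta>\<close> be applied with a conjugate as the base
  root.\<close>

lemma conjugate_root: "\<not> p dvd k \<Longrightarrow> prime_power_root p r (\<zeta> ^ k)"
proof
  assume k: "\<not> p dvd k"
  show "Factorial_Ring.prime p" "1 \<le> r" by (rule prime_p r_pos)+
  show "(\<zeta> ^ k) ^ p ^ r = 1"
    using zeta_N unfolding N_def by (metis mult.commute power_mult power_one)
  show "(\<zeta> ^ k) ^ p ^ (r - 1) \<noteq> 1"
  proof
    assume "(\<zeta> ^ k) ^ p ^ (r - 1) = 1"
    then have "\<zeta> ^ (k * q) = 1" by (simp add: power_mult q_def)
    then have "p * q dvd k * q" by (simp add: zeta_pow_eq_1_iff N_eq)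
    then show False using k q_pos by simp
  qed
qed

lemma mult_bij_T:
  assumes "\<not> p dvd j" shows "bij_betw (\<lambda>k. (j * k) mod N) T T"
proof -
  have "p dvd N" by (simp add: N_eq)
  have into: "(\<lambda>k. (j * k) mod N) ` T \<subseteq> T"
  proof safe
    fix k assume "k \<in> T"
    then have "\<not> p dvd j * k" using assms prime_p by (auto simp: T_def prime_dvd_mult_iff)
    then have "\<not> p dvd (j * k) mod N" using \<open>p dvd N\<close> by (simp add: dvd_mod_iff)
    then show "(j * k) mod N \<in> T" using N_ge_2 by (simp add: T_def)
  qed
  have inj: "inj_on (\<lambda>k. (j * k) mod N) T"
  proof (rule inj_onI)
    fix k l assume kl: "k \<in> T" "l \<in> T" "(j * k) mod N = (j * l) mod N"
    then have "[j * k = j * l] (mod N)" by (simp add: cong_def)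
    then have "[k = l] (mod N)" using assms by (simp add: cong_mult_lcancel_nat coprime_N_iff)
    then show "k = l" using kl by (simp add: T_def cong_def)
  qed
  show ?thesis
    unfolding bij_betw_def using inj into endo_inj_surj[OF finite_T into inj] by simp
qed

text \<open>Galois invariance of a product over all conjugates, obtained by permuting
  exponents.\<close>

lemma prod_conj_reindex:
  assumes "\<not> p dvd j"
  shows "(\<Prod>k\<in>T. h ((\<zeta> ^ j) ^ k)) = (\<Prod>k\<in>T. h (\<zeta> ^ k))"
proof -
  have "(\<Prod>k\<in>T. h ((\<zeta> ^ j) ^ k)) = (\<Prod>k\<in>T. h (\<zeta> ^ ((j * k) mod N)))"
    by (simp add: zeta_pow_mod power_mult)
  also have "\<dots> = (\<Prod>k\<in>T. h (\<zeta> ^ k))"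
    by (rule prod.reindex_bij_betw[OF mult_bij_T[OF assms]])
  finally show ?thesis .
qed

text \<open>The cyclotomic polynomial of order \<open>N\<close>, that is
  \<open>(X^N - 1) / (X^q - 1)\<close>. The explicit sum shows at once that it is monic and
  integral.\<close>

definition Phi :: "complex poly" where
  "Phi = (\<Sum>j<p. Polynomial.monom 1 (j * q))"

lemma integral_Phi: "integral_poly Phi"
  unfolding Phi_def by (intro integral_poly_sum integral_poly_monom) auto

lemma poly_Phi: "poly Phi x = (\<Sum>j<p. (x ^ q) ^ j)"
  by (simp add: Phi_def poly_sum poly_monom mult.commute flip: power_mult)

lemma degree_Phi_le: "Polynomial.degree Phi \<le> n"
  unfolding Phi_def
proof (intro degree_sum_le)
  fix j assume "j \<in> {..<p}"
  then have "j * q \<le> n" unfolding n_def by (intro mult_right_mono) auto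
  then show "Polynomial.degree (Polynomial.monom (1::complex) (j * q)) \<le> n" by (simp add: degree_monom_eq)
qed simp

lemma coeff_Phi_n: "Polynomial.coeff Phi n = 1"
proof -
  have "Polynomial.coeff Phi n = (\<Sum>j<p. if j = p - 1 then 1 else 0)"
    unfolding Phi_def coeff_sum n_def using q_pos by (intro sum.cong) auto
  also have "\<dots> = 1" using p_ge_2 by simp
  finally show ?thesis .
qed

lemma poly_Phi_zeta: "poly Phi \<zeta> = 0"
proof -
  have "(\<zeta> ^ q) ^ p = 1" using zeta_N by (simp add: N_eq mult.commute flip: power_mult)
  then show ?thesis by (simp add: poly_Phi geometric_sum[OF zeta_q])
qed

lemma poly_Phi_conj: "\<not> p dvd k \<Longrightarrow> poly Phi (\<zeta> ^ k) = 0"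
  using prime_power_root.poly_Phi_zeta[OF conjugate_root]
  unfolding prime_power_root.Phi_def[OF conjugate_root] Phi_def
    prime_power_root.q_def[OF conjugate_root] q_def by blast

lemma poly_eq_0_if_conj_roots:
  assumes "Polynomial.degree f < n" "\<And>k. k \<in> T \<Longrightarrow> poly f (\<zeta> ^ k) = 0"
  shows "f = 0"
proof (rule ccontr)
  assume "f \<noteq> 0"
  have "card ((\<lambda>k. \<zeta> ^ k) ` T) = n"
    using card_T by (subst card_image) (auto intro: inj_on_subset[OF zeta_pow_inj] simp: T_def)
  moreover have "card ((\<lambda>k. \<zeta> ^ k) ` T) \<le> card {x. poly f x = 0}"
    using assms(2) poly_roots_finite[OF \<open>f \<noteq> 0\<close>] by (intro card_mono) auto
  moreover have "card {x. poly f x = 0} \<le> Polynomial.degree f" by (rule card_poly_roots_bound[OF \<open>f \<noteq> 0\<close>])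
  ultimately show False using assms(1) by simp
qed

text \<open>Both sides are monic of degree \<open>n\<close>, so their difference has smaller degree;
  it vanishes at \<open>n\<close> distinct conjugates.\<close>

lemma Phi_eq: "Phi = (\<Prod>k\<in>T. [:- (\<zeta> ^ k), 1:])" (is "_ = ?P")
proof -
  have deg: "Polynomial.degree ?P = n" by (simp add: degree_prod_eq_sum_degree card_T)
  have "Polynomial.lead_coeff ?P = 1" by (simp add: lead_coeff_prod)
  have "Polynomial.degree (Phi - ?P) \<le> n" using degree_Phi_le deg by (intro degree_diff_le) auto
  moreover have "Polynomial.coeff (Phi - ?P) n = 0" using coeff_Phi_n \<open>Polynomial.lead_coeff ?P = 1\<close> deg by simp
  ultimately have "Polynomial.degree (Phi - ?P) < n"
    using n_pos by (metis degree_0 leading_coeff_0_iff le_neq_implies_less)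
  moreover have "poly (Phi - ?P) (\<zeta> ^ k) = 0" if "k \<in> T" for k
    using that poly_Phi_conj[of k] finite_T by (auto simp: poly_prod T_def)
  ultimately have "Phi - ?P = 0" by (intro poly_eq_0_if_conj_roots) auto
  then show ?thesis by simp
qed

lemma p_eq_prod: "of_nat p = (\<Prod>k\<in>T. 1 - \<zeta> ^ k)"
proof -
  have "of_nat p = poly Phi 1" by (simp add: poly_Phi)
  also have "\<dots> = (\<Prod>k\<in>T. 1 - \<zeta> ^ k)" unfolding Phi_eq by (simp add: poly_prod)
  finally show ?thesis .
qed

lemma reduce_mod_Phi:
  assumes "integral_poly f"
  obtains g where "integral_poly g" "Polynomial.degree g < n" "Phi dvd f - g"
proof -
  have "\<exists>g. integral_poly g \<and> Polynomial.degree g < n \<and> Phi dvd f - g"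
    using assms
  proof (induction f)
    case 0
    show ?case using n_pos by (intro exI[of _ 0]) (auto simp: integral_poly_0)
  next
    case (pCons a f)
    then obtain g where g: "integral_poly g" "Polynomial.degree g < n" "Phi dvd f - g" "a \<in> \<int>"
      by (auto simp: integral_poly_pCons)
    define h where "h = pCons a g - Polynomial.smult (Polynomial.coeff (pCons a g) n) Phi"
    have "Polynomial.coeff (pCons a g) n \<in> \<int>"
      using g by (auto simp: integral_poly_def coeff_pCons split: nat.splits)
    then have "integral_poly h"
      unfolding h_def using g
      by (intro integral_poly_diff integral_poly_smult integral_Phi) (auto simp: integral_poly_pCons)
    moreover have "Polynomial.degree h < n"
    proof -
      have "Polynomial.degree (pCons a g) \<le> n" using g(2) degree_pCons_le[of a g] by linarith
      moreover have "Polynomial.degree (Polynomial.smult (Polynomial.coeff (pCons a g) n) Phi) \<le> n"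
        using degree_Phi_le degree_smult_le order_trans by blast
      ultimately have "Polynomial.degree h \<le> n" unfolding h_def by (intro degree_diff_le)
      moreover have "Polynomial.coeff h n = 0" by (simp add: h_def coeff_Phi_n)
      ultimately show ?thesis
        using n_pos by (metis degree_0 leading_coeff_0_iff le_neq_implies_less)
    qed
    moreover have "pCons a f - h = [:0, 1:] * (f - g) + Polynomial.smult (Polynomial.coeff (pCons a g) n) Phi"
      by (simp add: h_def)
    then have "Phi dvd pCons a f - h" using g(3) by (simp only: dvd_add dvd_mult dvd_smult dvd_refl)
    ultimately show ?case by blast
  qed
  then show thesis using that by blast
qed

text \<open>Division by a monic polynomial vanishing at every conjugate keeps the values at all of
  them simultaneously, not just at \<open>\<zeta>\<close>.\<close>

lemma reduce_mod_Phi_poly: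
  assumes "integral_poly f"
  obtains g where "integral_poly g" "Polynomial.degree g < n" "\<forall>k. \<not> p dvd k \<longrightarrow> poly f (\<zeta> ^ k) = poly g (\<zeta> ^ k)"
proof -
  obtain g where g: "integral_poly g" "Polynomial.degree g < n" "Phi dvd f - g"
    by (rule reduce_mod_Phi[OF assms])
  have "poly f (\<zeta> ^ k) = poly g (\<zeta> ^ k)" if "\<not> p dvd k" for k
  proof -
    obtain h where "f - g = Phi * h" using g(3) by (rule dvdE)
    then have "poly (f - g) (\<zeta> ^ k) = 0" using poly_Phi_conj[OF that] by simp
    then show ?thesis by simp
  qed
  with g show thesis using that by blast
qed

lemma p_not_dvd_1: "\<not> p dvd 1"
  using prime_p by auto

section \<open>The ring generated by \<open>\<zeta>\<close>\<close>

definition Z :: "complex set" where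
  "Z = {poly f \<zeta> | f. integral_poly f}"

lemma Z_iff: "x \<in> Z \<longleftrightarrow> (\<exists>f. integral_poly f \<and> x = poly f \<zeta>)"
  by (auto simp: Z_def)

lemma reduced_rep:
  assumes "x \<in> Z"
  obtains g where "integral_poly g" "Polynomial.degree g < n" "x = poly g \<zeta>"
proof -
  obtain f where f: "integral_poly f" "x = poly f \<zeta>" using assms by (auto simp: Z_iff)
  obtain g where g: "integral_poly g" "Polynomial.degree g < n" "\<forall>k. \<not> p dvd k \<longrightarrow> poly f (\<zeta> ^ k) = poly g (\<zeta> ^ k)"
    by (rule reduce_mod_Phi_poly[OF f(1)])
  show thesis using that[OF g(1,2)] f(2) spec[OF g(3), of 1] p_not_dvd_1 by simp
qed

sublocale complex_subring Z
proof
  show "1 \<in> Z" unfolding Z_iff using integral_poly_1 by force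
  show "x - y \<in> Z" "x * y \<in> Z" if "x \<in> Z" "y \<in> Z" for x y
    using that unfolding Z_iff
    by (metis integral_poly_diff poly_diff, metis integral_poly_mult poly_mult)
qed

lemma zeta_mem: "\<zeta> \<in> Z"
  unfolding Z_iff by (rule exI[of _ "[:0, 1:]"]) (auto simp: integral_poly_pCons integral_poly_0)

lemma poly_conj_mem: "integral_poly f \<Longrightarrow> poly f (\<zeta> ^ k) \<in> Z"
  unfolding Z_iff
  by (rule exI[of _ "pcompose f (Polynomial.monom 1 k)"])
    (auto simp: poly_pcompose poly_monom intro!: integral_poly_pcompose integral_poly_monom)

lemma Ints_mem: "x \<in> \<int> \<Longrightarrow> x \<in> Z"
  using of_int_mem by (auto elim: Ints_cases)

text \<open>Plays the part of Galois descent. After reduction to degree below \<open>n\<close>, the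
  difference with the constant \<open>w\<close> has all \<open>n\<close> conjugates as roots, so
  \<open>w\<close> is the constant coefficient of the reduced polynomial.\<close>

lemma const_on_conj_imp_int:
  assumes "integral_poly f" "\<And>j. j \<in> T \<Longrightarrow> poly f (\<zeta> ^ j) = w"
  shows "w \<in> \<int>"
proof -
  obtain g where g: "integral_poly g" "Polynomial.degree g < n" "\<forall>k. \<not> p dvd k \<longrightarrow> poly f (\<zeta> ^ k) = poly g (\<zeta> ^ k)"
    by (rule reduce_mod_Phi_poly[OF assms(1)])
  have "g - [:w:] = 0"
  proof (rule poly_eq_0_if_conj_roots)
    show "Polynomial.degree (g - [:w:]) < n" using g(2) by (intro degree_diff_less) (auto simp: n_pos)
    show "poly (g - [:w:]) (\<zeta> ^ k) = 0" if "k \<in> T" for k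
      using that assms(2) g(3) by (auto simp: T_def)
  qed
  then have "w = Polynomial.coeff g 0" by simp
  then show ?thesis using g(1) by (simp add: integral_poly_def)
qed

text \<open>Each coefficient is the value at \<open>\<zeta>\<close> of one integral polynomial,
  whose value at another conjugate is the same because the product is only permuted; so
  \<open>const_on_conj_imp_int\<close> applies.\<close>

lemma charpoly_integral:
  assumes "integral_poly f"
  shows "integral_poly (\<Prod>k\<in>T. [:- poly f (\<zeta> ^ k), 1:])"
  unfolding integral_poly_def
proof
  fix i
  define F where "F = (\<lambda>k. pcompose f (Polynomial.monom 1 k))"
  have F: "integral_poly (F k)" "poly (F k) \<xi> = poly f (\<xi> ^ k)" for k \<xi>
    using assms by (auto simp: F_def poly_pcompose poly_monom intro!: integral_poly_pcompose integral_poly_monom)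
  obtain G where G: "\<And>i. integral_poly (G i)"
    "\<And>i \<xi>. Polynomial.coeff (\<Prod>k\<in>T. [:- poly (F k) \<xi>, 1:]) i = poly (G i) \<xi>"
    using integral_poly_prod_linear[OF finite_T, of F] F(1) by blast
  show "Polynomial.coeff (\<Prod>k\<in>T. [:- poly f (\<zeta> ^ k), 1:]) i \<in> \<int>"
  proof (rule const_on_conj_imp_int[OF G(1)])
    fix j assume j: "j \<in> T"
    have "poly (G i) (\<zeta> ^ j) = Polynomial.coeff (\<Prod>k\<in>T. [:- poly f ((\<zeta> ^ j) ^ k), 1:]) i"
      by (simp add: F(2) flip: G(2))
    also have "(\<Prod>k\<in>T. [:- poly f ((\<zeta> ^ j) ^ k), 1:]) = (\<Prod>k\<in>T. [:- poly f (\<zeta> ^ k), 1:])"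
      using j by (intro prod_conj_reindex[of j "\<lambda>x. [:- poly f x, 1:]"]) (simp add: T_def)
    finally show "poly (G i) (\<zeta> ^ j) = Polynomial.coeff (\<Prod>k\<in>T. [:- poly f (\<zeta> ^ k), 1:]) i" .
  qed
qed

lemma algebraic_int_Z:
  assumes "x \<in> Z" shows "algebraic_int x"
proof -
  obtain f where f: "integral_poly f" "x = poly f \<zeta>" using assms by (auto simp: Z_iff)
  show ?thesis
  proof
    show "Polynomial.lead_coeff (\<Prod>k\<in>T. [:- poly f (\<zeta> ^ k), 1:]) = 1" by (simp add: lead_coeff_prod)
    show "\<forall>i. Polynomial.coeff (\<Prod>k\<in>T. [:- poly f (\<zeta> ^ k), 1:]) i \<in> \<int>"
      using charpoly_integral[OF f(1)] by (simp add: integral_poly_def)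
    show "poly (\<Prod>k\<in>T. [:- poly f (\<zeta> ^ k), 1:]) x = 0"
      using f(2) finite_T one_in_T by (auto simp: poly_prod intro!: bexI[of _ 1])
  qed
qed

lemma rational_Z: "x \<in> Z \<Longrightarrow> x \<in> \<rat> \<Longrightarrow> x \<in> \<int>"
  using algebraic_int_Z rational_algebraic_int_is_int by blast

lemma prod_conj_int:
  assumes "integral_poly f"
  shows "(\<Prod>k\<in>T. poly f (\<zeta> ^ k)) \<in> \<int>"
proof -
  have "Polynomial.coeff (\<Prod>k\<in>T. [:- poly f (\<zeta> ^ k), 1:]) 0 \<in> \<int>"
    using charpoly_integral[OF assms] by (simp add: integral_poly_def)
  also have "Polynomial.coeff (\<Prod>k\<in>T. [:- poly f (\<zeta> ^ k), 1:]) 0 = (\<Prod>k\<in>T. - poly f (\<zeta> ^ k))"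
    by (simp add: poly_prod flip: poly_0_coeff_0)
  also have "\<dots> = (-1) ^ n * (\<Prod>k\<in>T. poly f (\<zeta> ^ k))"
    by (simp add: prod_uminus card_T)
  finally have "(-1) ^ n * (\<Prod>k\<in>T. poly f (\<zeta> ^ k)) \<in> \<int>" .
  then have "(-1) ^ n * ((-1) ^ n * (\<Prod>k\<in>T. poly f (\<zeta> ^ k))) \<in> \<int>"
    by (rule Ints_mult[rotated]) auto
  moreover have "((-1) ^ n :: complex) * ((-1) ^ n * y) = y" for y
    unfolding mult.assoc[symmetric] by (simp flip: power_mult_distrib)
  ultimately show ?thesis by metis
qed

section \<open>Cyclotomic units and the ramification of \<open>p\<close>\<close>

lemma lam_nonzero: "lam \<noteq> 0"
  using zeta_q by (auto simp: lam_def)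

lemma lam_mem: "lam \<in> Z"
  unfolding lam_def using zeta_mem by (intro ring_mems)

text \<open>The sum is \<open>(\<zeta>^k - 1) / (\<zeta> - 1)\<close>. Since \<open>\<zeta>\<close>
  is in turn a power of \<open>\<zeta>^k\<close>, with exponent inverse to \<open>k\<close> modulo
  \<open>N\<close>, the reciprocal is a geometric sum as well.\<close>

lemma cyclotomic_unit:
  assumes "\<not> p dvd k"
  obtains v where "v \<in> Z" "(\<Sum>i<k. \<zeta> ^ i) * v = 1"
proof -
  obtain k' where k': "[k * k' = 1] (mod N)" "\<not> p dvd k'" by (rule coprime_inverse[OF assms])
  have z1: "\<zeta> \<noteq> 1" using lam_nonzero by (simp add: lam_def)
  have zk: "\<zeta> ^ k \<noteq> 1" using assms by (auto simp: zeta_pow_eq_1_iff N_eq dest: dvd_mult_left)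
  have "(\<Sum>i<k. \<zeta> ^ i) * (\<Sum>i<k'. (\<zeta> ^ k) ^ i) = (\<zeta> ^ (k * k') - 1) / (\<zeta> - 1)"
    using zk by (simp add: geometric_sum[OF z1] geometric_sum[OF zk] power_mult)
  also have "\<zeta> ^ (k * k') = \<zeta>" using zeta_pow_cong[OF k'(1)] by simp
  finally have "(\<Sum>i<k. \<zeta> ^ i) * (\<Sum>i<k'. (\<zeta> ^ k) ^ i) = 1" using z1 by simp
  moreover have "(\<Sum>i<k'. (\<zeta> ^ k) ^ i) \<in> Z" by (intro sum_mem power_mem zeta_mem)
  ultimately show thesis using that by blast
qed

text \<open>Total ramification of \<open>p\<close>: each of the \<open>n\<close> factors in
  \<open>p_eq_prod\<close> is \<open>lam\<close> times a cyclotomic unit. The witness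
  \<open>e'\<close> is the inverse of the unit \<open>e\<close>.\<close>

lemma p_assoc_lam_pow:
  obtains e e' where "e \<in> Z" "e' \<in> Z" "e * e' = 1" "of_nat p = e * lam ^ n"
proof -
  define u where "u = (\<lambda>k. \<Sum>i<k. \<zeta> ^ i)"
  have "\<exists>v. v \<in> Z \<and> u k * v = 1" if "k \<in> T" for k
    using that cyclotomic_unit[of k] unfolding T_def u_def by blast
  then obtain v where v: "\<And>k. k \<in> T \<Longrightarrow> v k \<in> Z \<and> u k * v k = 1" by metis
  have "1 - \<zeta> ^ k = u k * lam" for k
    using one_diff_power_eq[of \<zeta> k] by (simp add: u_def lam_def mult.commute)
  then have "of_nat p = (\<Prod>k\<in>T. u k * lam)" by (simp add: p_eq_prod)
  also have "\<dots> = (\<Prod>k\<in>T. u k) * lam ^ n" by (simp add: prod.distrib card_T)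
  finally have "of_nat p = (\<Prod>k\<in>T. u k) * lam ^ n" .
  moreover have "(\<Prod>k\<in>T. u k) * (\<Prod>k\<in>T. v k) = 1"
    using v by (simp flip: prod.distrib)
  moreover have "(\<Prod>k\<in>T. u k) \<in> Z" "(\<Prod>k\<in>T. v k) \<in> Z"
    unfolding u_def using v by (auto intro!: prod_mem sum_mem power_mem zeta_mem)
  ultimately show thesis using that by blast
qed

end

text \<open>Instantiated with \<open>Z\<close> itself, for the independence of the powers of
  \<open>\<zeta>\<close>, and with the complete integral closure \<open>cic\<close>, to show that it
  is no larger than \<open>Z\<close>.\<close>

locale integral_extension = prime_power_root + A: complex_subring A for A +
  assumes Z_subset: "Z \<subseteq> A" and rational_A: "\<And>x. x \<in> A \<Longrightarrow> x \<in> \<rat> \<Longrightarrow> x \<in> \<int>"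
begin

text \<open>The \<open>n\<close>-th power of the relation contains \<open>lam ^ n\<close>, an
  associate of \<open>p\<close>. So \<open>c ^ n / p\<close> is a rational element of
  \<open>A\<close>, hence an integer, and \<open>p\<close> is prime.\<close>

lemma lam_dvd_int:
  assumes "of_int c = lam * a" "a \<in> A"
  shows "int p dvd c"
proof -
  obtain e e' where e: "e \<in> Z" "e' \<in> Z" "e * e' = 1" "of_nat p = e * lam ^ n"
    by (rule p_assoc_lam_pow)
  have "of_int (c ^ n) = lam ^ n * a ^ n" by (simp add: assms power_mult_distrib)
  also have "lam ^ n = (e * e') * lam ^ n" by (simp add: e(3))
  also have "\<dots> = of_nat p * e'" unfolding e(4) by (simp add: ac_simps)
  finally have eq: "of_int (c ^ n) = of_nat p * (e' * a ^ n)" by (simp add: mult.assoc)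
  have "e' * a ^ n = of_int (c ^ n) / of_int (int p)"
    using eq p_ge_2 by (simp add: field_simps)
  then have "e' * a ^ n \<in> \<rat>" by (metis Rats_divide Rats_of_int)
  moreover have "e' * a ^ n \<in> A" using e Z_subset assms by (intro A.ring_mems) auto
  ultimately have "e' * a ^ n \<in> \<int>" by (intro rational_A)
  then obtain d where "e' * a ^ n = of_int d" by (auto elim: Ints_cases)
  then have "(of_int (c ^ n) :: complex) = of_int (int p * d)" using eq by simp
  then have "c ^ n = int p * d" by (simp only: of_int_eq_iff)
  then have "int p dvd c ^ n" by simp
  then show ?thesis using prime_p prime_dvd_power by (metis prime_nat_int_transfer)
qed

text \<open>The terms of index below \<open>i\<close> are divisible by \<open>p\<close> by induction
  and can be subtracted. As \<open>p\<close> is a unit times \<open>lam ^ n\<close> with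
  \<open>n > i\<close>, everything left except the \<open>i\<close>-th term is divisible by
  \<open>lam ^ Suc i\<close>; so \<open>lam\<close> divides the integer coefficient, and
  \<open>p\<close> does by \<open>lam_dvd_int\<close>.\<close>

lemma lam_expansion_divisible:
  assumes h: "integral_poly h" "Polynomial.degree h < n" and x: "poly h lam = of_nat p * x" "x \<in> A"
  shows "Polynomial.coeff h i / of_nat p \<in> \<int>"
proof (induction i rule: less_induct)
  case (less i)
  show ?case
  proof (cases "i < n")
    case False
    then show ?thesis using h(2) by (simp add: coeff_eq_0)
  next
    case True
    obtain e e' where e: "e \<in> Z" "e' \<in> Z" "e * e' = 1" "of_nat p = e * lam ^ n"
      by (rule p_assoc_lam_pow)
    have p0: "(of_nat p :: complex) \<noteq> 0" using p_ge_2 by simp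
    obtain c where c: "Polynomial.coeff h i = of_int c" using h(1) by (auto simp: integral_poly_def elim: Ints_cases)
    define s where "s = (\<Sum>j<i. Polynomial.coeff h j / of_nat p * lam ^ j)"
    define t where "t = (\<Sum>j\<in>{i<..<n}. Polynomial.coeff h j * lam ^ (j - Suc i))"
    have sA: "s \<in> A" unfolding s_def using less lam_mem Z_subset
      by (intro A.sum_mem A.mult_mem A.power_mem) (auto simp: Ints_mem)
    have tA: "t \<in> A" unfolding t_def using h(1) lam_mem Z_subset
      by (intro A.sum_mem A.mult_mem A.power_mem) (auto simp: Ints_mem integral_poly_def)
    have split: "{..<n} = {..<i} \<union> ({i} \<union> {i<..<n})" using True by auto
    have "poly h lam = (\<Sum>j<n. Polynomial.coeff h j * lam ^ j)" by (rule poly_as_bounded_sum[OF h(2)])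
    also have "\<dots> = (\<Sum>j<i. Polynomial.coeff h j * lam ^ j) + (Polynomial.coeff h i * lam ^ i + (\<Sum>j\<in>{i<..<n}. Polynomial.coeff h j * lam ^ j))"
      unfolding split by (subst sum.union_disjoint) auto
    also have "(\<Sum>j<i. Polynomial.coeff h j * lam ^ j) = of_nat p * s"
      using p0 by (simp add: s_def sum_distrib_left)
    also have "(\<Sum>j\<in>{i<..<n}. Polynomial.coeff h j * lam ^ j) = lam ^ Suc i * t"
      unfolding t_def sum_distrib_left
      by (intro sum.cong) (auto simp: ac_simps simp flip: power_add power_Suc)
    finally have "Polynomial.coeff h i * lam ^ i = of_nat p * (x - s) - lam ^ Suc i * t"
      using x(1) by (simp add: algebra_simps)
    also have "of_nat p = e * (lam ^ Suc i * lam ^ (n - Suc i))"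
      using True by (simp add: e(4) flip: power_add power_Suc)
    finally have "lam ^ i * Polynomial.coeff h i = lam ^ i * (lam * (e * lam ^ (n - Suc i) * (x - s) - t))"
      by (simp add: algebra_simps)
    then have "Polynomial.coeff h i = lam * (e * lam ^ (n - Suc i) * (x - s) - t)"
      using lam_nonzero by simp
    then have "of_int c = lam * (e * lam ^ (n - Suc i) * (x - s) - t)" using c by simp
    moreover have "e * lam ^ (n - Suc i) * (x - s) - t \<in> A"
      using sA tA x(2) e(1) lam_mem Z_subset
      by (intro A.diff_mem A.mult_mem A.power_mem) auto
    ultimately have "int p dvd c" by (rule lam_dvd_int)
    then show ?thesis using c p0 by (auto elim!: dvdE)
  qed
qed

text \<open>Eisenstein's argument, applied to the expansion in powers of \<^term>\<open>lam\<close>.\<close>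

lemma divisible_rep:
  assumes g: "integral_poly g" "Polynomial.degree g < n" and x: "poly g \<zeta> = of_nat p * x" "x \<in> A"
  obtains g' where "integral_poly g'" "g = Polynomial.smult (of_nat p) g'"
proof -
  \<comment> \<open>The substitution of \<open>1 - X\<close> for \<open>X\<close> exchanges
    \<open>\<zeta>\<close> and \<open>lam\<close>, keeps degrees and integrality, and is its own
    inverse.\<close>
  define l :: "complex poly" where "l = [:1, -1:]"
  have l: "integral_poly l" by (simp add: l_def integral_poly_pCons integral_poly_0)
  define h where "h = pcompose g l"
  have ll: "pcompose l l = [:0, 1:]" by (simp add: l_def pcompose_pCons)
  have p0: "(of_nat p :: complex) \<noteq> 0" using p_ge_2 by simp
  define h' where "h' = Polynomial.smult (1 / of_nat p) h"
  have "integral_poly h'"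
    unfolding integral_poly_def
  proof
    fix i
    have "Polynomial.coeff h i / of_nat p \<in> \<int>"
    proof (rule lam_expansion_divisible)
      show "integral_poly h" unfolding h_def by (intro integral_poly_pcompose g l)
      show "Polynomial.degree h < n" using g(2) by (simp add: h_def degree_pcompose l_def)
      show "poly h lam = of_nat p * x" by (simp add: h_def poly_pcompose l_def lam_def x(1))
    qed (rule x(2))
    then show "Polynomial.coeff h' i \<in> \<int>" by (simp add: h'_def)
  qed
  moreover have "g = Polynomial.smult (of_nat p) (pcompose h' l)"
  proof -
    have "Polynomial.smult (of_nat p) (pcompose h' l) = pcompose (Polynomial.smult (of_nat p) h') l" by (simp add: pcompose_smult)
    also have "Polynomial.smult (of_nat p) h' = h" using p0 by (simp add: h'_def)
    also have "pcompose h l = g" by (simp add: h_def ll flip: pcompose_assoc)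
    finally show ?thesis by simp
  qed
  ultimately show thesis using that integral_poly_pcompose[OF _ l] by blast
qed

end

section \<open>Independence of the powers of \<open>\<zeta>\<close>, conjugates and the norm\<close>

context prime_power_root
begin

lemma integral_extension_Z: "integral_extension p r \<zeta> Z"
  using rational_Z by unfold_locales auto

text \<open>In effect the irreducibility of \<open>Phi\<close>. The value 0 is \<open>p\<close>
  times the element 0, so \<open>divisible_rep\<close> can be repeated forever and every power of
  \<open>p\<close> divides each coefficient.\<close>

lemma power_basis_independent:
  assumes g: "integral_poly g" "Polynomial.degree g < n" "poly g \<zeta> = 0"
  shows "g = 0"
proof -
  interpret E: integral_extension p r \<zeta> Z by (rule integral_extension_Z)
  have p0: "(of_nat p :: complex) \<noteq> 0" using p_ge_2 by simp
  have div: "\<exists>g'. integral_poly g' \<and> g = Polynomial.smult (of_nat p ^ k) g'" for k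
  proof (induction k)
    case 0
    show ?case using g by auto
  next
    case (Suc k)
    then obtain g' where g': "integral_poly g'" "g = Polynomial.smult (of_nat p ^ k) g'" by blast
    have "Polynomial.degree g' < n" "poly g' \<zeta> = of_nat p * 0" using g p0 by (auto simp: g'(2))
    then obtain g'' where "integral_poly g''" "g' = Polynomial.smult (of_nat p) g''"
      using E.divisible_rep[OF g'(1) _ _ zero_mem] by blast
    then show ?case using g' by (auto simp: mult.commute)
  qed
  show "g = 0"
  proof (rule poly_eqI)
    fix i
    obtain c where c: "Polynomial.coeff g i = of_int c" using g(1) by (auto simp: integral_poly_def elim: Ints_cases)
    have "int p ^ k dvd c" for k
    proof -
      obtain g' where g': "integral_poly g'" "g = Polynomial.smult (of_nat p ^ k) g'" using div by blast
      obtain c' where "Polynomial.coeff g' i = of_int c'" using g'(1) by (auto simp: integral_poly_def elim: Ints_cases)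
      then have "(of_int c :: complex) = of_int (int p ^ k * c')" using c g'(2) by simp
      then show ?thesis by (simp only: of_int_eq_iff dvd_triv_left)
    qed
    then have "c = 0" using bounded_powers_imp_unit[of "int p" c] p_ge_2 by auto
    then show "Polynomial.coeff g i = Polynomial.coeff 0 i" using c by simp
  qed
qed

text \<open>The difference reduces to a polynomial of degree below \<open>n\<close> that vanishes at
  \<open>\<zeta>\<close>; by independence it is zero, so it vanishes at every conjugate.\<close>

lemma conj_well_defined:
  assumes "integral_poly f" "integral_poly g" "poly f \<zeta> = poly g \<zeta>" "\<not> p dvd k"
  shows "poly f (\<zeta> ^ k) = poly g (\<zeta> ^ k)"
proof -
  obtain h where h: "integral_poly h" "Polynomial.degree h < n"
      "\<forall>k. \<not> p dvd k \<longrightarrow> poly (f - g) (\<zeta> ^ k) = poly h (\<zeta> ^ k)"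
    by (rule reduce_mod_Phi_poly[OF integral_poly_diff[OF assms(1,2)]])
  have "poly h \<zeta> = 0" using spec[OF h(3), of 1] p_not_dvd_1 assms(3) by simp
  then have "h = 0" by (rule power_basis_independent[OF h(1,2)])
  then show ?thesis using spec[OF h(3), of k] assms(4) by simp
qed

text \<open>The Galois automorphism sending \<open>\<zeta>\<close> to \<open>\<zeta> ^ k\<close>,
  restricted to \<open>Z\<close>. By \<open>conj_well_defined\<close> the choice of \<open>f\<close>
  is immaterial when the argument is in \<open>Z\<close> and \<open>p\<close> does not divide
  \<open>k\<close>; elsewhere the value has no meaning.\<close>

definition sigma :: "nat \<Rightarrow> complex \<Rightarrow> complex" where
  "sigma k x = poly (SOME f. integral_poly f \<and> poly f \<zeta> = x) (\<zeta> ^ k)"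

lemma sigma_poly:
  assumes "integral_poly f" "\<not> p dvd k"
  shows "sigma k (poly f \<zeta>) = poly f (\<zeta> ^ k)"
proof -
  have "integral_poly (SOME g. integral_poly g \<and> poly g \<zeta> = poly f \<zeta>) \<and>
      poly (SOME g. integral_poly g \<and> poly g \<zeta> = poly f \<zeta>) \<zeta> = poly f \<zeta>"
    by (rule someI[of _ f]) (simp add: assms(1))
  then show ?thesis
    unfolding sigma_def using conj_well_defined[OF _ assms(1) _ assms(2)] by blast
qed

lemma sigma_mult: "\<lbrakk>x \<in> Z; y \<in> Z; \<not> p dvd k\<rbrakk> \<Longrightarrow> sigma k (x * y) = sigma k x * sigma k y"
  unfolding Z_iff using sigma_poly integral_poly_mult by (metis poly_mult)

lemma sigma_mem: "\<lbrakk>x \<in> Z; \<not> p dvd k\<rbrakk> \<Longrightarrow> sigma k x \<in> Z"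
  unfolding Z_iff[of x] using sigma_poly poly_conj_mem by auto

lemma sigma_1: "x \<in> Z \<Longrightarrow> sigma 1 x = x"
  unfolding Z_iff using sigma_poly[OF _ p_not_dvd_1] by auto

lemma sigma_of_int: "\<not> p dvd k \<Longrightarrow> sigma k (of_int m) = of_int m"
  using sigma_poly[of "[:of_int m:]" k] by (simp add: integral_poly_pCons integral_poly_0)

text \<open>The conjugation is undone by the exponent \<open>k'\<close> inverse to \<open>k\<close>,
  using \<open>conj_well_defined\<close> with \<open>\<zeta> ^ k\<close> as the base root.\<close>

lemma sigma_nonzero:
  assumes "x \<in> Z" "x \<noteq> 0" "\<not> p dvd k"
  shows "sigma k x \<noteq> 0"
proof
  assume 0: "sigma k x = 0"
  obtain f where f: "integral_poly f" "x = poly f \<zeta>" using assms(1) by (auto simp: Z_iff)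
  have "poly f (\<zeta> ^ k) = poly 0 (\<zeta> ^ k)" using 0 sigma_poly[OF f(1) assms(3)] f(2) by simp
  interpret c: prime_power_root p r "\<zeta> ^ k" by (rule conjugate_root[OF assms(3)])
  obtain k' where k': "[k * k' = 1] (mod N)" "\<not> p dvd k'" by (rule coprime_inverse[OF assms(3)])
  have "poly f ((\<zeta> ^ k) ^ k') = poly 0 ((\<zeta> ^ k) ^ k')"
    by (rule c.conj_well_defined[OF f(1) integral_poly_0 _ k'(2)]) fact
  moreover have "(\<zeta> ^ k) ^ k' = \<zeta>" using zeta_pow_cong[OF k'(1)] by (simp add: power_mult)
  ultimately show False using assms(2) f(2) by simp
qed

definition nrm :: "complex \<Rightarrow> complex" where
  "nrm x = (\<Prod>k\<in>T. sigma k x)"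

lemma nrm_mult: "x \<in> Z \<Longrightarrow> y \<in> Z \<Longrightarrow> nrm (x * y) = nrm x * nrm y"
  unfolding nrm_def by (simp add: sigma_mult T_def flip: prod.distrib)

lemma nrm_of_int: "nrm (of_int m) = of_int m ^ n"
  unfolding nrm_def using card_T by (simp add: sigma_of_int T_def)

lemma nrm_eq_0_iff: "x \<in> Z \<Longrightarrow> nrm x = 0 \<longleftrightarrow> x = 0"
  unfolding nrm_def using finite_T sigma_nonzero sigma_1[of x] one_in_T
  by (auto simp: T_def)

lemma nrm_int: "x \<in> Z \<Longrightarrow> nrm x \<in> \<int>"
  unfolding nrm_def Z_iff using prod_conj_int by (auto simp: sigma_poly T_def)

lemma dvd_nrm:
  assumes "x \<in> Z" obtains y where "y \<in> Z" "nrm x = x * y"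
proof
  show "(\<Prod>k\<in>T - {1}. sigma k x) \<in> Z"
    using assms sigma_mem by (intro prod_mem) (auto simp: T_def)
  show "nrm x = x * (\<Prod>k\<in>T - {1}. sigma k x)"
    unfolding nrm_def prod.remove[OF finite_T one_in_T] sigma_1[OF assms] ..
qed

section \<open>The integral basis and the residue rings\<close>

lemma basis_rep:
  assumes "x \<in> Z"
  obtains a :: "nat \<Rightarrow> int" where "x = (\<Sum>i<n. of_int (a i) * \<zeta> ^ i)"
proof -
  obtain g where g: "integral_poly g" "Polynomial.degree g < n" "x = poly g \<zeta>" by (rule reduced_rep[OF assms])
  have "\<forall>i. \<exists>a. Polynomial.coeff g i = of_int a" using g(1) by (auto simp: integral_poly_def elim: Ints_cases)
  then obtain a where "\<And>i. Polynomial.coeff g i = of_int (a i)" by metis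
  then have "x = (\<Sum>i<n. of_int (a i) * \<zeta> ^ i)" using g(3) by (simp add: poly_as_bounded_sum[OF g(2)])
  then show thesis by (rule that)
qed

lemma basis_sum_mem: "(\<Sum>i<n. of_int (a i) * \<zeta> ^ i) \<in> Z"
  by (intro sum_mem mult_mem power_mem of_int_mem zeta_mem)

lemma sigma_basis_sum:
  assumes "\<not> p dvd k"
  shows "sigma k (\<Sum>i<n. of_int (a i) * \<zeta> ^ i) = (\<Sum>i<n. of_int (a i) * (\<zeta> ^ k) ^ i)"
proof -
  define f where "f = (\<Sum>i<n. Polynomial.monom (of_int (a i) :: complex) i)"
  have "integral_poly f" unfolding f_def by (intro integral_poly_sum integral_poly_monom) auto
  moreover have "poly f x = (\<Sum>i<n. of_int (a i) * x ^ i)" for x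
    by (simp add: f_def poly_sum poly_monom)
  ultimately show ?thesis using sigma_poly[OF _ assms, of f] by simp
qed

text \<open>The element \<open>a\<close> divides its norm, a nonzero integer \<open>m\<close>, so it
  suffices to reduce the coordinates in the power basis modulo \<open>\<bar>m\<bar>\<close>.\<close>

lemma finite_quotient_Z:
  assumes "a \<in> Z" "a \<noteq> 0"
  shows "\<exists>F. finite F \<and> F \<subseteq> Z \<and> (\<forall>y\<in>Z. \<exists>x\<in>F. rdvd a (y - x))"
proof -
  obtain b where b: "b \<in> Z" "nrm a = a * b" by (rule dvd_nrm[OF assms(1)])
  obtain m where m: "nrm a = of_int m" using nrm_int[OF assms(1)] by (auto elim: Ints_cases)
  have m0: "m \<noteq> 0" using m nrm_eq_0_iff[OF assms(1)] assms(2) by auto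
  define F where "F = (\<lambda>c. \<Sum>i<n. of_int (c i) * \<zeta> ^ i) ` ({..<n} \<rightarrow>\<^sub>E {0..<\<bar>m\<bar>})"
  have "finite F" unfolding F_def by (intro finite_imageI finite_PiE) auto
  moreover have "F \<subseteq> Z" unfolding F_def using basis_sum_mem by auto
  moreover have "\<exists>x\<in>F. rdvd a (y - x)" if y: "y \<in> Z" for y
  proof -
    obtain d where d: "y = (\<Sum>i<n. of_int (d i) * \<zeta> ^ i)" by (rule basis_rep[OF y])
    define c where "c = (\<lambda>i\<in>{..<n}. d i mod \<bar>m\<bar>)"
    define s where "s = (\<lambda>i. d i div \<bar>m\<bar> * sgn m)"
    have eq: "d i - c i = m * s i" if "i < n" for i
    proof -
      have "d i - d i mod \<bar>m\<bar> = \<bar>m\<bar> * (d i div \<bar>m\<bar>)" by (simp add: minus_mod_eq_mult_div)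
      also have "\<dots> = m * s i" by (simp add: s_def abs_sgn mult_ac)
      finally show ?thesis using that by (simp add: c_def)
    qed
    have "c \<in> {..<n} \<rightarrow>\<^sub>E {0..<\<bar>m\<bar>}" using m0 by (auto simp: c_def)
    then have cF: "(\<Sum>i<n. of_int (c i) * \<zeta> ^ i) \<in> F" unfolding F_def by blast
    have "y - (\<Sum>i<n. of_int (c i) * \<zeta> ^ i) = (\<Sum>i<n. of_int (d i - c i) * \<zeta> ^ i)"
      by (simp add: d left_diff_distrib sum_subtractf)
    also have "\<dots> = (\<Sum>i<n. of_int (m * s i) * \<zeta> ^ i)"
      using eq by (intro sum.cong) auto
    also have "\<dots> = nrm a * (\<Sum>i<n. of_int (s i) * \<zeta> ^ i)"
      by (simp add: m sum_distrib_left mult.assoc)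
    also have "\<dots> = a * (b * (\<Sum>i<n. of_int (s i) * \<zeta> ^ i))" by (simp add: b(2) mult.assoc)
    finally have "y - (\<Sum>i<n. of_int (c i) * \<zeta> ^ i) = a * (b * (\<Sum>i<n. of_int (s i) * \<zeta> ^ i))" .
    then have "rdvd a (y - (\<Sum>i<n. of_int (c i) * \<zeta> ^ i))"
      unfolding rdvd_def using mult_mem[OF b(1) basis_sum_mem] by blast
    with cF show ?thesis by blast
  qed
  ultimately show ?thesis by blast
qed

text \<open>The complete integral closure of \<open>\<int>[\<zeta>]\<close>.\<close>

definition cic :: "complex set" where
  "cic = {x. \<exists>M::int. M \<noteq> 0 \<and> (\<forall>k. of_int M * x ^ k \<in> Z)}"

text \<open>The product of the two denominators works for products and differences alike: each term
  of the binomial expansion contains one power of \<open>x\<close> and one of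
  \<open>y\<close>.\<close>

lemma cic_subring: "complex_subring cic"
proof
  show "1 \<in> cic" unfolding cic_def using one_mem by (auto intro!: exI[of _ 1])
next
  fix x y assume "x \<in> cic" "y \<in> cic"
  then obtain M M' :: int where M: "M \<noteq> 0" "\<And>k. of_int M * x ^ k \<in> Z"
    and M': "M' \<noteq> 0" "\<And>k. of_int M' * y ^ k \<in> Z" unfolding cic_def by blast
  have "of_int (M * M') * (x * y) ^ k \<in> Z" for k
  proof -
    have "of_int (M * M') * (x * y) ^ k = (of_int M * x ^ k) * (of_int M' * y ^ k)"
      by (simp add: power_mult_distrib ac_simps)
    then show ?thesis using mult_mem[OF M(2) M'(2)] by metis
  qed
  then show "x * y \<in> cic" unfolding cic_def using M(1) M'(1)
    by (intro CollectI exI[of _ "M * M'"]) simp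
  have "of_int (M * M') * (x - y) ^ k \<in> Z" for k
  proof -
    have "of_int (M * M') * (x - y) ^ k = of_int (M * M') * (x + (- y)) ^ k" by simp
    also have "\<dots> = (\<Sum>i\<le>k. of_int (M * M') * (of_nat (k choose i) * x ^ i * (- y) ^ (k - i)))"
      unfolding binomial_ring sum_distrib_left ..
    also have "\<dots> = (\<Sum>i\<le>k. of_nat (k choose i) * (-1) ^ (k - i) * (of_int M * x ^ i) * (of_int M' * y ^ (k - i)))"
      by (intro sum.cong refl) (simp add: power_minus[of y] ac_simps)
    also have "\<dots> \<in> Z"
      by (intro sum_mem mult_mem[OF mult_mem[OF mult_mem]] M(2) M'(2) power_mem uminus_mem one_mem of_nat_mem)
    finally show ?thesis .
  qed
  then show "x - y \<in> cic" unfolding cic_def using M(1) M'(1)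
    by (intro CollectI exI[of _ "M * M'"]) simp
qed

lemma Z_subset_cic: "Z \<subseteq> cic"
proof
  fix x assume "x \<in> Z"
  then show "x \<in> cic" unfolding cic_def by (auto intro!: exI[of _ 1] power_mem)
qed

text \<open>For a fraction \<open>a / b\<close> in lowest terms the multiples
  \<open>M * x ^ k\<close> are integers, so all powers of \<open>b\<close> divide
  \<open>M\<close>.\<close>

lemma rational_cic:
  assumes "x \<in> cic" "x \<in> \<rat>" shows "x \<in> \<int>"
proof -
  obtain M :: int where M: "M \<noteq> 0" "\<And>k. of_int M * x ^ k \<in> Z" using assms(1) unfolding cic_def by blast
  obtain a b where ab: "b > 0" "Rings.coprime a b" "x = of_int a / of_int b"
    using assms(2) by (elim Rats_cases') blast
  have "b ^ k dvd M" for k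
  proof -
    have "of_int M * x ^ k \<in> \<int>" using assms(2) by (intro rational_Z M(2)) auto
    then obtain c where "of_int M * x ^ k = of_int c" by (auto elim: Ints_cases)
    then have "(of_int (M * a ^ k) :: complex) = of_int (c * b ^ k)"
      using ab(1) by (simp add: ab(3) power_divide field_simps)
    then have "M * a ^ k = c * b ^ k" by (simp only: of_int_eq_iff)
    then have "b ^ k dvd M * a ^ k" by simp
    moreover have "Rings.coprime (b ^ k) (a ^ k)" using ab(2) by (simp add: coprime_commute)
    ultimately show ?thesis by (simp add: coprime_dvd_mult_left_iff)
  qed
  then have "\<bar>b\<bar> \<le> 1" using M(1) by (intro bounded_powers_imp_unit)
  then have "b = 1" using ab(1) by simp
  then show ?thesis using ab(3) by simp
qed

text \<open>The statement that \<open>M' * x ^ i\<close> lies in \<open>Z\<close> is, once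
  denominators are cleared, an identity between integral polynomials at \<open>\<zeta>\<close>. It
  carries over to \<open>\<zeta> ^ k\<close>, so the conjugate has the same common denominator
  \<open>M'\<close>.\<close>

lemma conj_cic:
  assumes f: "integral_poly f" "poly f \<zeta> = of_int M * x" "M \<noteq> 0" and x: "x \<in> cic" and "\<not> p dvd k"
  shows "poly f (\<zeta> ^ k) / of_int M \<in> cic"
proof -
  obtain M' :: int where M': "M' \<noteq> 0" "\<And>i. of_int M' * x ^ i \<in> Z" using x unfolding cic_def by blast
  have "of_int M' * (poly f (\<zeta> ^ k) / of_int M) ^ i \<in> Z" for i
  proof -
    obtain g where g: "integral_poly g" "of_int M' * x ^ i = poly g \<zeta>" using M'(2)[of i] by (auto simp: Z_iff)
    have "poly (Polynomial.smult (of_int M') (f ^ i)) \<zeta> = poly (Polynomial.smult (of_int M ^ i) g) \<zeta>"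
      by (simp add: f(2) power_mult_distrib flip: g(2))
    then have "poly (Polynomial.smult (of_int M') (f ^ i)) (\<zeta> ^ k) = poly (Polynomial.smult (of_int M ^ i) g) (\<zeta> ^ k)"
      by (intro conj_well_defined integral_poly_smult integral_poly_power f g assms(5)) auto
    then have "of_int M' * (poly f (\<zeta> ^ k) / of_int M) ^ i = poly g (\<zeta> ^ k)"
      using f(3) by (simp add: power_divide field_simps)
    then show ?thesis using poly_conj_mem[OF g(1)] by simp
  qed
  then show ?thesis unfolding cic_def using M'(1) by blast
qed

lemma power_sum_root:
  "(\<Sum>k<N. (\<zeta> ^ m) ^ k) = (if N dvd m then of_nat N else 0)"
proof (cases "N dvd m")
  case True
  then have "\<zeta> ^ m = 1" by (simp add: zeta_pow_eq_1_iff)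
  then show ?thesis using True by simp
next
  case False
  then have "\<zeta> ^ m \<noteq> 1" by (simp add: zeta_pow_eq_1_iff)
  moreover have "(\<zeta> ^ m) ^ N = 1" by (metis mult.commute power_mult power_one zeta_N)
  ultimately show ?thesis using False by (simp add: geometric_sum)
qed

lemma fourier_coeff:
  assumes "Polynomial.degree f < n" "j < N"
  shows "(\<Sum>k<N. poly f (\<zeta> ^ k) * (\<zeta> ^ (N - j)) ^ k) = of_nat N * Polynomial.coeff f j"
proof -
  have "(\<Sum>k<N. poly f (\<zeta> ^ k) * (\<zeta> ^ (N - j)) ^ k)
      = (\<Sum>k<N. \<Sum>i<n. Polynomial.coeff f i * (\<zeta> ^ (i + (N - j))) ^ k)"
    by (intro sum.cong refl)
      (simp add: poly_as_bounded_sum[OF assms(1)] sum_distrib_right power_add power_mult_distrib mult.assoc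
        flip: power_mult, simp add: mult.commute)
  also have "\<dots> = (\<Sum>i<n. Polynomial.coeff f i * (\<Sum>k<N. (\<zeta> ^ (i + (N - j))) ^ k))"
    by (subst sum.swap) (simp add: sum_distrib_left)
  also have "\<dots> = (\<Sum>i<n. if i = j then of_nat N * Polynomial.coeff f j else 0)"
  proof (intro sum.cong refl)
    fix i assume i: "i \<in> {..<n}"
    have "N dvd i + (N - j) \<longleftrightarrow> i = j"
    proof
      assume "N dvd i + (N - j)"
      then obtain t where t: "i + (N - j) = N * t" by (rule dvdE)
      \<comment> \<open>Here \<open>N - j\<close> stands for the exponent \<open>-j\<close>. The sum
        lies strictly between 0 and \<open>2 N\<close>, so it is a multiple of \<open>N\<close> only
        if it equals \<open>N\<close>.\<close>
      have "0 < i + (N - j)" "i + (N - j) < N * 2" using i assms(2) N_eq' by auto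
      then have "0 < t" "t < 2" unfolding t using nat_mult_less_cancel1 by (metis gr0I mult_0_right, metis mult_less_cancel1)
      then have "t = 1" by simp
      then show "i = j" using t assms(2) by simp
    qed (use assms in simp)
    then show "Polynomial.coeff f i * (\<Sum>k<N. (\<zeta> ^ (i + (N - j))) ^ k) = (if i = j then of_nat N * Polynomial.coeff f j else 0)"
      by (simp add: power_sum_root)
  qed
  also have "\<dots> = of_nat N * Polynomial.coeff f j"
    using assms(1) by (auto simp: coeff_eq_0)
  finally show ?thesis .
qed

text \<open>The coefficient of \<open>\<zeta>\<^sup>j\<close> times \<open>N\<close> is a finite Fourier transform. Subtracting that of the vanishing
  coefficient at a suitable \<open>j'\<close>, congruent to \<open>j\<close> modulo \<open>q\<close>, removes the terms with \<open>p\<close> dividing \<open>k\<close>,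
  where the value \<open>poly f (\<zeta>\<^sup>k)\<close> is not a conjugate of \<open>poly f \<zeta>\<close>.\<close>

lemma cic_denominator:
  assumes x: "x \<in> cic" shows "of_nat N * x \<in> Z"
proof -
  interpret A: complex_subring cic by (rule cic_subring)
  obtain M :: int where M: "M \<noteq> 0" "\<And>k. of_int M * x ^ k \<in> Z" using x unfolding cic_def by blast
  have "of_int M * x \<in> Z" using M(2)[of 1] by simp
  then obtain f where f: "integral_poly f" "Polynomial.degree f < n" "of_int M * x = poly f \<zeta>" by (rule reduced_rep)
  define h where "h = Polynomial.smult (of_nat N / of_int M) f"
  have "Polynomial.coeff h j \<in> \<int>" for j
  proof (cases "j < n")
    case False
    then show ?thesis using f(2) by (simp add: h_def coeff_eq_0)
  next
    case True
    \<comment> \<open>This index lies in the range from \<open>n\<close> to \<open>N - 1\<close>,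
      where the coefficient of \<open>f\<close> vanishes, and is congruent to \<open>j\<close>
      because \<open>q\<close> divides \<open>n\<close>.\<close>
    define j' where "j' = n + j mod q"
    have j'N: "j' < N" using q_pos by (simp add: j'_def N_eq')
    have jN: "j < N" using True by (simp add: N_eq')
    define w where "w = (\<lambda>k. (\<zeta> ^ (N - j)) ^ k - (\<zeta> ^ (N - j')) ^ k)"
    have "of_nat N * Polynomial.coeff f j' = 0" using f(2) by (simp add: j'_def coeff_eq_0)
    then have "of_nat N * Polynomial.coeff f j = (\<Sum>k<N. poly f (\<zeta> ^ k) * w k)"
      using fourier_coeff[OF f(2) jN] fourier_coeff[OF f(2) j'N]
      by (simp add: w_def right_diff_distrib sum_subtractf)
    then have eq: "of_nat N * Polynomial.coeff f j / of_int M = (\<Sum>k<N. poly f (\<zeta> ^ k) / of_int M * w k)"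
      by (simp add: sum_divide_distrib)
    have "poly f (\<zeta> ^ k) / of_int M * w k \<in> cic" for k
    proof (cases "p dvd k")
      case True
      then obtain l where l: "k = p * l" by (rule dvdE)
      have "[j = j'] (mod q)" by (simp add: cong_def j'_def n_def)
      then have "[j + ((N - j) + (N - j')) = j' + ((N - j) + (N - j'))] (mod q)"
        by (simp add: cong_add_rcancel_nat)
      then have "[N + (N - j') = N + (N - j)] (mod q)"
        using jN j'N by (simp add: add.commute add.left_commute)
      then have "[N - j' = N - j] (mod q)" by (simp add: cong_add_lcancel_nat)
      then have "[(N - j') * k = (N - j) * k] (mod N)"
        unfolding l N_eq[unfolded mult.commute[of p]] mult.assoc[symmetric]
        by (simp add: cong_def mult_mod_left flip: mod_mult_mult2) (metis mod_mult_mult2 mult.commute mult.left_commute mod_mult_left_eq)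
      then have "\<zeta> ^ ((N - j') * k) = \<zeta> ^ ((N - j) * k)" by (rule zeta_pow_cong)
      then have "w k = 0" by (simp add: w_def power_mult)
      then show ?thesis by (simp add: A.zero_mem)
    next
      case False
      have "w k \<in> cic" unfolding w_def using zeta_mem Z_subset_cic
        by (intro A.diff_mem A.power_mem) auto
      then show ?thesis
        using conj_cic[OF f(1) f(3)[symmetric] M(1) x False] by (intro A.mult_mem)
    qed
    then have "of_nat N * Polynomial.coeff f j / of_int M \<in> cic" unfolding eq by (intro A.sum_mem)
    moreover have "of_nat N * Polynomial.coeff f j / of_int M \<in> \<rat>"
      using f(1) Ints_subset_Rats by (auto simp: integral_poly_def intro!: Rats_divide Rats_mult)
    ultimately show ?thesis by (simp add: h_def rational_cic)
  qed
  then have "integral_poly h" by (simp add: integral_poly_def)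
  moreover have "of_nat N * x = poly h \<zeta>" using f(3) M(1) by (simp add: h_def field_simps)
  ultimately show ?thesis by (auto simp: Z_iff)
qed

text \<open>By \<open>cic_denominator\<close> the multiple \<open>p ^ r * x\<close> is in
  \<open>Z\<close>; \<open>divisible_rep\<close> over \<open>cic\<close> removes one factor
  \<open>p\<close> at a time.\<close>

lemma cic_eq_Z: "cic = Z"
proof (intro equalityI subsetI)
  fix x assume x: "x \<in> cic"
  interpret E: integral_extension p r \<zeta> cic
    using rational_cic Z_subset_cic by (intro integral_extension.intro prime_power_root_axioms cic_subring integral_extension_axioms.intro) auto
  have p0: "(of_nat p :: complex) \<noteq> 0" using p_ge_2 by simp
  have "of_nat (p ^ k) * x \<in> Z \<Longrightarrow> x \<in> Z" for k
  proof (induction k)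
    case (Suc k)
    obtain g where g: "integral_poly g" "Polynomial.degree g < n" "of_nat (p ^ Suc k) * x = poly g \<zeta>"
      by (rule reduced_rep[OF Suc.prems])
    have "poly g \<zeta> = of_nat p * (of_nat (p ^ k) * x)" using g(3) by (simp add: mult.assoc)
    moreover have "of_nat (p ^ k) * x \<in> cic" using x by (intro E.A.mult_mem E.A.of_nat_mem)
    ultimately obtain g' where g': "integral_poly g'" "g = Polynomial.smult (of_nat p) g'"
      using E.divisible_rep[OF g(1,2)] by blast
    have "of_nat p * (of_nat (p ^ k) * x) = of_nat p * poly g' \<zeta>" using g(3) g'(2) by (simp add: mult.assoc)
    then have "of_nat (p ^ k) * x = poly g' \<zeta>" using p0 by simp
    then show ?case using g'(1) Suc.IH by (auto simp: Z_iff)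
  qed simp
  then show "x \<in> Z" using cic_denominator[OF x] by (simp add: N_def)
qed (use Z_subset_cic in auto)

text \<open>The norm of \<open>a\<close> is an integer multiple of \<open>a\<close>, so it is a
  denominator of the kind that \<open>cic\<close> demands.\<close>

lemma completely_integrally_closed_Z:
  assumes "a \<in> Z" "a \<noteq> 0" "\<And>k. a * x ^ k \<in> Z"
  shows "x \<in> Z"
proof -
  obtain b where b: "b \<in> Z" "nrm a = a * b" by (rule dvd_nrm[OF assms(1)])
  obtain m where m: "nrm a = of_int m" using nrm_int[OF assms(1)] by (auto elim: Ints_cases)
  have m0: "m \<noteq> 0" using m nrm_eq_0_iff[OF assms(1)] assms(2) by auto
  have "of_int m * x ^ k \<in> Z" for k
  proof -
    have "of_int m * x ^ k = b * (a * x ^ k)"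
      unfolding m[symmetric] b(2) by (simp add: ac_simps)
    then show ?thesis using mult_mem[OF b(1) assms(3)] by metis
  qed
  then have "x \<in> cic" unfolding cic_def using m0 by blast
  then show ?thesis by (simp add: cic_eq_Z)
qed

sublocale dedekind_subring Z
  by unfold_locales (fact finite_quotient_Z, fact completely_integrally_closed_Z)

section \<open>Hurwitz' argument for the finiteness of the class number\<close>

lemma cmod_zeta: "cmod \<zeta> = 1"
proof -
  have "cmod \<zeta> ^ N = 1 ^ N" using arg_cong[OF zeta_N, of cmod] by (simp add: norm_power)
  from power_eq_imp_eq_base[OF this] show ?thesis using N_ge_2 by simp
qed

text \<open>All conjugates of \<open>\<zeta>\<close> have modulus 1, so each conjugate of the
  element is bounded by the sum of the \<open>\<bar>e i\<bar>\<close>. The factor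
  \<open>n + 1\<close> is the number of boxes per coordinate in
  \<open>simultaneous_approximation\<close>.\<close>

lemma norm_nrm_less:
  assumes "m > 0" "\<And>i. i < n \<Longrightarrow> \<bar>e i\<bar> * int (n + 1) < m"
  shows "cmod (nrm (\<Sum>i<n. of_int (e i) * \<zeta> ^ i)) < of_int m ^ n"
proof -
  define S where "S = (\<Sum>i<n. \<bar>e i\<bar>)"
  have "S * int (n + 1) = (\<Sum>i<n. \<bar>e i\<bar> * int (n + 1))" by (simp add: S_def sum_distrib_right)
  also have "\<dots> \<le> (\<Sum>i<n. m)" using assms(2) by (intro sum_mono less_imp_le) auto
  also have "\<dots> = m * int n" by simp
  also have "\<dots> < m * int (n + 1)" using assms(1) by simp
  finally have "S < m" by (simp add: mult_less_cancel_right)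
  have "cmod (sigma k (\<Sum>i<n. of_int (e i) * \<zeta> ^ i)) \<le> of_int S" if "k \<in> T" for k
  proof -
    have "cmod (sigma k (\<Sum>i<n. of_int (e i) * \<zeta> ^ i)) \<le> (\<Sum>i<n. cmod (of_int (e i) * (\<zeta> ^ k) ^ i))"
      using that norm_sum by (simp add: sigma_basis_sum T_def)
    also have "\<dots> = of_int S" by (simp add: S_def norm_mult norm_power cmod_zeta)
    finally show ?thesis .
  qed
  then have "cmod (nrm (\<Sum>i<n. of_int (e i) * \<zeta> ^ i)) \<le> (\<Prod>k\<in>T. of_int S)"
    unfolding nrm_def prod_norm[symmetric] by (intro prod_mono) auto
  also have "\<dots> = of_int S ^ n" by (simp add: card_T)
  also have "\<dots> < of_int m ^ n"
  proof (rule power_strict_mono)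
    show "(of_int S :: real) < of_int m" using \<open>S < m\<close> by simp
    show "(0 :: real) \<le> of_int S" by (simp add: S_def sum_nonneg)
  qed (rule n_pos)
  finally show ?thesis .
qed

text \<open>Dirichlet's pigeonhole argument. Modulo \<open>m\<close>, the coordinates of the
  \<open>(n + 1) ^ n + 1\<close> multiples of \<open>z\<close> fall into \<open>(n + 1) ^ n\<close>
  boxes; two multiples in the same box differ modulo \<open>m\<close> by coordinates smaller than
  \<open>m / (n + 1)\<close>.\<close>

lemma simultaneous_approximation:
  assumes "z \<in> Z" "m > (0::int)"
  obtains t w where "1 \<le> t" "t \<le> (n + 1) ^ n" "w \<in> Z"
    "cmod (nrm (of_nat t * z - of_int m * w)) < of_int m ^ n"
proof -
  obtain a where a: "z = (\<Sum>i<n. of_int (a i) * \<zeta> ^ i)" by (rule basis_rep[OF assms(1)])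
  define u where "u = (\<lambda>t i. (int t * a i) mod m)"
  define box where "box = (\<lambda>t. \<lambda>i\<in>{..<n}. (int (n + 1) * u t i) div m)"
  have "box ` {..(n + 1) ^ n} \<subseteq> {..<n} \<rightarrow>\<^sub>E {0..int n}"
  proof (rule image_subsetI)
    fix t
    have "(int (n + 1) * u t i) div m \<in> {0..int n}" for i
    proof -
      have "0 \<le> u t i" "u t i < m" using assms(2) by (auto simp: u_def)
      then have lt: "int (n + 1) * u t i < int (n + 1) * m" by simp
      have "(int (n + 1) * u t i) div m < int (n + 1)"
      proof (rule ccontr)
        assume "\<not> (int (n + 1) * u t i) div m < int (n + 1)"
        then have "int (n + 1) * m \<le> (int (n + 1) * u t i) div m * m"
          using assms(2) by (intro mult_right_mono) auto
        also have "\<dots> \<le> int (n + 1) * u t i"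
          using assms(2) minus_mod_eq_div_mult[of "int (n + 1) * u t i" m]
            pos_mod_sign[of m "int (n + 1) * u t i"] by linarith
        finally show False using lt by simp
      qed
      moreover have "0 \<le> (int (n + 1) * u t i) div m"
        using \<open>0 \<le> u t i\<close> assms(2) by (intro div_int_pos_iff[THEN iffD2]) simp
      ultimately show ?thesis by simp
    qed
    then show "box t \<in> {..<n} \<rightarrow>\<^sub>E {0..int n}" unfolding box_def by auto
  qed
  then have "card (box ` {..(n + 1) ^ n}) \<le> card ({..<n} \<rightarrow>\<^sub>E {0..int n})"
    by (intro card_mono finite_PiE) auto
  also have "\<dots> = (n + 1) ^ n" by (simp add: card_PiE nat_add_distrib)
  finally have "\<not> inj_on box {..(n + 1) ^ n}" by (intro pigeonhole) simp
  then obtain s t where "s \<le> (n + 1) ^ n" "t \<le> (n + 1) ^ n" "s \<noteq> t" "box s = box t"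
    unfolding inj_on_def by auto
  then obtain s t where st: "s < t" "t \<le> (n + 1) ^ n" "box s = box t"
    by (metis linorder_neq_iff)
  define e where "e = (\<lambda>i. u t i - u s i)"
  define w where "w = (\<Sum>i<n. of_int ((int t * a i) div m - (int s * a i) div m) * \<zeta> ^ i)"
  have "\<bar>e i\<bar> * int (n + 1) < m" if "i < n" for i
  proof -
    define x y where "x = int (n + 1) * u t i" and "y = int (n + 1) * u s i"
    have "x div m = y div m" using fun_cong[OF st(3), of i] that by (simp add: box_def x_def y_def)
    then have "x - y = x mod m - y mod m" by (metis add_diff_cancel_left mult_div_mod_eq)
    moreover have "0 \<le> x mod m" "x mod m < m" "0 \<le> y mod m" "y mod m < m" using assms(2) by auto
    ultimately have "\<bar>x - y\<bar> < m" by linarith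
    moreover have "\<bar>x - y\<bar> = \<bar>e i\<bar> * int (n + 1)"
    proof -
      have "x - y = e i * int (n + 1)" by (simp add: x_def y_def e_def algebra_simps)
      then show ?thesis by (simp add: abs_mult)
    qed
    ultimately show ?thesis by simp
  qed
  then have less: "cmod (nrm (\<Sum>i<n. of_int (e i) * \<zeta> ^ i)) < of_int m ^ n"
    using assms(2) by (intro norm_nrm_less)
  have e_eq: "int (t - s) * a i - m * ((int t * a i) div m - (int s * a i) div m) = e i" for i
    using st(1) by (simp add: e_def u_def of_nat_diff algebra_simps flip: minus_div_mult_eq_mod)
  have "of_nat (t - s) * z - of_int m * w
      = (\<Sum>i<n. of_int (int (t - s) * a i - m * ((int t * a i) div m - (int s * a i) div m)) * \<zeta> ^ i)"
    unfolding a w_def sum_distrib_left sum_subtractf[symmetric]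
    by (intro sum.cong refl) (simp add: algebra_simps)
  also have "\<dots> = (\<Sum>i<n. of_int (e i) * \<zeta> ^ i)" by (simp only: e_eq)
  finally have "of_nat (t - s) * z - of_int m * w = (\<Sum>i<n. of_int (e i) * \<zeta> ^ i)" .
  moreover have "w \<in> Z" unfolding w_def by (rule basis_sum_mem)
  moreover have "1 \<le> t - s" "t - s \<le> (n + 1) ^ n" using st by auto
  ultimately show thesis using that less by simp
qed

text \<open>A common multiple of all the multipliers \<open>t\<close> that
  \<open>simultaneous_approximation\<close> can produce.\<close>

definition hurwitz_const :: complex where
  "hurwitz_const = of_nat (fact ((n + 1) ^ n))"

text \<open>Take \<open>a\<close> of least nonzero norm and approximate \<open>x / a\<close>,
  written as \<open>c * x / m\<close> with \<open>m = a * c\<close>, by some \<open>w\<close>. After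
  division by the norm of \<open>c\<close>, the bound says that \<open>t * x - w * a\<close> has
  smaller norm than \<open>a\<close>; it lies in \<open>J\<close>, so it is 0 and \<open>a\<close>
  divides \<open>t * x\<close>.\<close>

lemma ideal_almost_principal:
  assumes J: "submodule J" "J \<subseteq> Z" "J \<noteq> {0}"
  shows "\<exists>a\<in>J. a \<noteq> 0 \<and> (\<forall>x\<in>J. rdvd a (hurwitz_const * x))"
proof -
  define g where "g = (\<lambda>x. nat \<lfloor>cmod (nrm x)\<rfloor>)"
  have g: "cmod (nrm x) = of_nat (g x)" if "x \<in> Z" for x
    using nrm_int[OF that] by (auto simp: g_def elim!: Ints_cases)
  obtain a0 where "a0 \<in> J \<and> a0 \<noteq> 0" using J(3) submodule_0[OF J(1)] by blast
  then obtain a where a: "a \<in> J" "a \<noteq> 0" and min: "\<And>y. y \<in> J \<Longrightarrow> y \<noteq> 0 \<Longrightarrow> g a \<le> g y"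
    using ex_has_least_nat[of "\<lambda>x. x \<in> J \<and> x \<noteq> 0" a0 g] by blast
  have aZ: "a \<in> Z" using a J by blast
  obtain b where b: "b \<in> Z" "nrm a = a * b" by (rule dvd_nrm[OF aZ])
  obtain m0 where m0: "nrm a = of_int m0" using nrm_int[OF aZ] by (auto elim: Ints_cases)
  have "m0 \<noteq> 0" using m0 nrm_eq_0_iff[OF aZ] a(2) by auto
  define m where "m = \<bar>m0\<bar>"
  define c where "c = of_int (sgn m0) * b"
  have m: "m > 0" using \<open>m0 \<noteq> 0\<close> by (simp add: m_def)
  have cZ: "c \<in> Z" unfolding c_def using b by (intro mult_mem of_int_mem)
  have mc: "of_int m = a * c"
  proof -
    have "of_int m = of_int (sgn m0) * (of_int m0 :: complex)"
      unfolding m_def by (simp add: sgn_if)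
    then show ?thesis using m0 b(2) by (simp add: c_def ac_simps)
  qed
  have c0: "c \<noteq> 0" using mc m by auto
  have "rdvd a (hurwitz_const * x)" if x: "x \<in> J" for x
  proof -
    have xZ: "x \<in> Z" using x J by blast
    obtain t w where tw: "1 \<le> t" "t \<le> (n + 1) ^ n" "w \<in> Z"
      "cmod (nrm (of_nat t * (c * x) - of_int m * w)) < of_int m ^ n"
      by (rule simultaneous_approximation[OF mult_mem[OF cZ xZ] m])
    define y where "y = of_nat t * x - w * a"
    have yJ: "y \<in> J" unfolding y_def
      by (intro submodule_diff[OF J(1)] submodule_mult[OF J(1)] of_nat_mem x a tw(3))
    then have yZ: "y \<in> Z" using J by blast
    have "of_nat t * (c * x) - of_int m * w = c * y"
      unfolding mc y_def by (simp add: algebra_simps)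
    then have "cmod (nrm c) * cmod (nrm y) < of_int m ^ n"
      using tw(4) by (simp add: nrm_mult[OF cZ yZ] norm_mult)
    also have "(of_int m ^ n :: real) = cmod (nrm (of_int m))"
      using m by (simp add: nrm_of_int norm_power)
    also have "\<dots> = cmod (nrm c) * cmod (nrm a)"
      unfolding mc by (simp add: nrm_mult[OF aZ cZ] norm_mult)
    finally have "cmod (nrm y) < cmod (nrm a)"
      using nrm_eq_0_iff[OF cZ] c0 by (simp add: mult_less_cancel_left)
    then have "g y < g a" using g[OF yZ] g[OF aZ] by simp
    then have "y = 0" using min[OF yJ] by (meson not_le)
    then have eq: "of_nat t * x = w * a" by (simp add: y_def)
    have "t dvd fact ((n + 1) ^ n)" using tw(1,2) by (intro dvd_fact)
    then obtain s :: nat where s: "fact ((n + 1) ^ n) = t * s" by (rule dvdE)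
    have "hurwitz_const * x = of_nat s * (of_nat t * x)"
      unfolding hurwitz_const_def s by (simp add: ac_simps)
    also have "\<dots> = a * (of_nat s * w)" unfolding eq by (simp add: ac_simps)
    finally show ?thesis unfolding rdvd_def using mult_mem[OF of_nat_mem tw(3)] by blast
  qed
  with a show ?thesis by blast
qed

sublocale finite_class_number Z hurwitz_const
proof
  show "hurwitz_const \<in> Z" "hurwitz_const \<noteq> 0"
    unfolding hurwitz_const_def by (rule of_nat_mem) simp
qed (rule ideal_almost_principal)

text \<open>For \<open>x = u / v\<close> integral of degree \<open>D\<close>, the single denominator
  \<open>v ^ D\<close> works for all powers of \<open>x\<close>: directly up to exponent
  \<open>D\<close>, and beyond it by the monic equation. Complete integral closedness does the
  rest.\<close>

lemma integers_of_frac_field: "integers_of frac_field = Z"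
proof (intro equalityI subsetI)
  fix x assume "x \<in> Z"
  then show "x \<in> integers_of frac_field"
    by (simp add: integers_of_def algebraic_int_Z frac_field_R)
next
  fix x assume "x \<in> integers_of frac_field"
  then have x: "x \<in> frac_field" "algebraic_int x" by (auto simp: integers_of_def)
  obtain u v where uv: "u \<in> Z" "v \<in> Z" "v \<noteq> 0" "x = u / v" using x(1) unfolding frac_field_def by blast
  obtain f where f: "Polynomial.lead_coeff f = 1" "\<forall>i. Polynomial.coeff f i \<in> \<int>" "poly f x = 0"
    using x(2) by (auto elim: algebraic_int.cases)
  define D where "D = Polynomial.degree f"
  have *: "v ^ D * x ^ k \<in> Z" for k
  proof (induction k rule: less_induct)
    case (less k)
    show ?case
    proof (cases "k \<le> D")
      case True
      have "v ^ D = v ^ (D - k) * v ^ k" using True by (simp flip: power_add)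
      then have "v ^ D * x ^ k = v ^ (D - k) * u ^ k" using uv by (simp add: power_divide)
      then show ?thesis using uv by (simp add: mult_mem power_mem)
    next
      case False
      have "0 = (\<Sum>i\<le>D. Polynomial.coeff f i * x ^ i)" using f(3) by (simp add: poly_altdef D_def)
      also have "\<dots> = (\<Sum>i<D. Polynomial.coeff f i * x ^ i) + x ^ D"
        using f(1) by (simp add: D_def flip: lessThan_Suc_atMost)
      finally have "x ^ D = - (\<Sum>i<D. Polynomial.coeff f i * x ^ i)" by (simp add: eq_neg_iff_add_eq_0 add.commute)
      moreover have "x ^ k = x ^ D * x ^ (k - D)" using False by (simp flip: power_add)
      ultimately have "v ^ D * x ^ k = - (\<Sum>i<D. Polynomial.coeff f i * (v ^ D * x ^ (i + (k - D))))"
        by (simp add: sum_distrib_left sum_distrib_right power_add ac_simps)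
      also have "\<dots> \<in> Z"
        using f(2) False by (intro uminus_mem sum_mem mult_mem[OF Ints_mem] less) auto
      finally show ?thesis .
    qed
  qed
  show "x \<in> Z" by (rule completely_integrally_closed_Z[OF power_mem[OF uv(2)] _ *]) (simp add: uv(3))
qed

section \<open>Residues modulo \<open>lam\<close>\<close>

lemma not_lam_dvd_1: "\<not> rdvd lam 1"
proof
  interpret E: integral_extension p r \<zeta> Z by (rule integral_extension_Z)
  assume "rdvd lam 1"
  then obtain s where "s \<in> Z" "of_int 1 = lam * s" unfolding rdvd_def by auto
  then have "int p dvd 1" using E.lam_dvd_int by blast
  then show False using p_ge_2 by simp
qed

lemma lam_dvd_power_diff: "rdvd lam (\<zeta> ^ i - 1)"
proof -
  have "\<zeta> ^ i - 1 = lam * - (\<Sum>j<i. \<zeta> ^ j)"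
    using one_diff_power_eq[of \<zeta> i] by (simp add: lam_def algebra_simps)
  moreover have "- (\<Sum>j<i. \<zeta> ^ j) \<in> Z" by (intro uminus_mem sum_mem power_mem zeta_mem)
  ultimately show ?thesis unfolding rdvd_def by blast
qed

lemma rdvd_sum: "(\<And>i. i \<in> S \<Longrightarrow> rdvd a (h i)) \<Longrightarrow> rdvd a (sum h S)"
  by (induction S rule: infinite_finite_induct) (auto simp: rdvd_0 rdvd_add)

text \<open>Modulo \<open>lam\<close> every power of \<open>\<zeta>\<close> is 1, so
  \<open>y\<close> is congruent to the sum of its coordinates, to the remainder \<open>k\<close> of
  that sum modulo \<open>p\<close>, and to the sum of \<open>k\<close> powers of
  \<open>\<zeta>\<close>. The last is a unit, as \<open>k\<close> is nonzero.\<close>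

lemma residue_lifts_to_unit:
  assumes "y \<in> Z" "\<not> rdvd lam y"
  obtains \<delta> \<delta>' where "\<delta> \<in> Z" "\<delta>' \<in> Z" "\<delta> * \<delta>' = 1" "rdvd lam (y - \<delta>)"
proof -
  obtain a where a: "y = (\<Sum>i<n. of_int (a i) * \<zeta> ^ i)" by (rule basis_rep[OF assms(1)])
  define c where "c = (\<Sum>i<n. a i)"
  have "y - of_int c = (\<Sum>i<n. of_int (a i) * (\<zeta> ^ i - 1))"
    by (simp add: a c_def right_diff_distrib sum_subtractf)
  then have yc: "rdvd lam (y - of_int c)"
    by (simp only:) (intro rdvd_sum rdvd_mult' lam_dvd_power_diff of_int_mem)
  obtain e e' where e: "e \<in> Z" "e' \<in> Z" "e * e' = 1" "of_nat p = e * lam ^ n" by (rule p_assoc_lam_pow)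
  have "lam ^ n = lam * lam ^ (n - 1)" using n_pos by (cases n) auto
  then have "of_nat p = lam * (e * lam ^ (n - 1))" using e(4) by (simp add: ac_simps)
  moreover have "e * lam ^ (n - 1) \<in> Z" by (intro mult_mem e power_mem lam_mem)
  ultimately have lp: "rdvd lam (of_nat p)" unfolding rdvd_def by blast
  define k where "k = nat (c mod int p)"
  have k: "int k = c mod int p" using p_ge_2 by (simp add: k_def)
  have "c = int p * (c div int p) + int k" by (simp add: k)
  then have "(of_int c :: complex) = of_nat p * of_int (c div int p) + of_nat k"
    by (metis of_int_add of_int_mult of_int_of_nat_eq)
  then have ck: "rdvd lam (of_int c - of_nat k)" using rdvd_mult[OF lp of_int_mem] by simp
  define \<delta> where "\<delta> = (\<Sum>i<k. \<zeta> ^ i)"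
  have "\<delta> - of_nat k = (\<Sum>i<k. \<zeta> ^ i - 1)" by (simp add: \<delta>_def sum_subtractf)
  then have dk: "rdvd lam (\<delta> - of_nat k)" by (simp only:) (intro rdvd_sum lam_dvd_power_diff)
  have "y - \<delta> = (y - of_int c) + ((of_int c - of_nat k) - (\<delta> - of_nat k))" by simp
  then have yd: "rdvd lam (y - \<delta>)" using rdvd_add[OF yc rdvd_diff[OF ck dk]] by simp
  have "int k < int p" unfolding k using p_ge_2 by (intro pos_mod_bound) simp
  then have "k < p" by simp
  moreover have "k \<noteq> 0"
  proof
    assume "k = 0"
    then have "\<delta> = 0" by (simp add: \<delta>_def)
    then show False using yd assms(2) by simp
  qed
  ultimately have "\<not> p dvd k" by (auto dest: dvd_imp_le)
  then obtain v where "v \<in> Z" "\<delta> * v = 1" unfolding \<delta>_def by (rule cyclotomic_unit)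
  moreover have "\<delta> \<in> Z" unfolding \<delta>_def by (intro sum_mem power_mem zeta_mem)
  ultimately show thesis using that yd by blast
qed

end

section \<open>Class groups\<close>

lemma complex_ring_simps:
  "carrier complex_ring = UNIV" "x \<otimes>\<^bsub>complex_ring\<^esub> y = x * y" "x \<oplus>\<^bsub>complex_ring\<^esub> y = x + y"
  "\<one>\<^bsub>complex_ring\<^esub> = 1" "\<zero>\<^bsub>complex_ring\<^esub> = 0"
  by (auto simp: ring_of_type_algebra_def)

lemma complex_ring_a_inv: "\<ominus>\<^bsub>complex_ring\<^esub> x = - x"
proof -
  interpret ring complex_ring by (rule ring_from_type_algebra)
  show ?thesis by (rule minus_equality) (auto simp: complex_ring_simps)
qed

lemma complex_ring_m_inv: "x \<noteq> 0 \<Longrightarrow> inv\<^bsub>complex_ring\<^esub> x = inverse x"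
proof -
  assume "x \<noteq> 0"
  interpret cring complex_ring by (rule cring_from_type_algebra)
  show ?thesis using \<open>x \<noteq> 0\<close> by (intro comm_inv_char) (auto simp: complex_ring_simps)
qed

lemma card_quotient_by_invariant:
  assumes "r = {(x, y). x \<in> S \<and> y \<in> S \<and> f x = f y}" and "f ` S = T"
  shows "bij_betw (\<lambda>t. {x \<in> S. f x = t}) T (S // r)"
proof -
  have "inj_on (\<lambda>t. {x \<in> S. f x = t}) T" using assms(2) by (auto simp: inj_on_def)
  moreover have "r `` {x} = {y \<in> S. f y = f x}" if "x \<in> S" for x
    using that assms(1) by auto
  then have "(\<lambda>t. {x \<in> S. f x = t}) ` T = S // r"
    unfolding assms(2)[symmetric] image_image quotient_def by auto
  ultimately show ?thesis by (simp add: bij_betw_def)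
qed

context complex_subring
begin

lemma complex_subring_frac_field: "complex_subring frac_field"
  using one_mem by unfold_locales (auto intro: frac_field_mems)

lemma ring_ideal_iff:
  assumes "R = integers_of K"
  shows "ideal I (ring_of_integers K) \<longleftrightarrow> submodule I \<and> I \<subseteq> R"
proof
  assume "ideal I (ring_of_integers K)"
  then interpret ideal I "ring_of_integers K" .
  note defs = ring_of_integers_def assms[symmetric] complex_ring_simps
  have "0 \<in> I" "I \<subseteq> R" using additive_subgroup.zero_closed[OF additive_subgroup_axioms] a_subset
    by (auto simp: defs)
  moreover have "x + y \<in> I" if "x \<in> I" "y \<in> I" for x y
    using additive_subgroup.a_closed[OF additive_subgroup_axioms that] by (simp add: defs)
  moreover have "s * x \<in> I" if "s \<in> R" "x \<in> I" for s x
    using I_l_closed[of x s] that by (simp add: defs)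
  ultimately show "submodule I \<and> I \<subseteq> R" by (simp add: submodule_def)
next
  assume I: "submodule I \<and> I \<subseteq> R"
  interpret C: ring complex_ring by (rule ring_from_type_algebra)
  have "subring R complex_ring"
    by (rule C.subringI) (auto simp: complex_ring_simps complex_ring_a_inv intro: ring_mems)
  then have ring: "ring (ring_of_integers K)"
    unfolding ring_of_integers_def assms[symmetric] by (rule C.subring_is_ring)
  note defs = ring_of_integers_def assms[symmetric] complex_ring_simps
  show "ideal I (ring_of_integers K)"
  proof (rule idealI[OF ring])
    interpret O: ring "ring_of_integers K" by (rule ring)
    show "subgroup I (add_monoid (ring_of_integers K))"
    proof (rule O.add.subgroupI)
      show "I \<subseteq> carrier (ring_of_integers K)" using I by (simp add: defs)
      show "I \<noteq> {}" using I submodule_0 by blast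
      show "\<ominus>\<^bsub>ring_of_integers K\<^esub> a \<in> I" if a: "a \<in> I" for a
      proof -
        have "\<ominus>\<^bsub>ring_of_integers K\<^esub> a = - a"
          using a I submodule_uminus[of I a] by (intro O.minus_equality) (auto simp: defs)
        then show ?thesis using a I submodule_uminus by simp
      qed
      show "a \<oplus>\<^bsub>ring_of_integers K\<^esub> b \<in> I" if "a \<in> I" "b \<in> I" for a b
        using that I submodule_add by (simp add: defs)
    qed
  next
    fix a x assume "a \<in> I" "x \<in> carrier (ring_of_integers K)"
    then show "x \<otimes>\<^bsub>ring_of_integers K\<^esub> a \<in> I" "a \<otimes>\<^bsub>ring_of_integers K\<^esub> x \<in> I"
      using I submodule_mult submodule_mult' by (auto simp: defs)
  qed
qed

lemma fractional_ideals_eq: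
  assumes "R = integers_of K"
  shows "fractional_ideals K = {J. fractional J}"
proof (intro equalityI subsetI CollectI)
  fix J assume "J \<in> fractional_ideals K"
  then obtain I d where J: "J = (\<lambda>x. x / d) ` I" and I: "submodule I" "I \<subseteq> R" "I \<noteq> {0}"
    and d: "d \<in> R" "d \<noteq> 0"
    unfolding fractional_ideals_def ring_ideal_iff[OF assms] assms[symmetric] by blast
  have "fractional I" unfolding fractional_def using I by (auto intro!: bexI[of _ 1] one_mem)
  then have "fractional ((*) (1 / d) ` I)"
    using d one_mem by (intro fractional_image) (auto intro: frac_field_mems)
  then show "fractional J" by (simp add: J)
next
  fix J assume "J \<in> {J. fractional J}"
  then have J: "fractional J" by simp
  then obtain d where d: "d \<in> R" "d \<noteq> 0" "\<forall>x\<in>J. d * x \<in> R" unfolding fractional_def by blast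
  have "fractional ((*) d ` J)" by (rule fractional_image[OF J frac_field_R[OF d(1)] d(2)])
  then have "ideal ((*) d ` J) (ring_of_integers K)" "(*) d ` J \<noteq> {0}"
    unfolding ring_ideal_iff[OF assms] fractional_def using d(3) by auto
  moreover have "J = (\<lambda>x. x / d) ` (*) d ` J" using d(2) by (simp add: image_image)
  ultimately show "J \<in> fractional_ideals K"
    unfolding fractional_ideals_def assms[symmetric] using d by blast
qed

text \<open>For fractional \<open>J\<close> this is the coset of \<open>J\<close> modulo the
  principal fractional ideals, an element of the class group.\<close>

definition homothety_class :: "complex set \<Rightarrow> complex set set" where
  "homothety_class J = {(*) a ` J | a. a \<in> frac_field \<and> a \<noteq> 0}"

lemma homothety_class_eq_iff:
  "homothety_class J = homothety_class J' \<longleftrightarrow> (\<exists>a\<in>frac_field. a \<noteq> 0 \<and> J = (*) a ` J')"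
proof
  assume "homothety_class J = homothety_class J'"
  moreover have "J = (*) 1 ` J" by simp
  then have "J \<in> homothety_class J"
    unfolding homothety_class_def using frac_field_R[OF one_mem] by force
  ultimately have "J \<in> homothety_class J'" by simp
  then show "\<exists>a\<in>frac_field. a \<noteq> 0 \<and> J = (*) a ` J'"
    unfolding homothety_class_def by (elim CollectE exE conjE) (intro bexI conjI)
next
  assume "\<exists>a\<in>frac_field. a \<noteq> 0 \<and> J = (*) a ` J'"
  then obtain a where a: "a \<in> frac_field" "a \<noteq> 0" "J = (*) a ` J'" by blast
  have J': "J' = (*) (1 / a) ` J" using a(2,3) by (simp add: image_image)
  have sub: "homothety_class ((*) c ` L) \<subseteq> homothety_class L" if c: "c \<in> frac_field" "c \<noteq> 0" for c L
  proof
    fix M assume "M \<in> homothety_class ((*) c ` L)"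
    then obtain b where b: "b \<in> frac_field" "b \<noteq> 0" "M = (*) b ` (*) c ` L"
      unfolding homothety_class_def by blast
    have "M = (*) (b * c) ` L" using b(3) by (simp add: image_image mult.assoc)
    then show "M \<in> homothety_class L"
      unfolding homothety_class_def
      by (intro CollectI exI[of _ "b * c"]) (simp add: b c frac_field_mult)
  qed
  have "homothety_class J \<subseteq> homothety_class J'" unfolding a(3) by (rule sub[OF a(1,2)])
  moreover have "1 / a \<in> frac_field" by (rule frac_field_divide[OF frac_field_R[OF one_mem] a(1)])
  then have "homothety_class J' \<subseteq> homothety_class J" by (subst J', intro sub) (simp_all add: a(2))
  ultimately show "homothety_class J = homothety_class J'" by (rule equalityI)
qed

lemma ideal_prod_principal:
  assumes "submodule J"
  shows "ideal_prod complex_ring ((*) a ` R) J = (*) a ` J"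
proof (intro equalityI subsetI)
  fix x assume "x \<in> ideal_prod complex_ring ((*) a ` R) J"
  then show "x \<in> (*) a ` J"
  proof induction
    case (prod i j)
    then obtain s where s: "i = a * s" "s \<in> R" by blast
    have "i \<otimes>\<^bsub>complex_ring\<^esub> j = a * (s * j)" by (simp add: s complex_ring_simps)
    then show ?case using submodule_mult[OF assms s(2) prod(2)] by blast
  next
    case (sum x y)
    then show ?case using submodule_add[OF submodule_image[OF assms]] by (simp add: complex_ring_simps)
  qed
next
  fix x assume "x \<in> (*) a ` J"
  then obtain j where "j \<in> J" "x = (a * 1) \<otimes>\<^bsub>complex_ring\<^esub> j" by (auto simp: complex_ring_simps)
  moreover have "a * 1 \<in> (*) a ` R" using one_mem by blast
  ultimately show "x \<in> ideal_prod complex_ring ((*) a ` R) J" by (metis ideal_prod.prod)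
qed

lemma class_group_carrier:
  assumes "R = integers_of frac_field"
  shows "carrier (class_group frac_field) = {homothety_class J | J. fractional J}"
proof -
  have "principal_fractional_ideals frac_field #>\<^bsub>fractional_ideal_group frac_field\<^esub> J = homothety_class J"
    if "fractional J" for J
    unfolding r_coset_def principal_fractional_ideals_def fractional_ideal_group_def homothety_class_def
    using ideal_prod_principal[OF fractional_submodule[OF that]]
    by (auto simp flip: assms)
  moreover have "carrier (fractional_ideal_group frac_field) = {J. fractional J}"
    by (simp add: fractional_ideal_group_def fractional_ideals_eq[OF assms])
  ultimately show ?thesis
    unfolding class_group_def FactGroup_def RCOSETS_def by auto
qed

end

context finite_class_number
begin

lemma finite_homothety_classes: "finite {homothety_class J | J. fractional J}"
proof -
  obtain \<S> where \<S>: "finite \<S>" "\<And>J. fractional J \<Longrightarrow> \<exists>a\<in>frac_field. a \<noteq> 0 \<and> (*) a ` J \<in> \<S>"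
    using finitely_many_fractional_up_to_scaling by blast
  have "{homothety_class J | J. fractional J} \<subseteq> homothety_class ` \<S>"
  proof
    fix c assume "c \<in> {homothety_class J | J. fractional J}"
    then obtain J where J: "c = homothety_class J" "fractional J" by blast
    then obtain a where a: "a \<in> frac_field" "a \<noteq> 0" "(*) a ` J \<in> \<S>" using \<S>(2) by blast
    have "homothety_class ((*) a ` J) = homothety_class J"
      unfolding homothety_class_eq_iff using a by blast
    then show "c \<in> homothety_class ` \<S>" using a(3) J(1) by blast
  qed
  then show ?thesis using \<S>(1) finite_surj by blast
qed

end

section \<open>Integral forms\<close>

no_notation fps_nth (infixl "$" 75)

section \<open>Matrix groups over subrings and conjugation\<close>

abbreviation matrices :: "complex set \<Rightarrow> (complex^2^2) set" where
  "matrices S \<equiv> {A. \<forall>i j. A $ i $ j \<in> S}"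

lemma monoid_matrix_monoid:
  assumes "complex_subring S"
  shows "Group.monoid (matrix_monoid S :: (complex^2^2) monoid)"
proof -
  interpret complex_subring S by fact
  show ?thesis
  proof (rule monoidI)
    fix x y z :: "complex^2^2"
    assume "x \<in> carrier (matrix_monoid S)" "y \<in> carrier (matrix_monoid S)"
    then show "x \<otimes>\<^bsub>matrix_monoid S\<^esub> y \<in> carrier (matrix_monoid S)"
      by (auto simp: matrix_monoid_def matrix_matrix_mult_def intro!: sum_mem mult_mem)
  next
    show "\<one>\<^bsub>matrix_monoid S\<^esub> \<in> carrier (matrix_monoid S)"
      by (simp add: matrix_monoid_def mat_def zero_mem one_mem)
  qed (simp_all add: matrix_monoid_def matrix_mul_assoc)
qed

lemma GL_carrier_inv:
  fixes P Q :: "complex^2^2"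
  assumes S: "complex_subring S" and "P \<in> matrices S" "Q \<in> matrices S" "P ** Q = mat 1" "Q ** P = mat 1"
  shows "P \<in> carrier (GL S)" "inv\<^bsub>GL S\<^esub> P = Q"
proof -
  interpret monoid "matrix_monoid S :: (complex^2^2) monoid" by (rule monoid_matrix_monoid[OF S])
  interpret G: group "GL S :: (complex^2^2) monoid" unfolding GL_def by (rule units_group)
  have *: "P \<in> carrier (GL S)" "Q \<in> carrier (GL S)"
    using assms by (auto simp: GL_def units_of_carrier Units_def matrix_monoid_def)
  then show "P \<in> carrier (GL S)" by simp
  show "inv\<^bsub>GL S\<^esub> P = Q"
    using * assms(5) by (intro G.inv_equality) (auto simp: GL_def units_of_mult units_of_one matrix_monoid_def)
qed

lemma GL_inverse:
  fixes P :: "complex^2^2"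
  assumes "P \<in> carrier (GL S)"
  obtains Q where "P \<in> matrices S" "Q \<in> matrices S" "P ** Q = mat 1" "Q ** P = mat 1"
  using assms by (auto simp: GL_def units_of_carrier Units_def matrix_monoid_def)

lemma GL_mult: "A \<otimes>\<^bsub>GL S\<^esub> B = A ** B"
  by (simp add: GL_def units_of_mult matrix_monoid_def)

lemma conjugate_homs_iff:
  fixes \<phi> \<psi> :: "'a \<Rightarrow> complex^2^2"
  assumes "complex_subring S"
  shows "conjugate_homs C (GL S) \<phi> \<psi> \<longleftrightarrow>
    (\<exists>P\<in>matrices S. \<exists>Q\<in>matrices S. P ** Q = mat 1 \<and> Q ** P = mat 1 \<and>
      (\<forall>g\<in>carrier C. \<psi> g = P ** \<phi> g ** Q))"
  (is "?L \<longleftrightarrow> ?R")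
proof
  assume ?L
  then obtain P where P: "P \<in> carrier (GL S)" "\<forall>g\<in>carrier C. \<psi> g = P ** \<phi> g ** inv\<^bsub>GL S\<^esub> P"
    by (auto simp: conjugate_homs_def GL_mult)
  obtain Q where Q: "P \<in> matrices S" "Q \<in> matrices S" "P ** Q = mat 1" "Q ** P = mat 1"
    by (rule GL_inverse[OF P(1)])
  then show ?R using P(2) GL_carrier_inv(2)[OF assms Q] by auto
next
  assume ?R
  then obtain P Q where PQ: "P \<in> matrices S" "Q \<in> matrices S" "P ** Q = mat 1" "Q ** P = mat 1"
    and "\<forall>g\<in>carrier C. \<psi> g = P ** \<phi> g ** Q" by blast
  then show ?L
    unfolding conjugate_homs_def GL_mult using GL_carrier_inv[OF assms PQ] by (intro bexI[of _ P]) auto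
qed

lemmas mat2_simps = vec_eq_iff forall_2 matrix_matrix_mult_def sum_2 mat_def

text \<open>The matrix \<open>1 + c u (-v\<^sub>2, v\<^sub>1)\<close>; it fixes \<open>v\<close> and multiplies \<open>u\<close> by \<open>1 + c det (v, u)\<close>.\<close>

definition form :: "complex^2 \<Rightarrow> complex^2 \<Rightarrow> complex \<Rightarrow> complex^2^2" where
  "form v u c = vector [vector [1 - c * u$1 * v$2, c * u$1 * v$1],
                        vector [- (c * u$2 * v$2), 1 + c * u$2 * v$1]]"

lemma form_nth:
  "form v u c $ 1 $ 1 = 1 - c * u$1 * v$2" "form v u c $ 1 $ 2 = c * u$1 * v$1"
  "form v u c $ 2 $ 1 = - (c * u$2 * v$2)" "form v u c $ 2 $ 2 = 1 + c * u$2 * v$1"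
  by (simp_all add: form_def)

text \<open>The square of the rank-one matrix \<open>u (-v\<^sub>2, v\<^sub>1)\<close> is
  \<open>z\<close> times itself, because the row applied to \<open>u\<close> gives
  \<open>z\<close>.\<close>

lemma form_mult:
  assumes "v$1 * u$2 - v$2 * u$1 = z"
  shows "form v u c ** form v u c' = form v u (c + c' + c * c' * z)"
  unfolding assms[symmetric] by (simp add: mat2_simps form_nth) (simp add: algebra_simps)

lemma form_0: "form v u 0 = mat 1"
  by (simp add: mat2_simps form_nth)

section \<open>Integral forms as normalised pairs of eigenvectors\<close>

locale cyclic_character = prime_power_root + C: group C for C :: "'a monoid" +
  fixes chi :: "'a \<Rightarrow> complex" and g0 :: 'a
  assumes g0: "g0 \<in> carrier C" and chi_g0: "chi g0 = \<zeta>"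
    and chi_mult: "\<lbrakk>g \<in> carrier C; h \<in> carrier C\<rbrakk> \<Longrightarrow> chi (g \<otimes>\<^bsub>C\<^esub> h) = chi g * chi h"
    and chi_power: "g \<in> carrier C \<Longrightarrow> \<exists>k. chi g = \<zeta> ^ k"
begin

lemma zeta_neq_1: "\<zeta> - 1 \<noteq> 0"
  using lam_nonzero by (simp add: lam_def)

text \<open>The coefficient for which \<open>form v u (cc g)\<close> has eigenvalue
  \<open>chi g\<close> on \<open>u\<close> when the determinant of \<open>(v, u)\<close> is
  \<open>\<zeta> - 1\<close>. For a value \<open>\<zeta> ^ k\<close> it is a geometric sum, hence in
  \<open>Z\<close>.\<close>

definition cc :: "'a \<Rightarrow> complex" where
  "cc g = (chi g - 1) / (\<zeta> - 1)"

lemma chi_eq: "chi g = 1 + cc g * (\<zeta> - 1)"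
  using zeta_neq_1 by (simp add: cc_def)

lemma cc_mem:
  assumes "g \<in> carrier C" shows "cc g \<in> Z"
proof -
  obtain k where "chi g = \<zeta> ^ k" using chi_power[OF assms] by blast
  then have "cc g = (\<Sum>i<k. \<zeta> ^ i)" using zeta_neq_1 by (simp add: cc_def geometric_sum)
  then show ?thesis by (auto intro!: sum_mem power_mem zeta_mem)
qed

lemma cc_mult:
  assumes "g \<in> carrier C" "h \<in> carrier C"
  shows "cc (g \<otimes>\<^bsub>C\<^esub> h) = cc g + cc h + cc g * cc h * (\<zeta> - 1)"
proof -
  have "cc (g \<otimes>\<^bsub>C\<^esub> h) * (\<zeta> - 1) = (cc g + cc h + cc g * cc h * (\<zeta> - 1)) * (\<zeta> - 1)"
    using chi_mult[OF assms] unfolding chi_eq[of g] chi_eq[of h] chi_eq[of "g \<otimes>\<^bsub>C\<^esub> h"]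
    by (simp add: algebra_simps)
  then show ?thesis using zeta_neq_1 by simp
qed

lemma cc_one: "cc \<one>\<^bsub>C\<^esub> = 0"
proof -
  obtain k where "chi \<one>\<^bsub>C\<^esub> = \<zeta> ^ k" using chi_power by blast
  moreover have "chi \<one>\<^bsub>C\<^esub> * chi \<one>\<^bsub>C\<^esub> = chi \<one>\<^bsub>C\<^esub>" using chi_mult[of "\<one>\<^bsub>C\<^esub>" "\<one>\<^bsub>C\<^esub>"] by simp
  ultimately have "chi \<one>\<^bsub>C\<^esub> = 1" using zeta_nonzero by simp
  then show ?thesis by (simp add: cc_def)
qed

lemma cc_g0: "cc g0 = 1"
  using zeta_neq_1 by (simp add: cc_def chi_g0)

text \<open>The products in the last condition are, up to sign, the entries of
  \<open>form v u 1 - mat 1\<close>; they lie in \<open>Z\<close> exactly when the entries of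
  \<open>u\<close> lie in the inverse of the ideal generated by those of \<open>v\<close>.\<close>

definition admissible :: "complex^2 \<Rightarrow> complex^2 \<Rightarrow> bool" where
  "admissible v u \<longleftrightarrow> (\<forall>i. v$i \<in> frac_field \<and> u$i \<in> frac_field) \<and>
     v$1 * u$2 - v$2 * u$1 = \<zeta> - 1 \<and> (\<forall>i j. u$i * v$j \<in> Z)"

text \<open>For an admissible pair, \<open>(form v u 1 - mat 1) / (\<zeta> - 1)\<close> is
  idempotent by the normalisation. It is integral in this case, so the lattice of integral vectors
  splits into its two eigenlattices.\<close>

definition split_pair :: "complex^2 \<Rightarrow> complex^2 \<Rightarrow> bool" where
  "split_pair v u \<longleftrightarrow> (\<forall>i j. rdvd lam (u$i * v$j))"

definition rep :: "complex^2 \<Rightarrow> complex^2 \<Rightarrow> 'a \<Rightarrow> complex^2^2" where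
  "rep v u = (\<lambda>g\<in>carrier C. form v u (cc g))"

abbreviation forms :: "('a \<Rightarrow> complex^2^2) set" where
  "forms \<equiv> integral_forms C frac_field (one_plus_character C chi)"

lemma complex_subring_Z: "complex_subring Z" ..

lemma form_mem:
  assumes "\<And>i j. u$i * v$j \<in> Z" "c \<in> Z"
  shows "form v u c \<in> matrices Z"
proof -
  have "c * u$i * v$j \<in> Z" for i j using mult_mem[OF assms(2) assms(1)] by (simp add: mult.assoc)
  then show ?thesis by (auto simp: forall_2 form_nth intro: ring_mems)
qed

lemma rep_in_forms:
  assumes "admissible v u"
  shows "rep v u \<in> forms"
proof -
  have det: "v$1 * u$2 - v$2 * u$1 = \<zeta> - 1" and int: "\<And>i j. u$i * v$j \<in> Z"
    and K: "\<And>i. v$i \<in> frac_field" "\<And>i. u$i \<in> frac_field" using assms by (auto simp: admissible_def)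
  have mult: "form v u (cc g) ** form v u (cc h) = form v u (cc (g \<otimes>\<^bsub>C\<^esub> h))"
    if "g \<in> carrier C" "h \<in> carrier C" for g h
    using that by (simp add: form_mult[OF det] cc_mult)
  have GL: "form v u (cc g) \<in> carrier (GL Z)" if g: "g \<in> carrier C" for g
  proof (rule GL_carrier_inv(1)[OF complex_subring_Z])
    have ig: "inv\<^bsub>C\<^esub> g \<in> carrier C" using g by simp
    show "form v u (cc g) ** form v u (cc (inv\<^bsub>C\<^esub> g)) = mat 1"
      "form v u (cc (inv\<^bsub>C\<^esub> g)) ** form v u (cc g) = mat 1"
      using g ig by (simp_all add: mult cc_one form_0)
    show "form v u (cc g) \<in> matrices Z" "form v u (cc (inv\<^bsub>C\<^esub> g)) \<in> matrices Z"
      by (intro form_mem int cc_mem g ig)+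
  qed
  have "rep v u \<in> hom C (GL Z)"
    by (rule homI) (auto simp: rep_def GL GL_mult mult)
  moreover have "rep v u \<in> extensional (carrier C)" by (simp add: rep_def)
  moreover have "conjugate_homs C (GL frac_field) (rep v u) (one_plus_character C chi)"
  proof -
    define z where "z = \<zeta> - 1"
    have z: "z \<noteq> 0" "v$1 * u$2 = z + v$2 * u$1" "z \<in> frac_field"
      using zeta_neq_1 det diff_mem[OF zeta_mem one_mem] by (auto simp: z_def algebra_simps intro: frac_field_R)
    \<comment> \<open>The inverse of \<open>Q\<close>, whose columns are the eigenvectors
      \<open>v\<close> and \<open>u\<close>.\<close>
    define P :: "complex^2^2" where
      "P = vector [vector [u$2 / z, - u$1 / z], vector [- v$2 / z, v$1 / z]]"
    define Q :: "complex^2^2" where "Q = vector [vector [v$1, u$1], vector [v$2, u$2]]"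
    show ?thesis
      unfolding conjugate_homs_iff[OF complex_subring_frac_field]
    proof (rule bexI[of _ P], rule bexI[of _ Q], intro conjI ballI)
      show "P \<in> matrices frac_field" "Q \<in> matrices frac_field"
        using K z(3)
        by (auto simp: P_def Q_def forall_2 intro!: frac_field_divide frac_field_minus)
      show PQ: "P ** Q = mat 1"
        using z(1,2) by (simp add: mat2_simps P_def Q_def field_simps)
      then show "Q ** P = mat 1" by (simp add: matrix_left_right_inverse)
      show "one_plus_character C chi g = P ** rep v u g ** Q" if "g \<in> carrier C" for g
      proof -
        have "form v u (cc g) ** Q = Q ** one_plus_character C chi g"
          using that unfolding one_plus_character_def restrict_apply chi_eq[of g] det[symmetric]
          by (simp add: mat2_simps form_nth Q_def) (simp add: algebra_simps)
        then have "P ** (form v u (cc g) ** Q) = (P ** Q) ** one_plus_character C chi g"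
          by (simp add: matrix_mul_assoc)
        then show ?thesis using that by (simp add: PQ rep_def matrix_mul_assoc)
      qed
    qed
  qed
  ultimately show ?thesis by (simp add: integral_forms_def integers_of_frac_field)
qed

text \<open>The columns of the inverse conjugating matrix are eigenvectors; integrality of the
  products is read off from the image of \<open>g0\<close>, where \<open>cc\<close> is 1.\<close>

lemma form_in_forms_exhaust:
  assumes "\<phi> \<in> forms"
  obtains v u where "admissible v u" "\<phi> = rep v u"
proof -
  have hom: "\<phi> \<in> hom C (GL Z)" and ext: "\<phi> \<in> extensional (carrier C)"
    and conj: "conjugate_homs C (GL frac_field) \<phi> (one_plus_character C chi)"
    using assms by (auto simp: integral_forms_def integers_of_frac_field)
  obtain P Q where P: "P \<in> matrices frac_field" and Q: "Q \<in> matrices frac_field"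
    and PQ: "P ** Q = mat 1" and QP: "Q ** P = mat 1"
    and eq: "\<And>g. g \<in> carrier C \<Longrightarrow> one_plus_character C chi g = P ** \<phi> g ** Q"
    using conj unfolding conjugate_homs_iff[OF complex_subring_frac_field] by blast
  \<comment> \<open>The determinant of \<open>P\<close>, reciprocal to that of \<open>Q\<close>;
    scaling the second column by \<open>(\<zeta> - 1) * e\<close> therefore gives the required
    determinant.\<close>
  define e where "e = P$1$1 * P$2$2 - P$1$2 * P$2$1"
  define v :: "complex^2" where "v = vector [Q$1$1, Q$2$1]"
  define u :: "complex^2" where "u = vector [(\<zeta> - 1) * e * Q$1$2, (\<zeta> - 1) * e * Q$2$2]"
  have pq: "P$1$1 * Q$1$1 + P$1$2 * Q$2$1 = 1" "P$1$1 * Q$1$2 + P$1$2 * Q$2$2 = 0"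
    "P$2$1 * Q$1$1 + P$2$2 * Q$2$1 = 0" "P$2$1 * Q$1$2 + P$2$2 * Q$2$2 = 1"
    using PQ by (simp_all add: mat2_simps)
  have qp: "Q$1$1 * P$1$1 + Q$1$2 * P$2$1 = 1" "Q$1$1 * P$1$2 + Q$1$2 * P$2$2 = 0"
    "Q$2$1 * P$1$1 + Q$2$2 * P$2$1 = 0" "Q$2$1 * P$1$2 + Q$2$2 * P$2$2 = 1"
    using QP by (simp_all add: mat2_simps)
  have P2: "P$2$2 = e * Q$1$1" "P$2$1 = - (e * Q$2$1)"
  proof -
    have "e * Q$1$1 = P$2$2 * (P$1$1 * Q$1$1 + P$1$2 * Q$2$1) - P$1$2 * (P$2$1 * Q$1$1 + P$2$2 * Q$2$1)"
      by (simp add: e_def algebra_simps)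
    then show "P$2$2 = e * Q$1$1" by (simp add: pq)
    have "- (e * Q$2$1) = P$2$1 * (P$1$1 * Q$1$1 + P$1$2 * Q$2$1) - P$1$1 * (P$2$1 * Q$1$1 + P$2$2 * Q$2$1)"
      by (simp add: e_def algebra_simps)
    then show "P$2$1 = - (e * Q$2$1)" by (simp add: pq)
  qed
  have form: "\<phi> g = form v u (cc g)" if g: "g \<in> carrier C" for g
  proof -
    have "Q ** one_plus_character C chi g ** P = (Q ** P) ** \<phi> g ** (Q ** P)"
      by (simp add: eq[OF g] matrix_mul_assoc)
    then have "\<phi> g = Q ** one_plus_character C chi g ** P" by (simp add: QP)
    also have "\<dots> = form v u (cc g)"
    proof -
      have "(Q ** one_plus_character C chi g ** P) $ i $ j = Q$i$1 * P$1$j + Q$i$2 * chi g * P$2$j" for i j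
        using g by (simp add: one_plus_character_def matrix_matrix_mult_def sum_2)
      also have "\<dots> i j = (Q ** P) $ i $ j + cc g * (\<zeta> - 1) * Q$i$2 * P$2$j" for i j
        unfolding chi_eq[of g] by (simp add: matrix_matrix_mult_def sum_2 algebra_simps)
      finally have "(Q ** one_plus_character C chi g ** P) $ i $ j
          = (mat 1 :: complex^2^2) $ i $ j + cc g * (\<zeta> - 1) * Q$i$2 * P$2$j" for i j
        by (simp add: QP)
      then show ?thesis
        by (simp add: vec_eq_iff forall_2 form_nth v_def u_def P2 mat_def)
    qed
    finally show ?thesis .
  qed
  have eK: "e \<in> frac_field" unfolding e_def using P by (auto intro!: frac_field_diff frac_field_mult)
  have zK: "\<zeta> - 1 \<in> frac_field" using zeta_mem one_mem by (intro frac_field_R diff_mem)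
  have det: "v$1 * u$2 - v$2 * u$1 = \<zeta> - 1"
  proof -
    have "v$1 * u$2 - v$2 * u$1 = (\<zeta> - 1) * (e * Q$1$1 * Q$2$2 - e * Q$2$1 * Q$1$2)"
      by (simp add: v_def u_def algebra_simps)
    also have "e * Q$1$1 * Q$2$2 - e * Q$2$1 * Q$1$2 = 1" using pq(4) unfolding P2 by simp
    finally show ?thesis by simp
  qed
  have "\<phi> g0 \<in> matrices Z"
    using hom g0 GL_inverse[of "\<phi> g0" Z] by (auto simp: hom_def Pi_iff)
  then have F: "form v u 1 $ i $ j \<in> Z" for i j using form[OF g0] cc_g0 by simp
  have "u$i * v$j \<in> Z" for i j
  proof -
    have "u$1 * v$1 \<in> Z" "u$2 * v$2 \<in> Z" "u$1 * v$2 \<in> Z" "u$2 * v$1 \<in> Z"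
      using F[of 1 2] uminus_mem[OF F[of 2 1]] diff_mem[OF one_mem F[of 1 1]] diff_mem[OF F[of 2 2] one_mem]
      by (simp_all add: form_nth)
    then show ?thesis using exhaust_2[of i] exhaust_2[of j] by auto
  qed
  then have "admissible v u"
    unfolding admissible_def using det Q eK zK
    by (auto simp: forall_2 v_def u_def intro!: frac_field_mult)
  moreover have "\<phi> = rep v u"
    using ext form by (auto simp: rep_def extensional_def fun_eq_iff)
  ultimately show thesis by (rule that)
qed

section \<open>Invariance of the ideal class and of splitting\<close>

lemma admissible_nonzero:
  assumes "admissible v u" shows "v$1 \<noteq> 0 \<or> v$2 \<noteq> 0" "u$1 \<noteq> 0 \<or> u$2 \<noteq> 0"
  using assms zeta_neq_1 by (auto simp: admissible_def)

lemma fractional_admissible: "admissible v u \<Longrightarrow> fractional (span2 (v$1) (v$2))"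
  using admissible_nonzero(1) by (intro fractional_span2) (auto simp: admissible_def)

lemma split_pair_iff:
  "split_pair v u \<longleftrightarrow> (\<forall>i j. rdvd lam ((form v u 1 - mat 1) $ i $ j))"
proof -
  have "rdvd lam (- x) \<longleftrightarrow> rdvd lam x" for x
    using rdvd_diff[OF rdvd_0, of lam x] rdvd_diff[OF rdvd_0, of lam "- x"] by auto
  then show ?thesis by (auto simp: split_pair_def forall_2 form_nth mat_def)
qed

lemma rdvd_matrix_mult:
  fixes A B :: "complex^2^2"
  assumes "\<forall>i j. rdvd a (A $ i $ j)" "B \<in> matrices Z"
  shows "\<forall>i j. rdvd a ((A ** B) $ i $ j)" "\<forall>i j. rdvd a ((B ** A) $ i $ j)"
proof -
  show "\<forall>i j. rdvd a ((A ** B) $ i $ j)"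
    using assms by (auto simp: matrix_matrix_mult_def intro!: rdvd_sum rdvd_mult)
  show "\<forall>i j. rdvd a ((B ** A) $ i $ j)"
    using assms by (auto simp: matrix_matrix_mult_def intro!: rdvd_sum rdvd_mult')
qed

lemma split_pair_conj:
  assumes "split_pair v u" "P \<in> matrices Z" "Q \<in> matrices Z" "P ** Q = mat 1"
    "form v' u' 1 = P ** form v u 1 ** Q"
  shows "split_pair v' u'"
proof -
  have "form v' u' 1 = P ** (mat 1 + (form v u 1 - mat 1)) ** Q" by (simp add: assms(5))
  also have "\<dots> = P ** Q + P ** (form v u 1 - mat 1) ** Q"
    by (simp add: vec_eq_iff matrix_matrix_mult_def sum_2 mat_def algebra_simps)
  finally have "form v' u' 1 - mat 1 = P ** (form v u 1 - mat 1) ** Q" using assms(4) by simp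
  then show ?thesis
    using assms(1) rdvd_matrix_mult(1)[OF rdvd_matrix_mult(2)[OF _ assms(2)] assms(3)]
    unfolding split_pair_iff by simp
qed

text \<open>An intertwining \<open>P\<close> maps the fixed vector \<open>v\<close> to a fixed
  vector of the other form, a multiple of \<open>v'\<close>. As \<open>P\<close> is invertible over
  \<open>Z\<close>, the entries of \<open>P v\<close> generate the same ideal as those of
  \<open>v\<close>.\<close>

lemma conjugate_imp_same_invariants:
  assumes adm: "admissible v u" "admissible v' u'"
    and conj: "conjugate_homs C (GL Z) (rep v u) (rep v' u')"
  shows "homothety_class (span2 (v$1) (v$2)) = homothety_class (span2 (v'$1) (v'$2))"
    and "split_pair v u \<longleftrightarrow> split_pair v' u'"
proof -
  obtain P Q where P: "P \<in> matrices Z" and Q: "Q \<in> matrices Z"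
    and PQ: "P ** Q = mat 1" and QP: "Q ** P = mat 1"
    and eq: "\<And>g. g \<in> carrier C \<Longrightarrow> rep v' u' g = P ** rep v u g ** Q"
    using conj unfolding conjugate_homs_iff[OF complex_subring_Z] by blast
  have A: "form v' u' 1 = P ** form v u 1 ** Q" using eq[OF g0] g0 by (simp add: rep_def cc_g0)
  have AP: "form v' u' 1 ** P = P ** form v u 1"
  proof -
    have "form v' u' 1 ** P = P ** form v u 1 ** (Q ** P)" by (simp add: A matrix_mul_assoc)
    then show ?thesis by (simp add: QP)
  qed
  have A': "form v u 1 = Q ** form v' u' 1 ** P"
  proof -
    have "Q ** form v' u' 1 ** P = (Q ** P) ** form v u 1 ** (Q ** P)" by (simp add: A matrix_mul_assoc)
    then show ?thesis by (simp add: QP)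
  qed
  show "split_pair v u \<longleftrightarrow> split_pair v' u'"
    using split_pair_conj[OF _ P Q PQ A] split_pair_conj[OF _ Q P QP A'] by blast
  define w1 where "w1 = P$1$1 * v$1 + P$1$2 * v$2"
  define w2 where "w2 = P$2$1 * v$1 + P$2$2 * v$2"
  \<comment> \<open>Entrywise this is
    \<open>u' (-v'\<^sub>2, v'\<^sub>1) P = P u (-v\<^sub>2, v\<^sub>1)\<close>. Applied to
    \<open>v\<close> the right side vanishes, and since \<open>u'\<close> is nonzero the row
    \<open>(-v'\<^sub>2, v'\<^sub>1)\<close> annihilates \<open>P v\<close>, which is
    \<open>(w1, w2)\<close>.\<close>
  have e: "- (u'$1 * v'$2) * P$1$1 + u'$1 * v'$1 * P$2$1 = - (P$1$1 * u$1 + P$1$2 * u$2) * v$2"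
    "- (u'$1 * v'$2) * P$1$2 + u'$1 * v'$1 * P$2$2 = (P$1$1 * u$1 + P$1$2 * u$2) * v$1"
    "- (u'$2 * v'$2) * P$1$1 + u'$2 * v'$1 * P$2$1 = - (P$2$1 * u$1 + P$2$2 * u$2) * v$2"
    "- (u'$2 * v'$2) * P$1$2 + u'$2 * v'$1 * P$2$2 = (P$2$1 * u$1 + P$2$2 * u$2) * v$1"
    using AP by (simp_all add: mat2_simps form_nth algebra_simps)
  have "u'$i * (v'$1 * w2 - v'$2 * w1) =
      (- (u'$i * v'$2) * P$1$1 + u'$i * v'$1 * P$2$1) * v$1 + (- (u'$i * v'$2) * P$1$2 + u'$i * v'$1 * P$2$2) * v$2" for i
    by (simp add: w1_def w2_def algebra_simps)
  from this[of 1] this[of 2] have "u'$1 * (v'$1 * w2 - v'$2 * w1) = 0" "u'$2 * (v'$1 * w2 - v'$2 * w1) = 0"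
    unfolding e by (simp_all add: algebra_simps)
  then have par: "v'$1 * w2 = v'$2 * w1" using admissible_nonzero(2)[OF adm(2)] by auto
  have qp: "Q$1$1 * P$1$1 + Q$1$2 * P$2$1 = 1" "Q$1$1 * P$1$2 + Q$1$2 * P$2$2 = 0"
    "Q$2$1 * P$1$1 + Q$2$2 * P$2$1 = 0" "Q$2$1 * P$1$2 + Q$2$2 * P$2$2 = 1"
    using QP by (simp_all add: mat2_simps)
  have v: "v$1 = Q$1$1 * w1 + Q$1$2 * w2" "v$2 = Q$2$1 * w1 + Q$2$2 * w2"
  proof -
    have "Q$i$1 * w1 + Q$i$2 * w2 = (Q$i$1 * P$1$1 + Q$i$2 * P$2$1) * v$1 + (Q$i$1 * P$1$2 + Q$i$2 * P$2$2) * v$2" for i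
      by (simp add: w1_def w2_def algebra_simps)
    then show "v$1 = Q$1$1 * w1 + Q$1$2 * w2" "v$2 = Q$2$1 * w1 + Q$2$2 * w2" by (simp_all add: qp)
  qed
  have "w1 \<in> span2 (v$1) (v$2)" "w2 \<in> span2 (v$1) (v$2)"
    "v$1 \<in> span2 w1 w2" "v$2 \<in> span2 w1 w2"
    using P Q v unfolding span2_def w1_def w2_def by blast+
  then have span_w: "span2 (v$1) (v$2) = span2 w1 w2"
    using span2_subset[OF submodule_span2] by (intro equalityI) auto
  have w0: "w1 \<noteq> 0 \<or> w2 \<noteq> 0" using v admissible_nonzero(1)[OF adm(1)] by auto
  have wK: "w1 \<in> frac_field" "w2 \<in> frac_field"
    unfolding w1_def w2_def using P adm(1)
    by (auto simp: admissible_def intro!: frac_field_add frac_field_mult intro: frac_field_R)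
  have vK: "v'$1 \<in> frac_field" "v'$2 \<in> frac_field" using adm(2) by (auto simp: admissible_def)
  obtain s where s: "s \<in> frac_field" "s \<noteq> 0" "w1 = s * v'$1" "w2 = s * v'$2"
  proof (cases "v'$1 = 0")
    case True
    then have "v'$2 \<noteq> 0" using admissible_nonzero(1)[OF adm(2)] by simp
    then have "w1 = 0" using par True by simp
    show thesis
      by (rule that[of "w2 / v'$2"]) (use \<open>v'$2 \<noteq> 0\<close> \<open>w1 = 0\<close> True w0 wK vK in \<open>auto intro: frac_field_divide\<close>)
  next
    case False
    have w2: "w2 = w1 / v'$1 * v'$2" using par False by (simp add: field_simps)
    show thesis
      by (rule that[of "w1 / v'$1"]) (use False w2 w0 wK vK in \<open>auto intro: frac_field_divide\<close>)
  qed
  have "span2 (v$1) (v$2) = (*) s ` span2 (v'$1) (v'$2)"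
    unfolding span_w span2_scale s(3,4) ..
  then show "homothety_class (span2 (v$1) (v$2)) = homothety_class (span2 (v'$1) (v'$2))"
    unfolding homothety_class_eq_iff using s by blast
qed

end

section \<open>Completeness of the two invariants\<close>

context cyclic_character
begin

lemma rdvd_lam_iff: "rdvd lam x \<longleftrightarrow> x / (\<zeta> - 1) \<in> Z"
proof -
  have eq: "x = lam * (- (x / (\<zeta> - 1)))" for x
    using zeta_neq_1 by (simp add: lam_def field_simps)
  show ?thesis
  proof
    assume "rdvd lam x"
    then obtain s where s: "s \<in> Z" "x = lam * s" unfolding rdvd_def by blast
    have "x / (\<zeta> - 1) = - s" using s(2) zeta_neq_1 by (simp add: lam_def field_simps)
    then show "x / (\<zeta> - 1) \<in> Z" using s(1) by (simp add: uminus_mem)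
  next
    assume "x / (\<zeta> - 1) \<in> Z"
    then show "rdvd lam x" unfolding rdvd_def using eq[of x] uminus_mem by blast
  qed
qed

lemma span_products_mem:
  assumes "x \<in> span2 a b" "y * a \<in> Z" "y * b \<in> Z"
  shows "y * x \<in> Z"
proof -
  obtain s t where st: "x = s * a + t * b" "s \<in> Z" "t \<in> Z" using assms(1) unfolding span2_def by blast
  have "y * x = s * (y * a) + t * (y * b)" by (simp add: st algebra_simps)
  then show ?thesis using st assms by (simp add: add_mem mult_mem)
qed

lemma span_products_rdvd:
  assumes "x \<in> span2 a b" "rdvd l (y * a)" "rdvd l (y * b)"
  shows "rdvd l (y * x)"
proof -
  obtain s t where st: "x = s * a + t * b" "s \<in> Z" "t \<in> Z" using assms(1) unfolding span2_def by blast
  have "y * x = s * (y * a) + t * (y * b)" by (simp add: st algebra_simps)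
  then show ?thesis using st assms by (simp add: rdvd_add rdvd_mult')
qed

lemma component_in_span2: "v$i \<in> span2 (v$1) (v$2)" for v :: "complex^2"
  using exhaust_2[of i] span2_gens(1)[of "v$1" "v$2"] span2_gens(2)[of "v$2" "v$1"] by auto

text \<open>If neither pair splits, then the matrices \<open>v' u\<^sup>T\<close> and \<open>u' v\<^sup>T\<close> have rank one over the field
  \<open>Z / lam\<close> with the same image and kernel, so they are proportional, and the factor lifts to a unit.\<close>

lemma proportional_mod_lam:
  assumes adm: "admissible v u" "admissible v' u'"
    and span: "span2 (v$1) (v$2) = span2 (v'$1) (v'$2)"
    and split: "split_pair v u \<longleftrightarrow> split_pair v' u'"
  obtains \<delta> \<delta>' where "\<delta> \<in> Z" "\<delta>' \<in> Z" "\<delta> * \<delta>' = 1"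
    "\<forall>i j. rdvd lam (v'$i * u$j - \<delta> * (u'$i * v$j))"
proof -
  have int: "u$j * v$i \<in> Z" "u'$j * v'$i \<in> Z" for i j using adm by (auto simp: admissible_def)
  have vs: "v'$i \<in> span2 (v$1) (v$2)" "v$i \<in> span2 (v'$1) (v'$2)" for i
    using component_in_span2[of v' i] component_in_span2[of v i] span by simp_all
  define x where "x = (\<lambda>i j. u$j * v'$i)"
  define y where "y = (\<lambda>i j. u'$i * v$j)"
  have xZ: "x i j \<in> Z" for i j unfolding x_def by (rule span_products_mem[OF vs(1) int(1) int(1)])
  have yZ: "y i j \<in> Z" for i j unfolding y_def by (rule span_products_mem[OF vs(2) int(2) int(2)])
  have "\<exists>\<delta> \<delta>'. \<delta> \<in> Z \<and> \<delta>' \<in> Z \<and> \<delta> * \<delta>' = 1 \<and> (\<forall>i j. rdvd lam (x i j - \<delta> * y i j))"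
  proof (cases "split_pair v u")
    case True
    then have d: "rdvd lam (u$j * v$i)" "rdvd lam (u'$j * v'$i)" for i j
      using split by (auto simp: split_pair_def)
    have "rdvd lam (x i j)" for i j
      unfolding x_def by (rule span_products_rdvd[OF vs(1) d(1) d(1)])
    moreover have "rdvd lam (y i j)" for i j
      unfolding y_def by (rule span_products_rdvd[OF vs(2) d(2) d(2)])
    ultimately show ?thesis using one_mem rdvd_diff by (intro exI[of _ 1]) auto
  next
    case False
    then have ns: "\<not> split_pair v u" "\<not> split_pair v' u'" using split by auto
    have x_ex: "\<not> (\<forall>i j. rdvd lam (x i j))"
    proof
      assume "\<forall>i j. rdvd lam (x i j)"
      then have "rdvd lam (u$j * v$i)" for i j
        unfolding x_def by (intro span_products_rdvd[OF vs(2)]) auto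
      then show False using ns(1) by (auto simp: split_pair_def)
    qed
    have "\<exists>i j. \<not> rdvd lam (y i j)"
    proof (rule ccontr)
      assume "\<not> (\<exists>i j. \<not> rdvd lam (y i j))"
      then have "rdvd lam (u'$j * v'$i)" for i j
        unfolding y_def by (intro span_products_rdvd[OF vs(1)]) auto
      then show False using ns(2) by (auto simp: split_pair_def)
    qed
    then obtain k l where kl: "\<not> rdvd lam (y k l)" by blast
    have det: "v$1 * u$2 - v$2 * u$1 = \<zeta> - 1" "v'$1 * u'$2 - v'$2 * u'$1 = \<zeta> - 1"
      using adm by (auto simp: admissible_def)
    have self: "rdvd lam (\<zeta> - 1)" "rdvd lam (- (\<zeta> - 1))"
      unfolding rdvd_lam_iff using zeta_neq_1 by (auto simp: one_mem uminus_mem simp del: minus_diff_eq)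
    \<comment> \<open>By the normalisation the antisymmetric parts of \<open>u v\<^sup>T\<close> and
      \<open>u' v'\<^sup>T\<close> consist of 0 and \<open>\<zeta> - 1\<close> up to sign, so both
      matrices are symmetric modulo \<open>lam\<close>. This makes the minors below vanish.\<close>
    have cross: "rdvd lam (u$j * v$i - u$i * v$j)" "rdvd lam (u'$j * v'$i - u'$i * v'$j)" for i j
    proof -
      have "u$j * v$i - u$i * v$j \<in> {0, \<zeta> - 1, - (\<zeta> - 1)}"
        unfolding det(1)[symmetric] using exhaust_2[of i] exhaust_2[of j] by (auto simp: mult.commute)
      moreover have "u'$j * v'$i - u'$i * v'$j \<in> {0, \<zeta> - 1, - (\<zeta> - 1)}"
        unfolding det(2)[symmetric] using exhaust_2[of i] exhaust_2[of j] by (auto simp: mult.commute)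
      ultimately show "rdvd lam (u$j * v$i - u$i * v$j)" "rdvd lam (u'$j * v'$i - u'$i * v'$j)"
        using self rdvd_0 by auto
    qed
    have minors: "rdvd lam (x i j * y k l - x k l * y i j)" for i j
    proof -
      have "x i j * y k l - x k l * y i j
          = (u$j * v$l - u$l * v$j) * (u'$k * v'$i) + (u$l * v$j) * (u'$k * v'$i - u'$i * v'$k)"
        by (simp add: x_def y_def algebra_simps)
      then show ?thesis
        using rdvd_add[OF rdvd_mult[OF cross(1) int(2)] rdvd_mult'[OF cross(2) int(1)]] by simp
    qed
    \<comment> \<open>The unit \<open>\<beta>\<close> stands in for the pivot \<open>y k l\<close>,
      so that \<open>\<beta>'\<close> divides by it modulo \<open>lam\<close>; with
      \<open>\<alpha>\<close> standing in for \<open>x k l\<close>, the proportionality factor is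
      \<open>\<alpha> * \<beta>'\<close>.\<close>
    obtain \<beta> \<beta>' where \<beta>: "\<beta> \<in> Z" "\<beta>' \<in> Z" "\<beta> * \<beta>' = 1" "rdvd lam (y k l - \<beta>)"
      by (rule residue_lifts_to_unit[OF yZ kl])
    have x_eq: "x i j = (x i j * y k l - x k l * y i j) * \<beta>' - (x i j * \<beta>') * (y k l - \<beta>) + x k l * (y i j * \<beta>')" for i j
    proof -
      have "x i j = x i j * (\<beta> * \<beta>')" by (simp add: \<beta>(3))
      also have "\<dots> = (x i j * y k l - x k l * y i j) * \<beta>' - (x i j * \<beta>') * (y k l - \<beta>) + x k l * (y i j * \<beta>')"
        by (simp add: algebra_simps)
      finally show ?thesis .
    qed
    have x_cong: "rdvd lam (x i j - x k l * (y i j * \<beta>'))" for i j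
    proof -
      have "x i j - x k l * (y i j * \<beta>') = (x i j * y k l - x k l * y i j) * \<beta>' - (x i j * \<beta>') * (y k l - \<beta>)"
        by (subst diff_eq_eq) (rule x_eq)
      then show ?thesis
        using rdvd_diff[OF rdvd_mult[OF minors \<beta>(2)] rdvd_mult'[OF \<beta>(4) mult_mem[OF xZ \<beta>(2)]]] by metis
    qed
    have "\<not> rdvd lam (x k l)"
    proof
      assume d: "rdvd lam (x k l)"
      have "rdvd lam (x i j)" for i j
        using rdvd_add[OF x_cong[of i j] rdvd_mult[OF d mult_mem[OF yZ[of i j] \<beta>(2)]]] by simp
      then show False using x_ex by blast
    qed
    then obtain \<alpha> \<alpha>' where \<alpha>: "\<alpha> \<in> Z" "\<alpha>' \<in> Z" "\<alpha> * \<alpha>' = 1" "rdvd lam (x k l - \<alpha>)"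
      using residue_lifts_to_unit[OF xZ] by blast
    have "rdvd lam (x i j - \<alpha> * \<beta>' * y i j)" for i j
    proof -
      have "x i j - \<alpha> * \<beta>' * y i j = (x i j - x k l * (y i j * \<beta>')) + (x k l - \<alpha>) * (y i j * \<beta>')"
        by (simp add: algebra_simps)
      then show ?thesis using rdvd_add[OF x_cong rdvd_mult[OF \<alpha>(4) mult_mem[OF yZ \<beta>(2)]]] by metis
    qed
    moreover have "\<alpha> * \<beta>' * (\<alpha>' * \<beta>) = 1"
    proof -
      have "\<alpha> * \<beta>' * (\<alpha>' * \<beta>) = (\<alpha> * \<alpha>') * (\<beta> * \<beta>')" by (simp add: ac_simps)
      then show ?thesis by (simp add: \<alpha>(3) \<beta>(3))
    qed
    ultimately show ?thesis using mult_mem[OF \<alpha>(1) \<beta>(2)] mult_mem[OF \<alpha>(2) \<beta>(1)] by blast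
  qed
  then obtain \<delta> \<delta>' where "\<delta> \<in> Z" "\<delta>' \<in> Z" "\<delta> * \<delta>' = 1" and d: "\<And>i j. rdvd lam (x i j - \<delta> * y i j)" by blast
  moreover have "rdvd lam (v'$i * u$j - \<delta> * (u'$i * v$j))" for i j
    using d[of i j] by (simp add: x_def y_def mult.commute[of "v'$i"])
  ultimately show thesis using that by blast
qed

text \<open>The conjugating matrix maps \<open>v\<close> to \<open>v'\<close> and \<open>u\<close> to \<open>\<delta> u'\<close>.\<close>

lemma same_span_imp_conjugate:
  assumes adm: "admissible v u" "admissible v' u'"
    and span: "span2 (v$1) (v$2) = span2 (v'$1) (v'$2)"
    and split: "split_pair v u \<longleftrightarrow> split_pair v' u'"
  shows "conjugate_homs C (GL Z) (rep v u) (rep v' u')"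
proof -
  obtain \<delta> \<delta>' where \<delta>: "\<delta> \<in> Z" "\<delta>' \<in> Z" "\<delta> * \<delta>' = 1"
      "\<forall>i j. rdvd lam (v'$i * u$j - \<delta> * (u'$i * v$j))"
    by (rule proportional_mod_lam[OF assms])
  define z where "z = \<zeta> - 1"
  have z0: "z \<noteq> 0" using zeta_neq_1 by (simp add: z_def)
  have det: "v$1 * u$2 - v$2 * u$1 = z" "v'$1 * u'$2 - v'$2 * u'$1 = z"
    using adm by (auto simp: admissible_def z_def)
  \<comment> \<open>Up to order and sign these are the entries of the matrix sending
    \<open>v\<close> to \<open>v'\<close> and \<open>u\<close> to \<open>\<delta> u'\<close>, by
    Cramer's rule with determinant \<open>z\<close>. The congruence modulo \<open>lam\<close> is
    what makes the division by \<open>z\<close> possible in \<open>Z\<close>.\<close>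
  define m where "m = (\<lambda>i j. (v'$i * u$j - \<delta> * (u'$i * v$j)) / z)"
  have mZ: "m i j \<in> Z" for i j using \<delta>(4) unfolding m_def z_def rdvd_lam_iff by blast
  define P :: "complex^2^2" where "P = vector [vector [m 1 2, - m 1 1], vector [m 2 2, - m 2 1]]"
  \<comment> \<open>The determinant of \<open>P\<close> is \<open>\<delta>\<close>, so its inverse
    is \<open>\<delta>'\<close> times the adjugate.\<close>
  define Q :: "complex^2^2" where
    "Q = vector [vector [- (\<delta>' * m 2 1), \<delta>' * m 1 1], vector [- (\<delta>' * m 2 2), \<delta>' * m 1 2]]"
  have PZ: "P \<in> matrices Z" and QZ: "Q \<in> matrices Z"
    using mZ \<delta>(2) by (auto simp: P_def Q_def forall_2 intro: ring_mems)
  have mz: "m i j * z = v'$i * u$j - \<delta> * (u'$i * v$j)" for i j using z0 by (simp add: m_def)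
  have "(m 1 1 * m 2 2 - m 1 2 * m 2 1) * (z * z) = (m 1 1 * z) * (m 2 2 * z) - (m 1 2 * z) * (m 2 1 * z)"
    by (simp add: algebra_simps)
  also have "\<dots> = \<delta> * ((v$1 * u$2 - v$2 * u$1) * (v'$1 * u'$2 - v'$2 * u'$1))"
    unfolding mz by (simp add: algebra_simps)
  also have "\<dots> = \<delta> * (z * z)" unfolding det ..
  finally have "m 1 1 * m 2 2 - m 1 2 * m 2 1 = \<delta>" using z0 by simp
  then have detm: "\<delta>' * (m 1 1 * m 2 2) - \<delta>' * (m 1 2 * m 2 1) = 1"
    using \<delta>(3) by (simp add: mult.commute flip: right_diff_distrib)
  then have PQ: "P ** Q = mat 1"
    by (simp add: mat2_simps P_def Q_def) (simp add: algebra_simps)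
  then have QP: "Q ** P = mat 1" by (simp add: matrix_left_right_inverse)
  have AP: "form v' u' c ** P = P ** form v u c" for c
  proof -
    have "- (m i 1 * u$2) + m i 2 * u$1 = \<delta> * u'$i" for i
    proof -
      have "(- (m i 1 * u$2) + m i 2 * u$1) * z = - ((m i 1 * z) * u$2) + (m i 2 * z) * u$1"
        by (simp add: algebra_simps)
      also have "\<dots> = \<delta> * u'$i * (v$1 * u$2 - v$2 * u$1)" unfolding mz by (simp add: algebra_simps)
      finally show ?thesis using z0 unfolding det by simp
    qed
    then have Pu: "m i 2 * u$1 = \<delta> * u'$i + m i 1 * u$2" for i by (simp add: algebra_simps)
    have "v'$1 * m 2 j - v'$2 * m 1 j = - (\<delta> * v$j)" for j
    proof -
      have "(v'$1 * m 2 j - v'$2 * m 1 j) * z = v'$1 * (m 2 j * z) - v'$2 * (m 1 j * z)"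
        by (simp add: algebra_simps)
      also have "\<dots> = - (\<delta> * v$j) * (v'$1 * u'$2 - v'$2 * u'$1)" unfolding mz by (simp add: algebra_simps)
      finally show ?thesis unfolding det mult_right_cancel[OF z0] .
    qed
    then have vP: "v'$1 * m 2 j = v'$2 * m 1 j - \<delta> * v$j" for j by (simp add: algebra_simps)
    have 1: "(form v' u' c ** P) $ i $ j = P$i$j + c * u'$i * (v'$1 * P$2$j - v'$2 * P$1$j)" for i j
      using exhaust_2[of i] by (auto simp: matrix_matrix_mult_def sum_2 form_nth algebra_simps)
    have 2: "(P ** form v u c) $ i $ 1 = P$i$1 - c * (P$i$1 * u$1 + P$i$2 * u$2) * v$2"
      "(P ** form v u c) $ i $ 2 = P$i$2 + c * (P$i$1 * u$1 + P$i$2 * u$2) * v$1" for i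
      by (auto simp: matrix_matrix_mult_def sum_2 form_nth algebra_simps)
    have 3: "P$i$1 * u$1 + P$i$2 * u$2 = \<delta> * u'$i" for i
      using exhaust_2[of i] Pu[of 1] Pu[of 2] by (auto simp: P_def)
    have 4: "v'$1 * P$2$1 - v'$2 * P$1$1 = - (\<delta> * v$2)" "v'$1 * P$2$2 - v'$2 * P$1$2 = \<delta> * v$1"
      using vP[of 1] vP[of 2] by (auto simp: P_def)
    show ?thesis
      by (simp add: vec_eq_iff forall_2 1 2 3 4)
  qed
  show ?thesis
    unfolding conjugate_homs_iff[OF complex_subring_Z]
  proof (rule bexI[of _ P], rule bexI[of _ Q], intro conjI ballI)
    fix g assume g: "g \<in> carrier C"
    have "P ** form v u (cc g) ** Q = form v' u' (cc g) ** (P ** Q)"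
      by (simp add: matrix_mul_assoc AP)
    then show "rep v' u' g = P ** rep v u g ** Q" using g by (simp add: rep_def PQ)
  qed (use PZ QZ PQ QP in auto)
qed

text \<open>Replacing \<open>(v', u')\<close> by \<open>(s v', u' / s)\<close> leaves all products,
  hence the form and the splitting, unchanged, and scales the ideal by \<open>s\<close>. This
  reduces homothetic ideals to equal ones.\<close>

lemma same_invariants_imp_conjugate:
  assumes adm: "admissible v u" "admissible v' u'"
    and hom: "homothety_class (span2 (v$1) (v$2)) = homothety_class (span2 (v'$1) (v'$2))"
    and split: "split_pair v u \<longleftrightarrow> split_pair v' u'"
  shows "conjugate_homs C (GL Z) (rep v u) (rep v' u')"
proof -
  obtain s where s: "s \<in> frac_field" "s \<noteq> 0" "span2 (v$1) (v$2) = (*) s ` span2 (v'$1) (v'$2)"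
    using hom unfolding homothety_class_eq_iff by blast
  define w :: "complex^2" where "w = (\<chi> i. s * v'$i)"
  define x :: "complex^2" where "x = (\<chi> i. u'$i / s)"
  have xw: "x$i * w$j = u'$i * v'$j" for i j using s(2) by (simp add: x_def w_def)
  have wx: "w$i * x$j = v'$i * u'$j" for i j using xw[of j i] by (simp add: mult.commute)
  have "admissible w x"
    using adm(2) s(1) unfolding admissible_def xw wx
    by (auto simp: x_def w_def intro!: frac_field_mult frac_field_divide)
  moreover have "span2 (v$1) (v$2) = span2 (w$1) (w$2)" by (simp add: s(3) span2_scale w_def)
  moreover have "split_pair v u \<longleftrightarrow> split_pair w x" using split by (simp add: split_pair_def xw)
  ultimately have "conjugate_homs C (GL Z) (rep v u) (rep w x)" by (rule same_span_imp_conjugate[OF adm(1)])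
  moreover have "form w x c = form v' u' c" for c
    by (simp add: form_def mult.assoc xw)
  then have "rep w x = rep v' u'" by (simp add: rep_def)
  ultimately show ?thesis by simp
qed

section \<open>Existence of forms with given invariants, and the count\<close>

lemma fractional_inv_ideal_in_frac_field:
  assumes "fractional J" "x \<in> inv_ideal J" shows "x \<in> frac_field"
proof -
  obtain y where y: "y \<in> J" "y \<noteq> 0" by (rule fractional_nonzero[OF assms(1)])
  have "x = (y * x) / y" using y(2) by simp
  also have "\<dots> \<in> frac_field"
    using fractional_in_frac_field[OF assms(1) y(1)] mult_inv_ideal[OF y(1) assms(2)]
    by (rule frac_field_divide[OF frac_field_R, rotated])
  finally show ?thesis .
qed

text \<open>The form of invariant \<open>(J, True)\<close> has \<open>x = 0\<close>; for \<open>(J, False)\<close>, an \<open>x\<close> with \<open>x J\<^sup>2\<close> contained in \<open>Z\<close> but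
  not in \<open>lam Z\<close> is found among the terms of \<open>1 = (a d - b c)\<^sup>2\<close>.\<close>

lemma invariants_exhausted:
  assumes J: "fractional J"
  obtains v u where "admissible v u" "span2 (v$1) (v$2) = J" "split_pair v u \<longleftrightarrow> s"
proof -
  obtain a b c d where ab: "J = span2 a b" and cd: "c \<in> inv_ideal J" "d \<in> inv_ideal J"
    and det: "a * d - b * c = 1"
    by (rule fractional_unimodular_generators[OF J])
  have abJ: "a \<in> J" "b \<in> J" unfolding ab by (rule span2_gens)+
  have Z: "c * a \<in> Z" "c * b \<in> Z" "d * a \<in> Z" "d * b \<in> Z"
    using mult_inv_ideal abJ cd by (simp_all add: mult.commute)
  define v :: "complex^2" where "v = vector [a, b]"
  \<comment> \<open>All vectors forming determinant \<open>\<zeta> - 1\<close> with \<open>v\<close>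
    differ by multiples of \<open>v\<close>, so \<open>x\<close> is the only freedom. The part with
    \<open>c\<close> and \<open>d\<close> contributes multiples of \<open>lam\<close> to the
    products; hence \<open>x\<close> alone decides about splitting.\<close>
  define u where "u = (\<lambda>x. vector [(\<zeta> - 1) * c + x * a, (\<zeta> - 1) * d + x * b] :: complex^2)"
  have zZ: "\<zeta> - 1 \<in> Z" using zeta_mem one_mem by (rule diff_mem)
  have lz: "rdvd lam ((\<zeta> - 1) * y)" if "y \<in> Z" for y
    using that zeta_neq_1 by (simp add: rdvd_lam_iff)
  have K: "a \<in> frac_field" "b \<in> frac_field" "c \<in> frac_field" "d \<in> frac_field"
    using fractional_in_frac_field[OF J] abJ fractional_inv_ideal_in_frac_field[OF J] cd by auto
  have uv: "u x $ 1 * v $ 1 = (\<zeta> - 1) * (c * a) + x * a * a" "u x $ 1 * v $ 2 = (\<zeta> - 1) * (c * b) + x * a * b"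
    "u x $ 2 * v $ 1 = (\<zeta> - 1) * (d * a) + x * a * b" "u x $ 2 * v $ 2 = (\<zeta> - 1) * (d * b) + x * b * b" for x
    by (simp_all add: u_def v_def algebra_simps)
  have adm: "admissible v (u x)"
    if x: "x \<in> frac_field" "x * a * a \<in> Z" "x * a * b \<in> Z" "x * b * b \<in> Z" for x
    unfolding admissible_def
  proof (intro conjI allI)
    show "v$i \<in> frac_field" "u x $ i \<in> frac_field" for i
      using exhaust_2[of i] K x(1) frac_field_R[OF zZ]
      by (auto simp: v_def u_def intro!: frac_field_add frac_field_mult)
    have "v$1 * u x $ 2 - v$2 * u x $ 1 = (\<zeta> - 1) * (a * d - b * c)"
      by (simp add: v_def u_def algebra_simps)
    then show "v$1 * u x $ 2 - v$2 * u x $ 1 = \<zeta> - 1" by (simp add: det)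
    have "u x $ 1 * v $ 1 \<in> Z" "u x $ 1 * v $ 2 \<in> Z" "u x $ 2 * v $ 1 \<in> Z" "u x $ 2 * v $ 2 \<in> Z"
      unfolding uv using x Z zZ by (auto intro!: add_mem mult_mem[OF zZ])
    then show "u x $ i * v $ j \<in> Z" for i j using exhaust_2[of i] exhaust_2[of j] by auto
  qed
  have span: "span2 (v$1) (v$2) = J" by (simp add: v_def ab)
  show thesis
  proof (cases s)
    case True
    have "rdvd lam (u 0 $ 1 * v $ 1)" "rdvd lam (u 0 $ 1 * v $ 2)" "rdvd lam (u 0 $ 2 * v $ 1)" "rdvd lam (u 0 $ 2 * v $ 2)"
      unfolding uv using lz Z by simp_all
    then have "split_pair v (u 0)" by (simp add: split_pair_def forall_2)
    moreover have "admissible v (u 0)"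
      using frac_field_R[OF zero_mem] zero_mem by (intro adm) auto
    ultimately show thesis using that span True by blast
  next
    case False
    have "\<exists>x\<in>{d * d, c * d, c * c}. \<not> (rdvd lam (x * a * a) \<and> rdvd lam (x * a * b) \<and> rdvd lam (x * b * b))"
    proof (rule ccontr)
      assume "\<not> ?thesis"
      then have r: "rdvd lam (d * d * a * a)" "rdvd lam (c * d * a * b)" "rdvd lam (c * c * b * b)" by auto
      have "1 = (a * d - b * c) * (a * d - b * c)" by (simp add: det)
      also have "\<dots> = (d * d * a * a - 2 * (c * d * a * b)) + c * c * b * b" by (simp add: algebra_simps)
      finally have "1 = (d * d * a * a - 2 * (c * d * a * b)) + c * c * b * b" .
      moreover have "rdvd lam ((d * d * a * a - 2 * (c * d * a * b)) + c * c * b * b)"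
        using of_nat_mem[of 2] by (intro rdvd_add rdvd_diff rdvd_mult' r) simp
      ultimately have "rdvd lam 1" by (rule ssubst)
      then show False using not_lam_dvd_1 by simp
    qed
    then obtain x where x: "x \<in> {d * d, c * d, c * c}"
      and nd: "\<not> (rdvd lam (x * a * a) \<and> rdvd lam (x * a * b) \<and> rdvd lam (x * b * b))" by blast
    have prods: "(d * a) * (d * a) \<in> Z" "(d * a) * (d * b) \<in> Z" "(d * b) * (d * b) \<in> Z"
      "(c * a) * (d * a) \<in> Z" "(c * a) * (d * b) \<in> Z" "(c * b) * (d * b) \<in> Z"
      "(c * a) * (c * a) \<in> Z" "(c * a) * (c * b) \<in> Z" "(c * b) * (c * b) \<in> Z"
      using Z by (auto intro: mult_mem)
    have "x * a * a \<in> Z" "x * a * b \<in> Z" "x * b * b \<in> Z"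
      using x prods by (auto simp: ac_simps)
    moreover have "x \<in> frac_field" using x K frac_field_mult by auto
    ultimately have "admissible v (u x)" by (intro adm)
    moreover have "\<not> split_pair v (u x)"
    proof
      assume "split_pair v (u x)"
      then have r: "rdvd lam (u x $ i * v $ j)" for i j by (auto simp: split_pair_def)
      have "rdvd lam (x * a * a)" "rdvd lam (x * a * b)" "rdvd lam (x * b * b)"
        using rdvd_diff[OF r[of 1 1] lz[OF Z(1)]] rdvd_diff[OF r[of 1 2] lz[OF Z(2)]]
          rdvd_diff[OF r[of 2 2] lz[OF Z(4)]] unfolding uv by simp_all
      then show False using nd by simp
    qed
    ultimately show thesis using that span False by blast
  qed
qed

text \<open>A choice, since a form determines its pair only up to scaling. Two pairs of the same
  form have equal invariants because the form is conjugate to itself.\<close>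

definition form_invariant :: "('a \<Rightarrow> complex^2^2) \<Rightarrow> complex set set \<times> bool" where
  "form_invariant \<phi> = (SOME t. \<exists>v u. admissible v u \<and> \<phi> = rep v u \<and>
     t = (homothety_class (span2 (v$1) (v$2)), split_pair v u))"

lemma conjugate_homs_refl: "conjugate_homs C (GL Z) \<phi> (\<phi> :: 'a \<Rightarrow> complex^2^2)"
proof -
  have "(mat 1 :: complex^2^2) \<in> matrices Z" by (simp add: mat_def zero_mem one_mem)
  then show ?thesis
    unfolding conjugate_homs_iff[OF complex_subring_Z] by (intro bexI[of _ "mat 1"]) auto
qed

lemma form_invariant_rep:
  assumes "admissible v u"
  shows "form_invariant (rep v u) = (homothety_class (span2 (v$1) (v$2)), split_pair v u)"
  unfolding form_invariant_def
proof (rule some_equality)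
  fix t assume "\<exists>v' u'. admissible v' u' \<and> rep v u = rep v' u' \<and>
     t = (homothety_class (span2 (v'$1) (v'$2)), split_pair v' u')"
  then obtain v' u' where *: "admissible v' u'" "rep v u = rep v' u'"
    "t = (homothety_class (span2 (v'$1) (v'$2)), split_pair v' u')" by blast
  have "conjugate_homs C (GL Z) (rep v u) (rep v' u')" unfolding *(2) by (rule conjugate_homs_refl)
  then show "t = (homothety_class (span2 (v$1) (v$2)), split_pair v u)"
    using conjugate_imp_same_invariants[OF assms *(1)] *(3) by simp
qed (use assms in blast)

lemma conjugate_iff_form_invariant_eq:
  assumes "\<phi> \<in> forms" "\<psi> \<in> forms"
  shows "conjugate_homs C (GL Z) \<phi> \<psi> \<longleftrightarrow> form_invariant \<phi> = form_invariant \<psi>"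
proof -
  obtain v u where vu: "admissible v u" "\<phi> = rep v u" by (rule form_in_forms_exhaust[OF assms(1)])
  obtain v' u' where vu': "admissible v' u'" "\<psi> = rep v' u'" by (rule form_in_forms_exhaust[OF assms(2)])
  show ?thesis
    unfolding vu(2) vu'(2) form_invariant_rep[OF vu(1)] form_invariant_rep[OF vu'(1)]
    using conjugate_imp_same_invariants[OF vu(1) vu'(1)] same_invariants_imp_conjugate[OF vu(1) vu'(1)]
    by auto
qed

lemma form_invariant_image:
  "form_invariant ` forms = {homothety_class J | J. fractional J} \<times> UNIV"
proof (intro equalityI subsetI)
  fix t assume "t \<in> form_invariant ` forms"
  then obtain \<phi> where \<phi>: "\<phi> \<in> forms" "t = form_invariant \<phi>" by blast
  obtain v u where vu: "admissible v u" "\<phi> = rep v u" by (rule form_in_forms_exhaust[OF \<phi>(1)])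
  show "t \<in> {homothety_class J | J. fractional J} \<times> UNIV"
    using \<phi>(2) vu(2) form_invariant_rep[OF vu(1)] fractional_admissible[OF vu(1)] by auto
next
  fix t :: "complex set set \<times> bool"
  assume "t \<in> {homothety_class J | J. fractional J} \<times> UNIV"
  then obtain J s where t: "t = (homothety_class J, s)" "fractional J" by auto
  obtain v u where vu: "admissible v u" "span2 (v$1) (v$2) = J" "split_pair v u \<longleftrightarrow> s"
    by (rule invariants_exhausted[OF t(2)])
  have "t = form_invariant (rep v u)" using form_invariant_rep[OF vu(1)] vu t by simp
  then show "t \<in> form_invariant ` forms" using rep_in_forms[OF vu(1)] by blast
qed

lemma card_integral_form_classes:
  "finite (integral_form_classes C frac_field (one_plus_character C chi))"
  "card (integral_form_classes C frac_field (one_plus_character C chi)) = 2 * class_number frac_field"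
proof -
  let ?r = "{(\<phi>, \<psi>). \<phi> \<in> forms \<and> \<psi> \<in> forms \<and> conjugate_homs C (GL Z) \<phi> \<psi>}"
  let ?T = "{homothety_class J | J. fractional J} \<times> (UNIV :: bool set)"
  have "?r = {(\<phi>, \<psi>). \<phi> \<in> forms \<and> \<psi> \<in> forms \<and> form_invariant \<phi> = form_invariant \<psi>}"
    using conjugate_iff_form_invariant_eq by blast
  then have bij: "bij_betw (\<lambda>t. {\<phi> \<in> forms. form_invariant \<phi> = t}) ?T (forms // ?r)"
    by (intro card_quotient_by_invariant form_invariant_image)
  have eq: "integral_form_classes C frac_field (one_plus_character C chi) = forms // ?r"
    by (simp add: integral_form_classes_def integers_of_frac_field)
  have "finite ?T" using finite_homothety_classes by simp
  then show "finite (integral_form_classes C frac_field (one_plus_character C chi))"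
    unfolding eq using bij_betw_finite[OF bij] by simp
  have "card (forms // ?r) = card ?T" using bij_betw_same_card[OF bij] by simp
  also have "\<dots> = 2 * class_number frac_field"
    by (simp add: class_number_def order_def class_group_carrier[OF integers_of_frac_field[symmetric]]
        card_cartesian_product)
  finally show "card (integral_form_classes C frac_field (one_plus_character C chi)) = 2 * class_number frac_field"
    unfolding eq .
qed

section \<open>The field of values of the character\<close>

lemma character_field_eq: "character_field C chi = frac_field"
proof (intro equalityI subsetI)
  fix x assume "x \<in> character_field C chi"
  then show "x \<in> frac_field"
    unfolding character_field_def
  proof induction
    case one
    show ?case by (simp add: complex_ring_simps frac_field_R one_mem)
  next
    case (incl h)
    then consider "h \<in> \<rat>" | g where "g \<in> carrier C" "h = chi g" by blast
    then show ?case
    proof cases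
      case 1
      then obtain a b where "h = of_int a / of_int b" by (elim Rats_cases') blast
      then show ?thesis by (simp add: frac_field_divide frac_field_R of_int_mem)
    next
      case 2
      then obtain k where "h = \<zeta> ^ k" using chi_power by blast
      then show ?thesis by (simp add: frac_field_R power_mem zeta_mem)
    qed
  qed (auto simp: complex_ring_simps complex_ring_a_inv complex_ring_m_inv
      intro: frac_field_minus frac_field_inverse frac_field_add frac_field_mult)
next
  let ?F = "character_field C chi"
  have incl: "h \<in> \<rat> \<union> chi ` carrier C \<Longrightarrow> h \<in> ?F" for h
    unfolding character_field_def by (rule generate_field.incl)
  have add: "x + y \<in> ?F" and mult: "x * y \<in> ?F" if "x \<in> ?F" "y \<in> ?F" for x y
    using that generate_field.eng_add[of x complex_ring _ y] generate_field.eng_mult[of x complex_ring _ y]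
    unfolding character_field_def by (auto simp: complex_ring_simps)
  have inv: "inverse x \<in> ?F" if "x \<in> ?F" for x
  proof (cases "x = 0")
    case False
    then show ?thesis
      using that generate_field.m_inv[of x complex_ring] unfolding character_field_def
      by (simp add: complex_ring_simps complex_ring_m_inv)
  qed (use that in simp)
  have rat: "x \<in> ?F" if "x \<in> \<rat>" for x by (rule incl) (use that in simp)
  have zeta: "\<zeta> \<in> ?F" using incl[of "chi g0"] g0 chi_g0 by auto
  have pow: "\<zeta> ^ k \<in> ?F" for k
    by (induction k) (auto intro: rat mult zeta)
  have ZF: "x \<in> ?F" if x: "x \<in> Z" for x
  proof -
    obtain a :: "nat \<Rightarrow> int" where "x = (\<Sum>i<n. of_int (a i) * \<zeta> ^ i)" by (rule basis_rep[OF x])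
    have "(\<Sum>i<m. of_int (a i) * \<zeta> ^ i) \<in> ?F" for m
      by (induction m) (auto intro!: add mult pow intro: rat)
    then show ?thesis unfolding \<open>x = _\<close> .
  qed
  fix x assume "x \<in> frac_field"
  then obtain y d where "x = y * inverse d" "y \<in> Z" "d \<in> Z"
    unfolding frac_field_def divide_inverse by blast
  then show "x \<in> ?F" by (simp add: mult inv ZF)
qed

end

section \<open>Passage from characters of cyclic groups to roots of unity\<close>

lemma character_group_simps:
  "carrier (character_group C) = hom C (mult_of complex_ring) \<inter> extensional (carrier C)"
  "f \<otimes>\<^bsub>character_group C\<^esub> h = (\<lambda>g\<in>carrier C. f g * h g)"
  "\<one>\<^bsub>character_group C\<^esub> = (\<lambda>g\<in>carrier C. 1)"
  by (auto simp: character_group_def)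

lemma character_group_pow:
  assumes "group C"
  shows "chi [^]\<^bsub>character_group C\<^esub> (k::nat) = (\<lambda>g\<in>carrier C. chi g ^ k)"
proof -
  interpret G: group "character_group C" by (rule group_character_group[OF assms])
  show ?thesis
    by (induction k) (auto simp: character_group_simps fun_eq_iff mult.commute)
qed

lemma character_mult:
  assumes "chi \<in> carrier (character_group C)" "g \<in> carrier C" "h \<in> carrier C"
  shows "chi (g \<otimes>\<^bsub>C\<^esub> h) = chi g * chi h"
  using assms by (auto simp: character_group_simps hom_def complex_ring_simps)

text \<open>All values are powers of the value at a generator. If that value had order dividing
  \<open>p ^ (r - 1)\<close>, so would all the others, and with them the character itself.\<close>

lemma character_of_cyclic_group:
  fixes C :: "'a monoid"
  assumes "group C" "cyclic_group C" "chi \<in> carrier (character_group C)"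
    and prime: "Factorial_Ring.prime p" and "r \<ge> 1" and ord: "group.ord (character_group C) chi = p ^ r"
  obtains g0 where "cyclic_character p r (chi g0) C chi g0"
proof -
  interpret C: group C by fact
  interpret G: group "character_group C" by (rule group_character_group[OF assms(1)])
  obtain g0 where g0: "g0 \<in> carrier C" "carrier C = range (\<lambda>n::int. g0 [^]\<^bsub>C\<^esub> n)"
    using assms(2) C.cyclic_group by blast
  define \<zeta> where "\<zeta> = chi g0"
  note mult = character_mult[OF assms(3)]
  have "chi [^]\<^bsub>character_group C\<^esub> (p ^ r) = \<one>\<^bsub>character_group C\<^esub>"
    using G.pow_ord_eq_1[OF assms(3)] ord by simp
  then have chi_pow: "chi g ^ (p ^ r) = 1" if "g \<in> carrier C" for g
    using that unfolding character_group_pow[OF assms(1)] character_group_simps by (metis restrict_apply')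
  have p0: "p ^ r > 0" using prime prime_gt_0_nat by simp
  have nonzero: "chi g \<noteq> 0" if "g \<in> carrier C" for g
  proof
    assume "chi g = 0"
    then have "chi g ^ (p ^ r) = 0" using p0 by (simp only: zero_power)
    then show False using chi_pow[OF that] by simp
  qed
  have one: "chi \<one>\<^bsub>C\<^esub> = 1" using mult[of "\<one>\<^bsub>C\<^esub>" "\<one>\<^bsub>C\<^esub>"] nonzero[of "\<one>\<^bsub>C\<^esub>"] by simp
  have nat_pow: "chi (g0 [^]\<^bsub>C\<^esub> k) = \<zeta> ^ k" for k :: nat
    using g0(1) by (induction k) (auto simp: one mult \<zeta>_def mult.commute)
  have chi_power: "\<exists>k. chi g = \<zeta> ^ k" if g: "g \<in> carrier C" for g
  proof -
    obtain i :: int where i: "g = g0 [^]\<^bsub>C\<^esub> i" using g g0(2) by blast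
    show ?thesis
    proof (cases "i \<ge> 0")
      case True
      then have "g = g0 [^]\<^bsub>C\<^esub> nat i" unfolding i int_pow_def2 by simp
      then show ?thesis using nat_pow by blast
    next
      case False
      define m where "m = nat (- i)"
      have "g = inv\<^bsub>C\<^esub> (g0 [^]\<^bsub>C\<^esub> m)" unfolding i int_pow_def2 m_def using False by simp
      then have "g \<otimes>\<^bsub>C\<^esub> (g0 [^]\<^bsub>C\<^esub> m) = \<one>\<^bsub>C\<^esub>" using g0(1) by simp
      then have "chi g * \<zeta> ^ m = 1" using mult[OF g, of "g0 [^]\<^bsub>C\<^esub> m"] g0(1) nat_pow one by simp
      \<comment> \<open>Since \<open>\<zeta> ^ (p ^ r)\<close> is 1, a negative exponent
        \<open>-m\<close> can be written as the natural number
        \<open>(p ^ r - 1) * m\<close>.\<close>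
      moreover have "\<zeta> ^ ((p ^ r - 1) * m) * \<zeta> ^ m = 1"
      proof -
        have "(p ^ r - 1) * m + m = p ^ r * m" using p0 by (cases "p ^ r") auto
        then have "\<zeta> ^ ((p ^ r - 1) * m) * \<zeta> ^ m = \<zeta> ^ (p ^ r * m)" by (simp only: flip: power_add)
        also have "\<dots> = 1" using chi_pow[OF g0(1)] by (simp add: power_mult \<zeta>_def)
        finally show ?thesis .
      qed
      ultimately have "chi g * \<zeta> ^ m = \<zeta> ^ ((p ^ r - 1) * m) * \<zeta> ^ m" by simp
      moreover have "\<zeta> ^ m \<noteq> 0" using nonzero[OF g0(1)] by (simp add: \<zeta>_def)
      ultimately have "chi g = \<zeta> ^ ((p ^ r - 1) * m)"
        using mult_right_cancel[of "\<zeta> ^ m"] by blast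
      then show ?thesis by blast
    qed
  qed
  have "\<zeta> ^ (p ^ (r - 1)) \<noteq> 1"
  proof
    assume 1: "\<zeta> ^ (p ^ (r - 1)) = 1"
    have "chi g ^ (p ^ (r - 1)) = 1" if g: "g \<in> carrier C" for g
    proof -
      obtain k where "chi g = \<zeta> ^ k" using chi_power[OF g] by blast
      then have "chi g ^ (p ^ (r - 1)) = (\<zeta> ^ (p ^ (r - 1))) ^ k"
        by (simp add: mult.commute flip: power_mult)
      then show ?thesis unfolding 1 by simp
    qed
    then have "chi [^]\<^bsub>character_group C\<^esub> (p ^ (r - 1)) = \<one>\<^bsub>character_group C\<^esub>"
      unfolding character_group_pow[OF assms(1)] character_group_simps by auto
    then have "p ^ r dvd p ^ (r - 1)" using G.pow_eq_id[OF assms(3)] ord by simp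
    then have "p ^ r \<le> p ^ (r - 1)" using prime prime_gt_0_nat by (intro dvd_imp_le) auto
    moreover have "p ^ (r - 1) < p ^ r" using prime_gt_1_nat[OF prime] assms(5) by (intro power_strict_increasing) auto
    ultimately show False by simp
  qed
  then have "prime_power_root p r \<zeta>"
    using prime assms(5) chi_pow[OF g0(1)] by unfold_locales (auto simp: \<zeta>_def)
  then have "cyclic_character p r \<zeta> C chi g0"
    using g0(1) mult chi_power assms(1)
    by (intro cyclic_character.intro cyclic_character_axioms.intro) (auto simp: \<zeta>_def)
  then show thesis using that by (simp add: \<zeta>_def)
qed

theorem theorem2:
  fixes C :: "'a monoid" and chi :: "'a \<Rightarrow> complex" and p r :: nat and K :: "complex set"
  assumes "group C" and "finite (carrier C)" and "cyclic_group C"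
    and "chi \<in> carrier (character_group C)"
    and "Factorial_Ring.prime p" and "r \<ge> 1" and "group.ord (character_group C) chi = p ^ r"
    and "K = character_field C chi"
  shows "finite (integral_form_classes C K (one_plus_character C chi)) \<and>
         card (integral_form_classes C K (one_plus_character C chi)) = 2 * class_number K"
proof -
  obtain g0 where "cyclic_character p r (chi g0) C chi g0"
    by (rule character_of_cyclic_group[OF assms(1,3-7)])
  then interpret cyclic_character p r "chi g0" C chi g0 .
  show ?thesis
    unfolding assms(8) character_field_eq using card_integral_form_classes by simp
qed

end
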